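(* Let $p$ be a prime and $G=\mathbb Z/p\times\mathbb Z/p$. Let $X$ be a proper geodesic metric space with finite asymptotic dimension which is a (mod $p$) coarse homology $m$-sphere. Then there is no action of $G$ on $X$ by isometries which is tame, semifree at the large scale, and for which $X^G_{bd}$ is a (mod $p$) coarse homology $r$-sphere for some $0\le r<m$.
   Context: A metric space is proper if its closed bounded subsets are compact. Asymptotic dimension: $X$ has asymptotic dimension $\le l$ if for each $R>0$ one can write $X=\bigcup_{k=0}^{l}X_k$, where each $X_k$ is a disjoint union of sets of uniformly bounded diameter which are pairwise at distance at least $R$. Coarse maps: a (not necessarily continuous) map $f\colon X\to Y$ of metric spaces is coarse if preimages of bounded sets are bounded and for every $R>0$ there is $S_R>0$ with $d_X(x_1,x_2)\le R\Rightarrow d_Y(f(x_1),f(x_2))\le S_R$. Two maps $f,f'$ into $Y$ are close if $d_Y(f(x),f'(x))$ is uniformly bounded. A coarse map $f\colon X\to Y$ is a coarse equivalence if there is a coarse map $f'\colon Y\to X$ with $f f'$ and $f'f$ close to the identity maps. Bounded fixed set: for $H$ acting on $(X,d)$ and $k\ge 0$ put $X^H_k=\{x\in X\mid d(x,hx)\le k\ \forall h\in H\}$. The bounded fixed set exists if there are $k_0>0$ and a subspace $Y\subset X^H_{k_0}$ such that the inclusion $Y\to X^H_k$ is a coarse equivalence for all $k\ge k_0$; then one writes $Y=X^H_{bd}$ (well defined up to coarse equivalence). A $G$-action is tame if $X^H_{bd}$ exists for every subgroup $H\le G$. A tame $G$-action is semifree at the large scale if $X^H_{bd}=X^G_{bd}$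 for all non-trivial subgroups $\{e\}\ne H\le G$ (i.e. one and the same subspace of $X$ serves as bounded fixed set for every non-trivial $H$). Coarse homology: a uniform covering of a proper metric space $X$ is a covering by relatively compact sets such that each bounded subset meets only finitely many members. A coarsening system is a sequence of uniform coverings $\{\mathscr U_n\}$ for which there are increasing reals $R_n\to\infty$ such that every $U\in\mathscr U_n$ has diameter $\le R_n$ and $\mathscr U_{n+1}$ has a Lebesgue number $\ge R_n$; it comes with refinement projections $\mathscr U_n\to\mathscr U_{n+1}$, inducing proper simplicial maps of nerves $K(\mathscr U_n)\to K(\mathscr U_{n+1})$. Coarse homology with $\mathbb F_p$ coefficients is $HC_*(X;\mathbb F_p)=\varinjlim H^{lf}_*(K(\mathscr U_n);\mathbb F_p)$, where $H^{lf}_*$ is simplicial homology based on infinite, locally finite chains; it is independent of the coarsening system and invariant under coarse equivalence. A metric space is a (mod $p$) coarse homology $m$-sphere if it has the same $HC_*(-;\mathbb F_p)$ as $\mathbb R^m$, i.e. $HC_q\cong\mathbb F_p$ for $q=m$ and $HC_q=0$ otherwise. *)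

theory Defs
  imports
    "HOL-Analysis.Analysis"
    "HOL-Algebra.Elementary_Groups"
    "HOL-Algebra.Group_Action"
    "HOL-Combinatorics.Permutations"
begin

text \<open>
  A metric space is a subset \<open>S\<close> of a type of class \<^class>\<open>metric_space\<close>, with the restricted
  distance; all notions below are intrinsic to \<open>S\<close>.
\<close>

section \<open>Metric and coarse notions\<close>

definition proper_space :: "'a::metric_space set \<Rightarrow> bool" where
  "proper_space S \<longleftrightarrow>
     (\<forall>B. closedin (top_of_set S) B \<and> bounded B \<longrightarrow> compact B)"

definition geodesic_space :: "'a::metric_space set \<Rightarrow> bool" where
  "geodesic_space S \<longleftrightarrow>
     (\<forall>x\<in>S. \<forall>y\<in>S. \<exists>\<gamma> :: real \<Rightarrow> 'a.
        \<gamma> ` {0..dist x y} \<subseteq> S \<and> \<gamma> 0 = x \<and> \<gamma> (dist x y) = y \<and>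
        (\<forall>s\<in>{0..dist x y}. \<forall>t\<in>{0..dist x y}. dist (\<gamma> s) (\<gamma> t) = \<bar>s - t\<bar>))"

text \<open>
  \<open>\<V> k\<close> is the family of pieces whose union is the set $X_k$. Uniform boundedness is
  spelled out pointwise because \<^const>\<open>diameter\<close> is only meaningful for bounded sets.
\<close>

definition asdim_le :: "'a::metric_space set \<Rightarrow> nat \<Rightarrow> bool" where
  "asdim_le S l \<longleftrightarrow>
     (\<forall>R>0. \<exists>\<V> :: nat \<Rightarrow> 'a set set.
        S = (\<Union>k\<le>l. \<Union>(\<V> k)) \<and>
        (\<forall>k\<le>l. \<exists>D. \<forall>V\<in>\<V> k. \<forall>x\<in>V. \<forall>y\<in>V. dist x y \<le> D) \<and>
        (\<forall>k\<le>l. \<forall>V\<in>\<V> k. \<forall>W\<in>\<V> k. V \<noteq> W \<longrightarrow>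
           V \<inter> W = {} \<and> (\<forall>x\<in>V. \<forall>y\<in>W. R \<le> dist x y)))"

definition finite_asdim :: "'a::metric_space set \<Rightarrow> bool" where
  "finite_asdim S \<longleftrightarrow> (\<exists>l. asdim_le S l)"

definition coarse_map ::
  "'a::metric_space set \<Rightarrow> 'b::metric_space set \<Rightarrow> ('a \<Rightarrow> 'b) \<Rightarrow> bool" where
  "coarse_map S T f \<longleftrightarrow>
     f ` S \<subseteq> T \<and>
     (\<forall>B\<subseteq>T. bounded B \<longrightarrow> bounded {x \<in> S. f x \<in> B}) \<and>
     (\<forall>R>0. \<exists>C>0. \<forall>x\<in>S. \<forall>y\<in>S. dist x y \<le> R \<longrightarrow> dist (f x) (f y) \<le> C)"

definition close_on ::
  "'a set \<Rightarrow> ('a \<Rightarrow> 'b::metric_space) \<Rightarrow> ('a \<Rightarrow> 'b) \<Rightarrow> bool" where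
  "close_on S f g \<longleftrightarrow> (\<exists>C. \<forall>x\<in>S. dist (f x) (g x) \<le> C)"

definition coarse_equivalence ::
  "'a::metric_space set \<Rightarrow> 'b::metric_space set \<Rightarrow> ('a \<Rightarrow> 'b) \<Rightarrow> bool" where
  "coarse_equivalence S T f \<longleftrightarrow>
     coarse_map S T f \<and>
     (\<exists>g. coarse_map T S g \<and> close_on T (f \<circ> g) id \<and> close_on S (g \<circ> f) id)"


section \<open>Isometric actions and bounded fixed sets\<close>

text \<open>The actions below are on the whole type, i.e. on \<^term>\<open>UNIV :: 'a set\<close>.\<close>

definition isometric_action ::
  "('g, 'm) monoid_scheme \<Rightarrow> ('g \<Rightarrow> 'a::metric_space \<Rightarrow> 'a) \<Rightarrow> bool" where
  "isometric_action G \<phi> \<longleftrightarrow>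
     group_action G UNIV \<phi> \<and>
     (\<forall>g\<in>carrier G. \<forall>x y. dist (\<phi> g x) (\<phi> g y) = dist x y)"

definition fixed_within ::
  "('g \<Rightarrow> 'a::metric_space \<Rightarrow> 'a) \<Rightarrow> 'g set \<Rightarrow> real \<Rightarrow> 'a set" where
  "fixed_within \<phi> H k = {x. \<forall>h\<in>H. dist x (\<phi> h x) \<le> k}"

definition is_bounded_fixed_set ::
  "('g \<Rightarrow> 'a::metric_space \<Rightarrow> 'a) \<Rightarrow> 'g set \<Rightarrow> 'a set \<Rightarrow> bool" where
  "is_bounded_fixed_set \<phi> H Y \<longleftrightarrow>
     (\<exists>k\<^sub>0>0. Y \<subseteq> fixed_within \<phi> H k\<^sub>0 \<and>
        (\<forall>k\<ge>k\<^sub>0. coarse_equivalence Y (fixed_within \<phi> H k) id))"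

definition tame_action ::
  "('g, 'm) monoid_scheme \<Rightarrow> ('g \<Rightarrow> 'a::metric_space \<Rightarrow> 'a) \<Rightarrow> bool" where
  "tame_action G \<phi> \<longleftrightarrow> (\<forall>H. subgroup H G \<longrightarrow> (\<exists>Y. is_bounded_fixed_set \<phi> H Y))"

definition semifree_at_large_scale ::
  "('g, 'm) monoid_scheme \<Rightarrow> ('g \<Rightarrow> 'a::metric_space \<Rightarrow> 'a) \<Rightarrow> bool" where
  "semifree_at_large_scale G \<phi> \<longleftrightarrow>
     tame_action G \<phi> \<and>
     (\<exists>Y. \<forall>H. subgroup H G \<and> H \<noteq> {\<one>\<^bsub>G\<^esub>} \<longrightarrow> is_bounded_fixed_set \<phi> H Y)"


section \<open>Simplicial homology with locally finite chains\<close>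

text \<open>
  A simplicial complex is given by its set \<open>K\<close> of simplices (finite nonempty sets of vertices,
  closed under nonempty subsets). An oriented \<open>q\<close>-chain $\sum_\sigma c_\sigma \sigma$ is encoded by
  the alternating function \<open>c\<close> on ordered simplices, \<open>c [v\<^sub>0,\<dots>,v\<^sub>q]\<close> being the coefficient of the
  oriented simplex $[v_0,\dots,v_q]$. Coefficients are the residues \<open>{0..<p}\<close>.
\<close>

definition nerve :: "'a set set \<Rightarrow> 'a set set set" where
  "nerve \<U> = {\<sigma>. \<sigma> \<noteq> {} \<and> finite \<sigma> \<and> \<sigma> \<subseteq> \<U> \<and> \<Inter>\<sigma> \<noteq> {}}"

definition ordered_simplices :: "'v set set \<Rightarrow> nat \<Rightarrow> 'v list set" where
  "ordered_simplices K q = {vs. length vs = Suc q \<and> distinct vs \<and> set vs \<in> K}"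

definition lf_chains :: "nat \<Rightarrow> 'v set set \<Rightarrow> nat \<Rightarrow> ('v list \<Rightarrow> int) set" where
  "lf_chains p K q =
     {c. (\<forall>vs. c vs \<in> {0..<int p}) \<and>
         (\<forall>vs. vs \<notin> ordered_simplices K q \<longrightarrow> c vs = 0) \<and>
         (\<forall>vs\<in>ordered_simplices K q. \<forall>\<pi>. \<pi> permutes {..<Suc q} \<longrightarrow>
            c (permute_list \<pi> vs) = (sign \<pi> * c vs) mod int p) \<and>
         (\<forall>v. finite {vs. v \<in> set vs \<and> c vs \<noteq> 0})}"

definition lf_chain_group ::
  "nat \<Rightarrow> 'v set set \<Rightarrow> nat \<Rightarrow> ('v list \<Rightarrow> int) monoid" where
  "lf_chain_group p K q =
     \<lparr>carrier = lf_chains p K q,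
      monoid.mult = (\<lambda>c d vs. (c vs + d vs) mod int p),
      one = (\<lambda>_. 0)\<rparr>"

text \<open>
  Since $\partial [v, v_0, \dots, v_q] = [v_0, \dots, v_q] - \dots$, the coefficient of $\partial c$ at
  $[v_0, \dots, v_q]$ is the sum of the coefficients of \<open>c\<close> at all $[v, v_0, \dots, v_q]$, a finite
  sum by local finiteness. The empty list is excluded because the complex is not augmented:
  the boundary of a 0-chain is zero.
\<close>

definition lf_boundary :: "nat \<Rightarrow> ('v list \<Rightarrow> int) \<Rightarrow> 'v list \<Rightarrow> int" where
  "lf_boundary p c vs =
     (if vs = [] then 0 else (\<Sum>v | c (v # vs) \<noteq> 0. c (v # vs)) mod int p)"

definition lf_cycles :: "nat \<Rightarrow> 'v set set \<Rightarrow> nat \<Rightarrow> ('v list \<Rightarrow> int) set" where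
  "lf_cycles p K q = {c \<in> lf_chains p K q. lf_boundary p c = (\<lambda>_. 0)}"

definition lf_boundaries :: "nat \<Rightarrow> 'v set set \<Rightarrow> nat \<Rightarrow> ('v list \<Rightarrow> int) set" where
  "lf_boundaries p K q = lf_boundary p ` lf_chains p K (Suc q)"

definition lf_homology ::
  "nat \<Rightarrow> 'v set set \<Rightarrow> nat \<Rightarrow> ('v list \<Rightarrow> int) set monoid" where
  "lf_homology p K q =
     (lf_chain_group p K q)\<lparr>carrier := lf_cycles p K q\<rparr> Mod lf_boundaries p K q"

text \<open>
  The chain map of a proper simplicial map \<open>f\<close> sends $[v_0, \dots, v_q]$ to
  $[f v_0, \dots, f v_q]$, which is zero if two of these vertices coincide.
\<close>

definition lf_chain_map ::
  "nat \<Rightarrow> ('v \<Rightarrow> 'w) \<Rightarrow> ('v list \<Rightarrow> int) \<Rightarrow> 'w list \<Rightarrow> int" where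
  "lf_chain_map p f c ws =
     (if distinct ws then (\<Sum>vs | map f vs = ws \<and> c vs \<noteq> 0. c vs) mod int p else 0)"

text \<open>
  The map induced on homology classes, i.e. on cosets of the group of boundaries; all members of
  the union are the same coset of the target.
\<close>

definition lf_homology_map ::
  "nat \<Rightarrow> 'w set set \<Rightarrow> nat \<Rightarrow> ('v \<Rightarrow> 'w) \<Rightarrow> ('v list \<Rightarrow> int) set \<Rightarrow> ('w list \<Rightarrow> int) set" where
  "lf_homology_map p L q f A =
     (\<Union>c\<in>A. lf_boundaries p L q #>\<^bsub>lf_chain_group p L q\<^esub> lf_chain_map p f c)"


section \<open>Direct limits of sequences of groups\<close>

text \<open>
  For homomorphisms \<open>f n : A n \<rightarrow> A (Suc n)\<close> and \<open>i \<le> k\<close>, the composite \<open>A i \<rightarrow> A k\<close> is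
  \<open>fold f [i..<k]\<close>.
\<close>

definition direct_limit_rel ::
  "(nat \<Rightarrow> ('x, 'm) monoid_scheme) \<Rightarrow> (nat \<Rightarrow> 'x \<Rightarrow> 'x) \<Rightarrow> ((nat \<times> 'x) \<times> (nat \<times> 'x)) set" where
  "direct_limit_rel A f =
     {((i, x), (j, y)) | i x j y. x \<in> carrier (A i) \<and> y \<in> carrier (A j) \<and>
        (\<exists>k\<ge>max i j. fold f [i..<k] x = fold f [j..<k] y)}"

definition direct_limit ::
  "(nat \<Rightarrow> ('x, 'm) monoid_scheme) \<Rightarrow> (nat \<Rightarrow> 'x \<Rightarrow> 'x) \<Rightarrow> (nat \<times> 'x) set monoid" where
  "direct_limit A f =
     \<lparr>carrier = (SIGMA i:UNIV. carrier (A i)) // direct_limit_rel A f,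
      monoid.mult = (\<lambda>X Y. \<Union>{direct_limit_rel A f ``
                           {(k, fold f [i..<k] x \<otimes>\<^bsub>A k\<^esub> fold f [j..<k] y)}
                         | i x j y k. (i, x) \<in> X \<and> (j, y) \<in> Y \<and> max i j \<le> k}),
      one = direct_limit_rel A f `` {(0, \<one>\<^bsub>A 0\<^esub>)}\<rparr>"


section \<open>Coarse homology\<close>

text \<open>\<open>S \<inter> closure U\<close> is the closure of \<open>U\<close> in the subspace \<open>S\<close>.\<close>

definition uniform_covering :: "'a::metric_space set \<Rightarrow> 'a set set \<Rightarrow> bool" where
  "uniform_covering S \<U> \<longleftrightarrow>
     \<Union>\<U> = S \<and>
     (\<forall>U\<in>\<U>. compact (S \<inter> closure U)) \<and>
     (\<forall>B\<subseteq>S. bounded B \<longrightarrow> finite {U \<in> \<U>. U \<inter> B \<noteq> {}})"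

text \<open>
  A covering has Lebesgue number at least \<open>R\<close> if every nonempty set of diameter at most \<open>R\<close> lies
  in one of its members.
\<close>

definition lebesgue_number_ge ::
  "'a::metric_space set \<Rightarrow> 'a set set \<Rightarrow> real \<Rightarrow> bool" where
  "lebesgue_number_ge S \<U> R \<longleftrightarrow>
     (\<forall>A\<subseteq>S. A \<noteq> {} \<and> (\<forall>x\<in>A. \<forall>y\<in>A. dist x y \<le> R) \<longrightarrow> (\<exists>U\<in>\<U>. A \<subseteq> U))"

text \<open>\<open>\<rho> n\<close> is the refinement projection from \<open>\<U> n\<close> to \<open>\<U> (Suc n)\<close>.\<close>

definition coarsening_system ::
  "'a::metric_space set \<Rightarrow> (nat \<Rightarrow> 'a set set) \<Rightarrow> (nat \<Rightarrow> 'a set \<Rightarrow> 'a set) \<Rightarrow> bool" where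
  "coarsening_system S \<U> \<rho> \<longleftrightarrow>
     (\<forall>n. uniform_covering S (\<U> n)) \<and>
     (\<exists>R :: nat \<Rightarrow> real. mono R \<and> filterlim R at_top sequentially \<and>
        (\<forall>n. \<forall>U\<in>\<U> n. \<forall>x\<in>U. \<forall>y\<in>U. dist x y \<le> R n) \<and>
        (\<forall>n. lebesgue_number_ge S (\<U> (Suc n)) (R n))) \<and>
     (\<forall>n. \<forall>U\<in>\<U> n. \<rho> n U \<in> \<U> (Suc n) \<and> U \<subseteq> \<rho> n U)"

definition coarse_homology ::
  "nat \<Rightarrow> (nat \<Rightarrow> 'a set set) \<Rightarrow> (nat \<Rightarrow> 'a set \<Rightarrow> 'a set) \<Rightarrow> nat
     \<Rightarrow> (nat \<times> ('a set list \<Rightarrow> int) set) set monoid" where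
  "coarse_homology p \<U> \<rho> q =
     direct_limit (\<lambda>n. lf_homology p (nerve (\<U> n)) q)
       (\<lambda>n. lf_homology_map p (nerve (\<U> (Suc n))) q (\<rho> n))"

text \<open>
  Coarse homology does not depend on the coarsening system, so it may be computed from any one of
  them. A group isomorphism between vector spaces over the field of \<open>p\<close> elements is linear.
\<close>

definition coarse_homology_sphere :: "nat \<Rightarrow> nat \<Rightarrow> 'a::metric_space set \<Rightarrow> bool" where
  "coarse_homology_sphere p m S \<longleftrightarrow>
     proper_space S \<and>
     (\<exists>\<U> \<rho>. coarsening_system S \<U> \<rho> \<and>
        coarse_homology p \<U> \<rho> m \<cong> integer_mod_group p \<and>
        (\<forall>q. q \<noteq> m \<longrightarrow> trivial_group (coarse_homology p \<U> \<rho> q)))"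

end

theory Submission
  imports Defs "HOL-Library.Function_Algebras"
    "HOL-Number_Theory.Cong"
begin

text \<open>
  Finite asymptotic dimension gives coverings of \<open>X\<close> by \<open>G\<close>-invariant families of bounded sets with
  uniformly many colours, whose nerves have uniformly bounded dimension. In such a nerve a group
  element stabilising a simplex fixes all its vertices, and a vertex stabilised by a nontrivial
  subgroup consists of points moved a bounded distance by that subgroup. Semifreeness at the large
  scale makes it \<open>G\<close>-fixed at a later stage of the coarsening system. Hence in the direct limit of the
  chain complexes the chains \<open>C\<close> of \<open>X\<close> modulo the chains \<open>F\<close> on fixed vertices are free
  over the group ring of \<open>G\<close>, and \<open>F\<close> retains the fundamental class of \<open>X\<^sup>G\<^sub>b\<^sub>d\<close>.

  Tensoring with the product of the 2-periodic resolutions of the two cyclic factors, \<open>C/F\<close>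
  contributes nothing in high total degree \<open>n\<close>, where \<open>C\<close> and \<open>F\<close> therefore have the same
  homology. A degree-\<open>k\<close> part of the resolution has rank \<open>k + 1\<close>, so \<open>F\<close> yields at least
  \<open>p\<close> to the power \<open>n - r + 1\<close> classes while \<open>C\<close>, filtered by an \<open>m\<close>-sphere, has at most \<open>p\<close> to the
  power \<open>n - m + 1\<close>. This is absurd for \<open>r < m\<close>.
\<close>

section \<open>Borel homology of a relatively free pair\<close>

text \<open>Rank two is what makes the count decisive. For one cyclic factor the resolution has rank
  one in every degree, so fixed part and whole space would be allowed equally many classes. With two
  factors the ranks grow with the degree, and a growth that starts at \<open>r\<close> instead of
  \<open>m\<close> leaves a surplus.

  Each sphere enters only through a weak consequence. For the whole space it is an upper bound on
  the number of classes, recorded by labels that need not be additive; for the fixed set it is one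
  cycle none of whose multiples by \<open>0 < j < p\<close> ever bounds. So the homology of
  \<open>F\<close> is never computed in full and no dimensions occur.

  Locally finite chains on free orbits form a product rather than a direct sum, so freeness is not
  expressed through a basis. What survives for products is the exactness of norms and differences,
  and this is all the algebra asks for. Even that holds only in the limit modulo \<open>F\<close>,
  because at a fixed stage there are simplices that are neither free nor fixed.\<close>

abbreviation additive_map :: "('a::ab_group_add \<Rightarrow> 'b::ab_group_add) \<Rightarrow> bool" where
  "additive_map \<equiv> Modules.additive"

section \<open>Group ring operators of a cyclic group\<close>

definition tau :: "('b::ab_group_add \<Rightarrow> 'b) \<Rightarrow> 'b \<Rightarrow> 'b" where
  "tau T x = T x - x"

definition norm_op :: "nat \<Rightarrow> ('b::ab_group_add \<Rightarrow> 'b) \<Rightarrow> 'b \<Rightarrow> 'b" where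
  "norm_op p T x = (\<Sum>k<p. (T ^^ k) x)"

text \<open>The differential leaving degree \<open>i\<close> of the 2-periodic resolution of a cyclic group.\<close>

definition res_op :: "nat \<Rightarrow> ('b::ab_group_add \<Rightarrow> 'b) \<Rightarrow> nat \<Rightarrow> 'b \<Rightarrow> 'b" where
  "res_op p T i = (if odd i then tau T else norm_op p T)"

definition sgn_pow :: "nat \<Rightarrow> 'b::ab_group_add \<Rightarrow> 'b" where
  "sgn_pow k x = (if even k then x else - x)"

definition nmult :: "nat \<Rightarrow> 'b::ab_group_add \<Rightarrow> 'b" where
  "nmult k x = (\<Sum>i<k. x)"

lemma nmult_0 [simp]: "nmult 0 x = 0" and nmult_Suc: "nmult (Suc k) x = nmult k x + x"
  by (simp_all add: nmult_def)

lemma nmult_add: "nmult (j + k) x = nmult j x + nmult k x"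
  by (induction k) (simp_all add: nmult_Suc add.assoc)

lemma nmult_mult: "nmult (j * k) x = nmult j (nmult k x)"
  by (induction j) (simp_all add: nmult_Suc nmult_add add.commute)

lemma additive_nmult: "additive_map (nmult k)"
  by (rule additive.intro, induction k) (simp_all add: nmult_Suc)

lemma additive_nmult_commute: "additive_map f \<Longrightarrow> f (nmult k x) = nmult k (f x)"
  by (simp add: nmult_def additive.sum)

lemma additive_comp: "additive_map f \<Longrightarrow> additive_map g \<Longrightarrow> additive_map (\<lambda>x. f (g x))"
  by (simp add: Modules.additive_def)

lemma additive_tau: "additive_map T \<Longrightarrow> additive_map (tau T)"
  by (simp add: Modules.additive_def tau_def)

lemma additive_funpow: "additive_map (T :: 'b::ab_group_add \<Rightarrow> 'b) \<Longrightarrow> additive_map (T ^^ k)"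
  unfolding Modules.additive_def by (induction k) auto

lemma additive_norm_op: "additive_map T \<Longrightarrow> additive_map (norm_op p T)"
  using additive_funpow[of T] by (simp add: Modules.additive_def norm_op_def sum.distrib)

lemma additive_res_op: "additive_map T \<Longrightarrow> additive_map (res_op p T i)"
  by (simp add: res_op_def additive_tau additive_norm_op)

lemma additive_sgn_pow: "additive_map (sgn_pow k)"
  by (simp add: Modules.additive_def sgn_pow_def)

lemma sgn_pow_0 [simp]: "sgn_pow k 0 = 0"
  by (simp add: sgn_pow_def)

lemma sgn_pow_Suc: "sgn_pow (Suc k) x = - sgn_pow k x"
  by (simp add: sgn_pow_def)

lemma tau_norm_op: "additive_map T \<Longrightarrow> tau T (norm_op p T x) = (T ^^ p) x - x"
  using sum_lessThan_telescope[of "\<lambda>k. (T ^^ k) x" p]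
  by (simp add: tau_def norm_op_def additive.sum sum_subtractf)

lemma norm_op_tau: "additive_map T \<Longrightarrow> norm_op p T (tau T x) = (T ^^ p) x - x"
  using sum_lessThan_telescope[of "\<lambda>k. (T ^^ k) x" p]
  by (simp add: tau_def norm_op_def additive.diff[OF additive_funpow] sum_subtractf funpow_swap1)

lemma res_op_res_op:
  "additive_map T \<Longrightarrow> (T ^^ p) x = x \<Longrightarrow> res_op p T i (res_op p T (Suc i) x) = 0"
  by (simp add: res_op_def tau_norm_op norm_op_tau)

lemma funpow_commute_on:
  assumes "\<And>x. x \<in> X \<Longrightarrow> T x \<in> X" "\<And>x. x \<in> X \<Longrightarrow> f (T x) = S (f x)" "x \<in> X"
  shows "f ((T ^^ k) x) = (S ^^ k) (f x) \<and> (T ^^ k) x \<in> X"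
  using assms by (induction k) simp_all

text \<open>Commutation is assumed only on an invariant set \<open>X\<close>, because the boundary
  commutes with the actions on chains and not on arbitrary elements of the ambient group.\<close>

lemma res_op_commute_on:
  assumes "additive_map f" "\<And>x. x \<in> X \<Longrightarrow> T x \<in> X" "\<And>x. x \<in> X \<Longrightarrow> f (T x) = S (f x)" "x \<in> X"
  shows "f (res_op p T i x) = res_op p S i (f x)"
  using assms funpow_commute_on[of X T f S x]
  by (auto simp: res_op_def tau_def norm_op_def additive.sum additive.diff)

text \<open>
  \<open>A\<close> and \<open>B\<close> are the actions of the two generators. The last four assumptions are the exactness
  properties of free modules over the group rings of the first factor and of the whole group,
  stated for the quotients \<open>C q / F q\<close>.
\<close>

locale free_pair =
  fixes C F :: "nat \<Rightarrow> 'b::ab_group_add set" and bd A B :: "'b \<Rightarrow> 'b" and p N :: nat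
  assumes C0: "0 \<in> C q" and Cdiff: "x \<in> C q \<Longrightarrow> y \<in> C q \<Longrightarrow> x - y \<in> C q"
    and F0: "0 \<in> F q" and Fdiff: "x \<in> F q \<Longrightarrow> y \<in> F q \<Longrightarrow> x - y \<in> F q"
    and FC: "x \<in> F q \<Longrightarrow> x \<in> C q"
    and add_bd: "additive_map bd" and add_A: "additive_map A" and add_B: "additive_map B"
    and bdC: "x \<in> C (Suc q) \<Longrightarrow> bd x \<in> C q" and bdF: "x \<in> F (Suc q) \<Longrightarrow> bd x \<in> F q"
    and bd0: "x \<in> C 0 \<Longrightarrow> bd x = 0" and bdbd: "x \<in> C q \<Longrightarrow> bd (bd x) = 0"
    and AC: "x \<in> C q \<Longrightarrow> A x \<in> C q" and BC: "x \<in> C q \<Longrightarrow> B x \<in> C q"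
    and Abd: "x \<in> C q \<Longrightarrow> A (bd x) = bd (A x)" and Bbd: "x \<in> C q \<Longrightarrow> B (bd x) = bd (B x)"
    and AB: "x \<in> C q \<Longrightarrow> A (B x) = B (A x)"
    and Ap: "x \<in> C q \<Longrightarrow> (A ^^ p) x = x" and Bp: "x \<in> C q \<Longrightarrow> (B ^^ p) x = x"
    and AF: "x \<in> F q \<Longrightarrow> A x = x" and BF: "x \<in> F q \<Longrightarrow> B x = x"
    and tors: "x \<in> C q \<Longrightarrow> nmult p x = 0"
    and bounded_degree: "x \<in> C q \<Longrightarrow> N \<le> q \<Longrightarrow> x = 0"
    and ker_tau: "x \<in> C q \<Longrightarrow> tau A x \<in> F q \<Longrightarrow> \<exists>y\<in>C q. x - norm_op p A y \<in> F q"
    and ker_norm: "x \<in> C q \<Longrightarrow> norm_op p A x \<in> F q \<Longrightarrow> \<exists>y\<in>C q. x - tau A y \<in> F q"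
    and ker_tau_tau: "x \<in> C q \<Longrightarrow> tau A x \<in> F q \<Longrightarrow> tau B x \<in> F q \<Longrightarrow>
       \<exists>y\<in>C q. x - norm_op p A (norm_op p B y) \<in> F q"
    and ker_norm_norm: "x \<in> C q \<Longrightarrow> norm_op p A (norm_op p B x) \<in> F q \<Longrightarrow>
       \<exists>y\<in>C q. \<exists>z\<in>C q. x - tau A y - tau B z \<in> F q"
begin

abbreviation a where "a \<equiv> res_op p A"
abbreviation b where "b \<equiv> res_op p B"

lemma Cminus: "x \<in> C q \<Longrightarrow> - x \<in> C q" using Cdiff[OF C0, of x q] by simp
lemma Cadd: "x \<in> C q \<Longrightarrow> y \<in> C q \<Longrightarrow> x + y \<in> C q" using Cdiff[OF _ Cminus, of x q y] by simp
lemma Fminus: "x \<in> F q \<Longrightarrow> - x \<in> F q" using Fdiff[OF F0, of x q] by simp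
lemma Fadd: "x \<in> F q \<Longrightarrow> y \<in> F q \<Longrightarrow> x + y \<in> F q" using Fdiff[OF _ Fminus, of x q y] by simp
lemma Fadd_cancel: "x + y \<in> F q \<Longrightarrow> x \<in> F q \<Longrightarrow> y \<in> F q" using Fdiff[of "x+y" q x] by simp
lemma Csum: "(\<And>i. i \<in> I \<Longrightarrow> f i \<in> C q) \<Longrightarrow> sum f I \<in> C q"
  by (induction I rule: infinite_finite_induct) (auto intro: C0 Cadd)
lemma Csgn: "x \<in> C q \<Longrightarrow> sgn_pow k x \<in> C q" by (auto simp: sgn_pow_def Cminus)
lemma Fsgn: "x \<in> F q \<Longrightarrow> sgn_pow k x \<in> F q" by (auto simp: sgn_pow_def Fminus)

lemma aC: "x \<in> C q \<Longrightarrow> a i x \<in> C q"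
  using funpow_commute_on[of "C q" A "\<lambda>x. x" A x] AC
  by (auto simp: res_op_def tau_def norm_op_def intro!: Csum Cdiff)
lemma bC: "x \<in> C q \<Longrightarrow> b i x \<in> C q"
  using funpow_commute_on[of "C q" B "\<lambda>x. x" B x] BC
  by (auto simp: res_op_def tau_def norm_op_def intro!: Csum Cdiff)
text \<open>On \<open>F\<close> the group acts trivially, so \<open>tau\<close> vanishes and the
  norm is multiplication by \<open>p\<close>, which kills torsion elements.\<close>

lemma aF: assumes "x \<in> F q" shows "a i x = 0"
proof -
  have "(A ^^ k) x = x" for k using assms by (induction k) (simp_all add: AF)
  then show ?thesis using assms tors[OF FC[OF assms]]
    by (simp add: res_op_def tau_def norm_op_def AF nmult_def)
qed
lemma bF: assumes "x \<in> F q" shows "b i x = 0"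
proof -
  have "(B ^^ k) x = x" for k using assms by (induction k) (simp_all add: BF)
  then show ?thesis using assms tors[OF FC[OF assms]]
    by (simp add: res_op_def tau_def norm_op_def BF nmult_def)
qed
lemma aa: "x \<in> C q \<Longrightarrow> a i (a (Suc i) x) = 0" by (simp add: res_op_res_op add_A Ap)
lemma bb: "x \<in> C q \<Longrightarrow> b i (b (Suc i) x) = 0" by (simp add: res_op_res_op add_B Bp)
lemma abd: "x \<in> C q \<Longrightarrow> bd (a i x) = a i (bd x)"
  by (rule res_op_commute_on[OF add_bd, of "C q"]) (auto simp: AC Abd)
lemma bbd: "x \<in> C q \<Longrightarrow> bd (b i x) = b i (bd x)"
  by (rule res_op_commute_on[OF add_bd, of "C q"]) (auto simp: BC Bbd)
lemma Ab: "x \<in> C q \<Longrightarrow> A (b j x) = b j (A x)"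
  by (rule res_op_commute_on[OF add_A, of "C q"]) (auto simp: BC AB)
lemma ab: "x \<in> C q \<Longrightarrow> b j (a i x) = a i (b j x)"
  by (rule res_op_commute_on[OF additive_res_op[OF add_B], of "C q"]) (auto simp: AC Ab)

lemmas add_a = additive_res_op[OF add_A] and add_b = additive_res_op[OF add_B]
lemmas lin = additive.add[OF add_a] additive.add[OF add_b] additive.add[OF add_bd]
  additive.diff[OF add_a] additive.diff[OF add_b] additive.diff[OF add_bd]
  additive.minus[OF add_a] additive.minus[OF add_b] additive.minus[OF add_bd]
  additive.zero[OF add_a] additive.zero[OF add_b] additive.zero[OF add_bd]
lemma lin_sgn: "a i (sgn_pow k x) = sgn_pow k (a i x)" "b i (sgn_pow k x) = sgn_pow k (b i x)"
  "bd (sgn_pow k x) = sgn_pow k (bd x)"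
  by (simp_all add: sgn_pow_def lin)

lemma a_exact:
  assumes "x \<in> C q" "a i x \<in> F q" "i \<ge> 1" shows "\<exists>y\<in>C q. x - a (Suc i) y \<in> F q"
  using assms ker_tau ker_norm by (auto simp: res_op_def split: if_splits)

text \<open>Exactness in the column of resolution degree 0 of the first factor, where no
  differential \<open>a\<close> leaves and \<open>a_exact\<close> says nothing. The norm
  \<open>a 0\<close> takes over: it kills both \<open>a 1 y\<close> and \<open>F\<close>, and it
  turns a statement about coinvariants of the first factor into one about invariants. There the
  exactness properties of the whole group apply, invariants being norms for odd \<open>k\<close> and
  elements of norm zero being sums of differences for even \<open>k\<close>.\<close>

lemma b_exact:
  assumes x: "x \<in> C q" and y: "y \<in> C q" and h: "a 1 y + b k x \<in> F q"
  shows "\<exists>u\<in>C q. \<exists>v\<in>C q. x - (a 1 v + b (Suc k) u) \<in> F q"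
proof -
  have "a 0 (a 1 y + b k x) = 0" using h by (rule aF)
  then have ab0: "b k (a 0 x) = 0" using aa[OF y, of 0] ab[OF x, of k 0] by (simp add: lin)
  show ?thesis
  proof (cases "odd k")
    case True
    have "a 1 (a 0 x) = 0" using aa[OF x, of 1] by (simp add: res_op_def)
    with ab0 True obtain z where z: "z \<in> C q" "a 0 x - a 0 (b 0 z) \<in> F q"
      using ker_tau_tau[of "a 0 x" q] aC[OF x, of 0] F0 by (auto simp: res_op_def)
    then have "a 0 (x - b 0 z) \<in> F q" by (simp add: lin)
    then obtain v where v: "v \<in> C q" "(x - b 0 z) - tau A v \<in> F q"
      using ker_norm[of "x - b 0 z" q] Cdiff[OF x bC[OF z(1), of 0]] by (auto simp: res_op_def)
    then show ?thesis using z v True by (intro bexI[of _ z] bexI[of _ v]) (auto simp: res_op_def algebra_simps)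
  next
    case False
    then have "norm_op p A (norm_op p B x) \<in> F q"
      using ab0 ab[OF x, of 0 0] F0 by (simp add: res_op_def)
    then obtain v u where "v \<in> C q" "u \<in> C q" "x - tau A v - tau B u \<in> F q" using ker_norm_norm[OF x] by blast
    then show ?thesis using False by (intro bexI[of _ u] bexI[of _ v]) (auto simp: res_op_def algebra_simps)
  qed
qed

text \<open>
  In total resolution degree \<open>k\<close>, \<open>w i\<close> is the component of bidegree \<open>(i, k - i)\<close>.
\<close>

definition dQ :: "nat \<Rightarrow> (nat \<Rightarrow> 'b) \<Rightarrow> nat \<Rightarrow> 'b" where
  "dQ k w i = a (Suc i) (w (Suc i)) + sgn_pow i (b (k - i) (w i))"

lemma dQ_add: "dQ k (\<lambda>i. v i + w i) i = dQ k v i + dQ k w i"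
  by (simp add: dQ_def lin additive.add[OF additive_sgn_pow])
lemma dQ_diff: "dQ k (\<lambda>i. v i - w i) i = dQ k v i - dQ k w i"
  by (simp add: dQ_def lin additive.diff[OF additive_sgn_pow])

lemma dQ_C: "\<forall>i\<le>k. w i \<in> C q \<Longrightarrow> i < k \<Longrightarrow> dQ k w i \<in> C q"
  by (auto simp: dQ_def intro!: Cadd Csgn aC bC)

lemma dQ_dQ: assumes "\<forall>i\<le>Suc k. w i \<in> C q" "i < k" shows "dQ k (dQ (Suc k) w) i = 0"
proof -
  have w: "w i \<in> C q" "w (Suc i) \<in> C q" "w (Suc (Suc i)) \<in> C q" using assms by auto
  have "Suc k - i = Suc (k - i)" using assms by simp
  then show ?thesis using w assms
    by (simp add: dQ_def lin lin_sgn aa[OF w(3)] bb[OF w(1)] ab[OF w(2)] sgn_pow_Suc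
         additive.add[OF additive_sgn_pow])
qed

text \<open>Exactness of the tensor product resolution modulo \<open>F\<close> in positive degree,
  column by column. Column 0 is \<open>b_exact\<close>. In a later column the components already
  corrected lie in \<open>F\<close>, where \<open>b\<close> vanishes, so the cycle condition reduces
  to one about \<open>a\<close> and \<open>a_exact\<close> applies.\<close>

lemma dQ_exact:
  assumes k: "k \<ge> 1" and wC: "\<forall>i\<le>k. w i \<in> C q" and wF: "\<forall>i<k. dQ k w i \<in> F q"
  shows "\<exists>y. (\<forall>i\<le>Suc k. y i \<in> C q) \<and> (\<forall>i\<le>k. w i - dQ (Suc k) y i \<in> F q)"
proof -
  have "t \<le> k \<Longrightarrow> \<exists>y. (\<forall>i\<le>Suc k. y i \<in> C q) \<and> (\<forall>i\<le>t. w i - dQ (Suc k) y i \<in> F q)" for t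
  proof (induction t)
    case 0
    have "a 1 (w 1) + b k (w 0) \<in> F q" using wF k by (auto simp: dQ_def sgn_pow_def)
    then obtain u v where uv: "u \<in> C q" "v \<in> C q" "w 0 - (a 1 v + b (Suc k) u) \<in> F q"
      using b_exact[of "w 0" q "w 1" k] wC k by auto
    define y :: "nat \<Rightarrow> 'b" where "y = (\<lambda>i. if i = 0 then u else if i = 1 then v else 0)"
    have "\<forall>i\<le>Suc k. y i \<in> C q" using uv C0 by (simp add: y_def)
    moreover have "\<forall>i\<le>0. w i - dQ (Suc k) y i \<in> F q" using uv by (simp add: y_def dQ_def sgn_pow_def)
    ultimately show ?case by blast
  next
    case (Suc t)
    then obtain y where y: "\<forall>i\<le>Suc k. y i \<in> C q" "\<forall>i\<le>t. w i - dQ (Suc k) y i \<in> F q" by auto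
    define w' where "w' = (\<lambda>i. w i - dQ (Suc k) y i)"
    have w'C: "w' i \<in> C q" if "i \<le> k" for i
      unfolding w'_def using wC y(1) that dQ_C[of "Suc k" y q i] by (intro Cdiff) auto
    have "dQ k w' t = dQ k w t - dQ k (dQ (Suc k) y) t" unfolding w'_def by (rule dQ_diff)
    also have "\<dots> = dQ k w t" using dQ_dQ[OF y(1)] Suc.prems by simp
    finally have "dQ k w' t \<in> F q" using wF Suc.prems by simp
    moreover have "b (k - t) (w' t) = 0" using y(2) by (auto simp: w'_def intro: bF)
    ultimately have "a (Suc t) (w' (Suc t)) \<in> F q" by (simp add: dQ_def)
    then obtain v where v: "v \<in> C q" "w' (Suc t) - a (Suc (Suc t)) v \<in> F q"
      using a_exact[of "w' (Suc t)" q "Suc t"] w'C[OF Suc.prems] by auto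
    \<comment> \<open>Placed at index \<open>Suc (Suc t)\<close>, the correction reaches component
      \<open>Suc t\<close> through \<open>a\<close> and leaves all smaller components
      untouched.\<close>
    define e where "e = (\<lambda>i. if i = Suc (Suc t) then v else 0)"
    have e: "w' i - dQ (Suc k) e i \<in> F q" if "i \<le> Suc t" for i
    proof (cases "i = Suc t")
      case True then show ?thesis using v by (simp add: e_def dQ_def lin sgn_pow_def)
    next
      case False
      then have "dQ (Suc k) e i = 0" using that by (simp add: e_def dQ_def lin)
      then show ?thesis using y(2) that False by (simp add: w'_def)
    qed
    have "dQ (Suc k) (\<lambda>i. y i + e i) i = dQ (Suc k) y i + dQ (Suc k) e i" for i by (rule dQ_add)
    then show ?case using e y(1) v(1) C0
      by (intro exI[of _ "\<lambda>i. y i + e i"]) (auto simp: w'_def e_def diff_diff_add intro!: Cadd)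
  qed
  from this[of k] show ?thesis by auto
qed

text \<open>
  The component \<open>z q i\<close> of an element of total degree \<open>n\<close> has chain degree \<open>q\<close> and resolution
  bidegree \<open>(i, n - q - i)\<close>; values outside \<open>q + i \<le> n\<close> are junk.
\<close>

definition tot :: "(nat \<Rightarrow> 'b set) \<Rightarrow> nat \<Rightarrow> (nat \<Rightarrow> nat \<Rightarrow> 'b) \<Rightarrow> bool" where
  "tot X n z \<longleftrightarrow> (\<forall>q i. q + i \<le> n \<longrightarrow> z q i \<in> X q)"

text \<open>The sign alternating with the resolution degree makes the boundary anticommute with
  \<open>dQ\<close>, so that the total differential squares to zero.\<close>

definition D :: "nat \<Rightarrow> (nat \<Rightarrow> nat \<Rightarrow> 'b) \<Rightarrow> nat \<Rightarrow> nat \<Rightarrow> 'b" where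
  "D n z q i = dQ (n - q) (z q) i + sgn_pow (n - q) (bd (z (Suc q) i))"

lemma D_diff: "D n (\<lambda>q i. v q i - w q i) q i = D n v q i - D n w q i"
  by (simp add: D_def dQ_diff lin additive.diff[OF additive_sgn_pow])
lemma D_add: "D n (\<lambda>q i. v q i + w q i) q i = D n v q i + D n w q i"
  by (simp add: D_def dQ_add lin additive.add[OF additive_sgn_pow])

lemma tot_diff: "tot C n v \<Longrightarrow> tot C n w \<Longrightarrow> tot C n (\<lambda>q i. v q i - w q i)"
  by (auto simp: tot_def Cdiff)
lemma tot_add: "tot C n v \<Longrightarrow> tot C n w \<Longrightarrow> tot C n (\<lambda>q i. v q i + w q i)"
  by (auto simp: tot_def Cadd)

lemma tot_D: "tot C (Suc n) z \<Longrightarrow> tot C n (D (Suc n) z)"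
  by (auto simp: tot_def D_def intro!: Cadd Csgn bdC dQ_C)

lemma bd_dQ: "\<forall>i\<le>k. w i \<in> C q \<Longrightarrow> i < k \<Longrightarrow> bd (dQ k w i) = dQ k (\<lambda>i. bd (w i)) i"
  by (simp add: dQ_def lin abd[of "w (Suc i)" q] bbd[of "w i" q] lin_sgn)

lemma dQ_sgn: "dQ k (\<lambda>i. sgn_pow l (w i)) i = sgn_pow l (dQ k w i)"
  by (simp add: dQ_def lin_sgn additive.add[OF additive_sgn_pow]) (simp add: sgn_pow_def)

lemma D_D:
  assumes z: "tot C (Suc n) z" and qi: "q + i < n" shows "D n (D (Suc n) z) q i = 0"
proof -
  define k where "k = n - q"
  have k: "n - q = k" "Suc n - q = Suc k" "Suc n - Suc q = k" "i < k" using qi by (auto simp: k_def)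
  have z1: "\<forall>i\<le>Suc k. z q i \<in> C q" "\<forall>i\<le>k. z (Suc q) i \<in> C (Suc q)" "z (Suc (Suc q)) i \<in> C (Suc (Suc q))"
    using z qi by (auto simp: tot_def k_def)
  have "D (Suc n) z q = (\<lambda>i. dQ (Suc k) (z q) i + sgn_pow (Suc k) (bd (z (Suc q) i)))"
    using k by (auto simp: D_def)
  then have "D n (D (Suc n) z) q i = dQ k (dQ (Suc k) (z q)) i
     + dQ k (\<lambda>i. sgn_pow (Suc k) (bd (z (Suc q) i))) i
     + sgn_pow k (bd (dQ k (z (Suc q)) i + sgn_pow k (bd (z (Suc (Suc q)) i))))"
    using k by (simp add: D_def dQ_add)
  also have "\<dots> = dQ k (\<lambda>i. sgn_pow (Suc k) (bd (z (Suc q) i))) i + sgn_pow k (dQ k (\<lambda>i. bd (z (Suc q) i)) i)"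
    using dQ_dQ[OF z1(1) k(4)] bd_dQ[OF z1(2) k(4)] bdbd[OF z1(3)]
    by (simp add: lin lin_sgn)
  also have "\<dots> = 0" by (subst dQ_sgn) (simp add: sgn_pow_Suc)
  finally show ?thesis .
qed

text \<open>Descending induction on the chain degree. Components of chain degree at least
  \<open>N\<close> vanish, and below \<open>N\<close> the resolution degree \<open>n - q\<close> is
  positive because \<open>N \<le> n\<close>, so \<open>dQ_exact\<close> clears them one chain degree
  at a time. The counter \<open>t\<close> measures how far below \<open>N\<close> this has
  progressed.\<close>

lemma rel_exact:
  assumes n: "N \<le> n" and z: "tot C n z" and Dz: "\<forall>q i. q + i < n \<longrightarrow> D n z q i \<in> F q"
  shows "\<exists>y. tot C (Suc n) y \<and> tot F n (\<lambda>q i. z q i - D (Suc n) y q i)"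
proof -
  have "\<exists>y. tot C (Suc n) y \<and> (\<forall>q i. q + i \<le> n \<longrightarrow> N \<le> q + t \<longrightarrow> z q i - D (Suc n) y q i \<in> F q)" for t
  proof (induction t)
    case 0
    show ?case
    proof (intro exI[of _ "\<lambda>q i. 0"] conjI allI impI)
      show "tot C (Suc n) (\<lambda>q i. 0)" by (simp add: tot_def C0)
      fix q i assume "q + i \<le> n" "N \<le> q + 0"
      then have "z q i = 0" using z bounded_degree by (auto simp: tot_def)
      then show "z q i - D (Suc n) (\<lambda>q i. 0) q i \<in> F q"
        by (simp add: D_def dQ_def lin F0 sgn_pow_def)
    qed
  next
    case (Suc t)
    then obtain y where y: "tot C (Suc n) y"
      "\<forall>q i. q + i \<le> n \<longrightarrow> N \<le> q + t \<longrightarrow> z q i - D (Suc n) y q i \<in> F q" by auto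
    show ?case
    proof (cases "N \<le> t")
      case True then show ?thesis using y by auto
    next
      case False
      define Q where "Q = N - Suc t"
      define k where "k = n - Q"
      have Q: "N = Q + Suc t" "k \<ge> 1" "n = Q + k" using False n by (auto simp: Q_def k_def)
      define w where "w = (\<lambda>q i. z q i - D (Suc n) y q i)"
      have wC: "tot C n w" unfolding w_def by (rule tot_diff[OF z tot_D[OF y(1)]])
      have Dw: "D n w q i \<in> F q" if "q + i < n" for q i
        unfolding w_def using D_D[OF y(1) that] Dz that by (simp add: D_diff)
      have wF: "w q i \<in> F q" if "q + i \<le> n" "Q < q" for q i
        using y(2) that Q by (auto simp: w_def)
      have "dQ k (w Q) i \<in> F Q" if "i < k" for i
      proof -
        have "sgn_pow k (bd (w (Suc Q) i)) \<in> F Q" using wF[of "Suc Q" i] that Q by (intro Fsgn bdF) auto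
        then show ?thesis using Dw[of Q i] that Q Fadd_cancel[of "sgn_pow k (bd (w (Suc Q) i))" "dQ k (w Q) i" Q]
          by (auto simp: D_def add.commute)
      qed
      then obtain v where v: "\<forall>i\<le>Suc k. v i \<in> C Q" "\<forall>i\<le>k. w Q i - dQ (Suc k) v i \<in> F Q"
        using dQ_exact[of k "w Q" Q] Q wC by (auto simp: tot_def)
      define e where "e = (\<lambda>q i. if q = Q then v i else 0)"
      have e: "tot C (Suc n) e" using v(1) C0 Q by (auto simp: tot_def e_def)
      have "w q i - D (Suc n) e q i \<in> F q" if "q + i \<le> n" "N \<le> q + Suc t" for q i
      proof (cases "q = Q")
        case True
        have "D (Suc n) e q i = dQ (Suc k) v i" using True Q
          by (simp add: D_def e_def lin sgn_pow_def Suc_diff_le)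
        then show ?thesis using v(2) True that Q by auto
      next
        case False
        then have "D (Suc n) e q i = 0" using that Q by (simp add: D_def e_def dQ_def lin sgn_pow_def)
        then show ?thesis using wF[of q i] False that Q by auto
      qed
      then show ?thesis using tot_add[OF y(1) e]
        by (intro exI[of _ "\<lambda>q i. y q i + e q i"]) (auto simp: D_add w_def diff_diff_add)
    qed
  qed
  from this[of N] show ?thesis by (auto simp: tot_def)
qed

text \<open>When everything below chain degree \<open>Q\<close> vanishes, the total cycle condition
  one degree lower says that each \<open>z Q i\<close> is a cycle for \<open>bd\<close>. Primitives
  of these sit in chain degree \<open>Suc Q\<close>, so subtracting their total boundary does not
  disturb the degrees below \<open>Q\<close>.\<close>

lemma reduce_step:
  assumes z: "tot C n z" and Dz: "\<forall>q i. q + i < n \<longrightarrow> D n z q i = 0"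
    and lo: "\<forall>q i. q + i \<le> n \<longrightarrow> q < Q \<longrightarrow> z q i = 0"
    and ex: "\<forall>i. Q + i \<le> n \<longrightarrow> bd (z Q i) = 0 \<longrightarrow> (\<exists>y\<in>C (Suc Q). z Q i = bd y)"
  shows "\<exists>y. tot C (Suc n) y \<and> (\<forall>q i. q + i \<le> n \<longrightarrow> q < Suc Q \<longrightarrow> z q i - D (Suc n) y q i = 0)"
proof -
  have "bd (z Q i) = 0" if "Q + i \<le> n" for i
  proof (cases Q)
    case 0 then show ?thesis using z that bd0 by (auto simp: tot_def)
  next
    case (Suc R)
    then have "dQ (n - R) (z R) i = 0" using lo that by (simp add: dQ_def lin sgn_pow_def)
    then have "sgn_pow (n - R) (bd (z Q i)) = 0" using Dz[rule_format, of R i] Suc that by (simp add: D_def)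
    then show ?thesis by (simp add: sgn_pow_def split: if_splits)
  qed
  then have "\<exists>y\<in>C (Suc Q). z Q i = bd y" if "Q + i \<le> n" for i using ex that by blast
  then obtain v where v: "\<And>i. Q + i \<le> n \<Longrightarrow> v i \<in> C (Suc Q) \<and> z Q i = bd (v i)" by metis
  \<comment> \<open>The sign cancels the one in \<open>D\<close>; the bound on \<open>q + i\<close>
    is there because \<open>v\<close> is only specified for \<open>Q + i \<le> n\<close>.\<close>
  define e where "e = (\<lambda>q i. if q = Suc Q \<and> q + i \<le> Suc n then sgn_pow (Suc n - Q) (v i) else 0)"
  have "tot C (Suc n) e" using v C0 by (auto simp: tot_def e_def intro!: Csgn)
  moreover have "z q i - D (Suc n) e q i = 0" if "q + i \<le> n" "q < Suc Q" for q i
  proof (cases "q = Q")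
    case True
    have "dQ (Suc n - q) (e q) i = 0" using True by (simp add: dQ_def e_def lin sgn_pow_def)
    then have "D (Suc n) e q i = bd (v i)" using True that by (simp add: D_def e_def lin_sgn) (simp add: sgn_pow_def)
    then show ?thesis using True v[of i] that by simp
  next
    case False
    then show ?thesis using lo that by (simp add: D_def e_def dQ_def lin sgn_pow_def)
  qed
  ultimately show ?thesis by blast
qed

lemma reduce_upto:
  assumes z: "tot C n z" and Dz: "\<forall>q i. q + i < n \<longrightarrow> D n z q i = 0"
    and lo: "\<forall>q i. q + i \<le> n \<longrightarrow> q < Q0 \<longrightarrow> z q i = 0"
    and ex: "\<And>Q x. Q0 \<le> Q \<Longrightarrow> Q < Q0 + t \<Longrightarrow> x \<in> C Q \<Longrightarrow> bd x = 0 \<Longrightarrow> \<exists>y\<in>C (Suc Q). x = bd y"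
  shows "\<exists>y. tot C (Suc n) y \<and> (\<forall>q i. q + i \<le> n \<longrightarrow> q < Q0 + t \<longrightarrow> z q i - D (Suc n) y q i = 0)"
  using ex
proof (induction t)
  case 0
  show ?case by (intro exI[of _ "\<lambda>q i. 0"]) (use lo in \<open>auto simp: tot_def C0 D_def dQ_def lin sgn_pow_def\<close>)
next
  case (Suc t)
  have "\<exists>y. tot C (Suc n) y \<and> (\<forall>q i. q + i \<le> n \<longrightarrow> q < Q0 + t \<longrightarrow> z q i - D (Suc n) y q i = 0)"
    by (rule Suc.IH, rule Suc.prems) auto
  then obtain y where y: "tot C (Suc n) y"
    "\<forall>q i. q + i \<le> n \<longrightarrow> q < Q0 + t \<longrightarrow> z q i - D (Suc n) y q i = 0" by blast
  define w where "w = (\<lambda>q i. z q i - D (Suc n) y q i)"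
  have wC: "tot C n w" unfolding w_def by (rule tot_diff[OF z tot_D[OF y(1)]])
  have Dw: "D n w q i = 0" if "q + i < n" for q i
    unfolding w_def using D_D[OF y(1) that] Dz that by (simp add: D_diff)
  obtain e where e: "tot C (Suc n) e"
    "\<forall>q i. q + i \<le> n \<longrightarrow> q < Suc (Q0 + t) \<longrightarrow> w q i - D (Suc n) e q i = 0"
    using reduce_step[of n w "Q0 + t"] wC Dw y(2) Suc.prems[of "Q0 + t"] by (auto simp: w_def tot_def)
  then show ?case using tot_add[OF y(1) e(1)]
    by (intro exI[of _ "\<lambda>q i. y q i + e q i"]) (auto simp: D_add w_def diff_diff_add)
qed

text \<open>Stands in for a comparison of dimensions: coefficient vectors of length \<open>k\<close>
  outnumber label vectors of length \<open>l\<close>, whatever the labelling \<open>f\<close>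
  is.\<close>

lemma card_pow_pigeonhole:
  fixes f :: "(nat \<Rightarrow> nat) \<Rightarrow> nat \<Rightarrow> nat"
  assumes "p > 1" "l < k" "\<And>u i. i < l \<Longrightarrow> f u i < p"
  shows "\<exists>u v. (\<forall>i<k. u i < p \<and> v i < p) \<and> (\<exists>i<k. u i \<noteq> v i) \<and> (\<forall>i<l. f u i = f v i)"
proof -
  define U where "U = ({..<k} \<rightarrow>\<^sub>E {..<p})"
  define V where "V = ({..<l} \<rightarrow>\<^sub>E {..<p})"
  define g where "g = (\<lambda>u. restrict (f u) {..<l})"
  have "card U = p ^ k" "card V = p ^ l" by (simp_all add: U_def V_def card_PiE)
  then have "card V < card U" using assms by (simp add: power_strict_increasing)
  moreover have "g ` U \<subseteq> V" using assms(3) by (auto simp: g_def V_def split: if_splits)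
  moreover have "finite V" by (simp add: V_def finite_PiE)
  ultimately have "\<not> inj_on g U" by (meson card_inj_on_le not_less)
  then obtain u v where uv: "u \<in> U" "v \<in> U" "g u = g v" "u \<noteq> v" by (auto simp: inj_on_def)
  have "\<exists>i<k. u i \<noteq> v i"
    using uv(1,2,4) PiE_ext[of u "{..<k}" "\<lambda>_. {..<p}" v] by (auto simp: U_def)
  moreover have "f u i = f v i" if "i < l" for i
    using fun_cong[OF uv(3), of i] that by (simp add: g_def)
  moreover have "\<forall>i<k. u i < p \<and> v i < p" using uv(1,2) by (auto simp: U_def)
  ultimately show ?thesis by blast
qed

theorem no_small_fixed_homology:
  assumes p: "p > 1" and rm: "r < m"
    and ac: "\<And>q x. q \<noteq> m \<Longrightarrow> x \<in> C q \<Longrightarrow> bd x = 0 \<Longrightarrow> \<exists>y\<in>C (Suc q). x = bd y"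
    and cl: "\<And>x. cl x < p"
      "\<And>x y. x \<in> C m \<Longrightarrow> y \<in> C m \<Longrightarrow> bd x = 0 \<Longrightarrow> bd y = 0 \<Longrightarrow> cl x = cl y \<Longrightarrow> \<exists>e\<in>C (Suc m). x - y = bd e"
    and w: "w \<in> F r" "bd w = 0"
      "\<And>j k e. j < p \<Longrightarrow> k < p \<Longrightarrow> e \<in> F (Suc r) \<Longrightarrow> nmult j w - nmult k w = bd e \<Longrightarrow> j = k"
  shows False
proof -
  \<comment> \<open>Placing multiples of \<open>w\<close> in the \<open>n - r + 1\<close> components of chain degree \<open>r\<close> gives more cycles than
    there are classes in the \<open>n - m + 1\<close> components of chain degree \<open>m\<close>, so two of them are
    homologous in \<open>C\<close>, hence in \<open>F\<close>, where the resolution differentials vanish.\<close>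
  define n where "n = N + m"
  define z :: "(nat \<Rightarrow> nat) \<Rightarrow> nat \<Rightarrow> nat \<Rightarrow> 'b" where
    "z = (\<lambda>u q i. if q = r then nmult (u i) w else 0)"
  have wF: "nmult j w \<in> F r" for j
    using w(1) by (induction j) (auto simp: nmult_Suc F0 intro: Fadd)
  have zF: "tot F n (z u)" for u using wF F0 by (auto simp: tot_def z_def)
  have zC: "tot C n (z u)" for u using zF FC by (auto simp: tot_def)
  have DF: "D k f q i = sgn_pow (k - q) (bd (f (Suc q) i))" if "tot F k f" "q + i < k" for k f q i
  proof -
    have "a (Suc i) (f q (Suc i)) = 0" "b (k - q - i) (f q i) = 0"
      using that by (auto simp: tot_def intro!: aF[of _ q] bF[of _ q])
    then show ?thesis by (simp add: D_def dQ_def sgn_pow_def)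
  qed
  have Dz: "D n (z u) q i = 0" if "q + i < n" for u q i
    using DF[OF zF that, of u] w(2) by (simp add: z_def additive_nmult_commute[OF add_bd] lin)
      (simp add: sgn_pow_def nmult_def)
  \<comment> \<open>Since \<open>C\<close> is acyclic below \<open>m\<close>, every cycle
    \<open>z u\<close> can be moved into chain degrees at least \<open>m\<close>, where the labels
    \<open>cl\<close> can see it.\<close>
  have "\<exists>y. tot C (Suc n) y \<and> (\<forall>q i. q + i \<le> n \<longrightarrow> q < 0 + m \<longrightarrow> z u q i - D (Suc n) y q i = 0)" for u
    by (rule reduce_upto[OF zC]) (use Dz ac in auto)
  then obtain y where y: "\<And>u. tot C (Suc n) (y u)"
    "\<And>u q i. q + i \<le> n \<Longrightarrow> q < m \<Longrightarrow> z u q i - D (Suc n) (y u) q i = 0" by (metis add_0)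
  define z' where "z' = (\<lambda>u q i. z u q i - D (Suc n) (y u) q i)"
  have z'C: "tot C n (z' u)" for u unfolding z'_def by (rule tot_diff[OF zC tot_D[OF y(1)]])
  have Dz': "D n (z' u) q i = 0" if "q + i < n" for u q i
    unfolding z'_def using D_D[OF y(1) that] Dz[OF that] by (simp add: D_diff)
  have "Suc (n - m) < Suc (n - r)" using rm by (simp add: n_def)
  then have "\<exists>u v. (\<forall>i<Suc (n - r). u i < p \<and> v i < p) \<and> (\<exists>i<Suc (n - r). u i \<noteq> v i)
      \<and> (\<forall>i<Suc (n - m). cl (z' u m i) = cl (z' v m i))"
    by (rule card_pow_pigeonhole[OF p]) (rule cl(1))
  then obtain u v where uv: "\<forall>i<Suc (n - r). u i < p \<and> v i < p" "\<exists>i<Suc (n - r). u i \<noteq> v i"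
      "\<forall>i<Suc (n - m). cl (z' u m i) = cl (z' v m i)"
    by metis
  define x where "x = (\<lambda>q i. z' u q i - z' v q i)"
  have xC: "tot C n x" unfolding x_def by (rule tot_diff[OF z'C z'C])
  have Dx: "\<forall>q i. q + i < n \<longrightarrow> D n x q i = 0" unfolding x_def by (simp add: D_diff Dz')
  have x0: "\<forall>q i. q + i \<le> n \<longrightarrow> q < m \<longrightarrow> x q i = 0" using y(2) by (simp add: x_def z'_def)
  have bdz': "bd (z' u m i) = 0" if "m + i \<le> n" for u i
  proof -
    obtain R where R: "m = Suc R" using rm by (cases m) auto
    have "dQ (n - R) (z' u R) i = 0" using y(2) that R by (simp add: dQ_def z'_def lin sgn_pow_def)
    then have "sgn_pow (n - R) (bd (z' u m i)) = 0" using Dz'[of R i u] R that by (simp add: D_def)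
    then show ?thesis by (simp add: sgn_pow_def split: if_splits)
  qed
  have "\<exists>e. tot C (Suc n) e \<and> (\<forall>q i. q + i \<le> n \<longrightarrow> q < Suc m \<longrightarrow> x q i - D (Suc n) e q i = 0)"
  proof (rule reduce_step[OF xC Dx x0], intro allI impI)
    fix i assume i: "m + i \<le> n"
    then show "\<exists>e\<in>C (Suc m). x m i = bd e"
      unfolding x_def using z'C[of u] z'C[of v] uv(3) bdz'[OF i]
      by (intro cl(2)) (auto simp: tot_def)
  qed
  then obtain e where e: "tot C (Suc n) e"
    "\<forall>q i. q + i \<le> n \<longrightarrow> q < Suc m \<longrightarrow> x q i - D (Suc n) e q i = 0" by blast
  define x' where "x' = (\<lambda>q i. x q i - D (Suc n) e q i)"
  have x'C: "tot C n x'" unfolding x'_def by (rule tot_diff[OF xC tot_D[OF e(1)]])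
  have Dx': "\<forall>q i. q + i < n \<longrightarrow> D n x' q i = 0"
    unfolding x'_def using D_D[OF e(1)] Dx by (simp add: D_diff)
  \<comment> \<open>Past degree \<open>m\<close> the complex \<open>C\<close> is acyclic again, and
    in total degree \<open>n\<close> no chain degree exceeds \<open>n\<close>, so \<open>n\<close>
    further steps exhaust all components.\<close>
  have "\<exists>f. tot C (Suc n) f \<and> (\<forall>q i. q + i \<le> n \<longrightarrow> q < Suc m + n \<longrightarrow> x' q i - D (Suc n) f q i = 0)"
    by (rule reduce_upto[OF x'C Dx']) (use e(2) ac in \<open>auto simp: x'_def\<close>)
  then obtain f where f: "tot C (Suc n) f"
    "\<forall>q i. q + i \<le> n \<longrightarrow> x' q i - D (Suc n) f q i = 0" by auto
  define g where "g = (\<lambda>q i. (y u q i - y v q i) + (e q i + f q i))"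
  have gC: "tot C (Suc n) g" unfolding g_def by (intro tot_add tot_diff y(1) e(1) f(1))
  have Dg: "D (Suc n) g q i = z u q i - z v q i" if "q + i \<le> n" for q i
    using f(2)[rule_format, OF that]
    by (simp add: g_def D_add D_diff x'_def x_def z'_def algebra_simps)
  \<comment> \<open>The boundary of \<open>g\<close> is \<open>z u - z v\<close>, which lies in
    \<open>F\<close>. Thus \<open>g\<close> is a relative cycle, and relative exactness replaces it
    by an element of \<open>F\<close> with the same boundary.\<close>
  have "\<exists>h. tot C (Suc (Suc n)) h \<and> tot F (Suc n) (\<lambda>q i. g q i - D (Suc (Suc n)) h q i)"
  proof (rule rel_exact[OF _ gC], goal_cases)
    case 2 show ?case using Dg zF by (auto simp: tot_def intro: Fdiff)
  qed (simp add: n_def)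
  then obtain h where h: "tot C (Suc (Suc n)) h" "tot F (Suc n) (\<lambda>q i. g q i - D (Suc (Suc n)) h q i)" by blast
  define k where "k = (\<lambda>q i. g q i - D (Suc (Suc n)) h q i)"
  have kF: "tot F (Suc n) k" using h(2) by (simp add: k_def)
  obtain i where i: "i \<le> n - r" "u i \<noteq> v i" using uv(2) by (auto simp: less_Suc_eq_le)
  then have ri: "r + i \<le> n" using rm by (auto simp: n_def)
  have "sgn_pow (Suc n - r) (bd (k (Suc r) i)) = D (Suc n) k r i" using DF[OF kF, of r i] ri by simp
  also have "\<dots> = D (Suc n) g r i" unfolding k_def using D_D[OF h(1), of r i] ri by (simp add: D_diff)
  also have "\<dots> = nmult (u i) w - nmult (v i) w" using Dg[OF ri] by (simp add: z_def)
  finally have "nmult (u i) w - nmult (v i) w = bd (sgn_pow (Suc n - r) (k (Suc r) i))" by (simp add: lin_sgn)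
  moreover have "sgn_pow (Suc n - r) (k (Suc r) i) \<in> F (Suc r)" using kF ri by (intro Fsgn) (auto simp: tot_def)
  ultimately show False using w(3)[of "u i" "v i"] uv(1) i by auto
qed

end

section \<open>Locally finite alternating chains\<close>

lemma sum_fun_apply: "(\<Sum>i\<in>I. f i) x = (\<Sum>i\<in>I. f i x)"
  for f :: "'i \<Rightarrow> 'x \<Rightarrow> 'k::comm_monoid_add"
  by (induction I rule: infinite_finite_induct) auto

text \<open>The diagonal is a separate assumption, since \<open>h x x = - h x x\<close> does not
  force zero when the coefficients have 2-torsion.\<close>

lemma sum_antisym:
  fixes h :: "'a \<Rightarrow> 'a \<Rightarrow> 'k::ab_group_add"
  assumes "finite S" "\<And>x y. h x y = - h y x" "\<And>x. h x x = 0"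
  shows "(\<Sum>x\<in>S. \<Sum>y\<in>S. h x y) = 0"
  using assms(1)
proof induction
  case (insert a S)
  have "(\<Sum>x\<in>S. h x a) = - (\<Sum>x\<in>S. h a x)" by (subst assms(2)) (simp add: sum_negf)
  with insert show ?case by (simp add: sum.distrib assms(3))
qed simp

text \<open>
  Unlike in the chains of the definitions, degenerate simplices are allowed as arguments (with value
  zero), and coefficients live in an arbitrary group; signs are governed by adjacent transpositions.
\<close>

definition alternating :: "('v list \<Rightarrow> 'k::ab_group_add) \<Rightarrow> bool" where
  "alternating c \<longleftrightarrow> (\<forall>xs u v ys. c (xs @ u # v # ys) = - c (xs @ v # u # ys)) \<and>
     (\<forall>xs u ys. c (xs @ u # u # ys) = 0)"

lemma alternating_swap: "alternating c \<Longrightarrow> c (xs @ u # v # ys) = - c (xs @ v # u # ys)"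
  unfolding alternating_def by blast

lemma alternating_repeat: "alternating c \<Longrightarrow> c (xs @ u # u # ys) = 0"
  unfolding alternating_def by blast

lemma alternatingD:
  assumes "alternating c"
  shows "c (u # v # ys) = - c (v # u # ys)" "c (u # u # ys) = 0"
  by (rule alternating_swap[OF assms, of "[]" u v ys, unfolded append.simps])
    (rule alternating_repeat[OF assms, of "[]" u ys, unfolded append.simps])

lemma alternating_slice:
  assumes "alternating c" shows "alternating (\<lambda>ys. c (x # ys))"
  unfolding alternating_def
proof (intro conjI allI)
  fix xs u v ys
  show "c (x # xs @ u # v # ys) = - c (x # xs @ v # u # ys)"
    using alternating_swap[OF assms, of "x # xs" u v ys] unfolding append.simps .
  show "c (x # xs @ u # u # ys) = 0"
    using alternating_repeat[OF assms, of "x # xs" u ys] unfolding append.simps .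
qed

lemma alternatingI:
  assumes "\<And>u v ys. c (u # v # ys) = - c (v # u # ys)" "\<And>u ys. c (u # u # ys) = 0"
    "\<And>x. alternating (\<lambda>ys. c (x # ys))"
  shows "alternating c"
  unfolding alternating_def
proof (intro conjI allI)
  fix xs u v ys
  show "c (xs @ u # v # ys) = - c (xs @ v # u # ys)"
  proof (cases xs)
    case Nil show ?thesis unfolding Nil append.simps by (rule assms(1))
  next
    case (Cons x xs') show ?thesis unfolding Cons append.simps by (rule alternating_swap[OF assms(3)])
  qed
  show "c (xs @ u # u # ys) = 0"
    using assms(2) alternating_repeat[OF assms(3)] by (cases xs) simp_all
qed

lemma alternating_0: "alternating (\<lambda>_. 0)" by (simp add: alternating_def)
lemma alternating_minus:
  assumes "alternating c" shows "alternating (\<lambda>vs. - c vs)"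
  unfolding alternating_def
proof (intro conjI allI)
  fix xs u v ys
  show "- c (xs @ u # v # ys) = - (- c (xs @ v # u # ys))"
    by (subst alternating_swap[OF assms]) (rule refl)
qed (simp add: alternating_repeat[OF assms])
lemma alternating_add:
  assumes c: "alternating c" and d: "alternating d" shows "alternating (\<lambda>vs. c vs + d vs)"
  unfolding alternating_def
proof (intro conjI allI)
  fix xs u v ys
  show "c (xs @ u # v # ys) + d (xs @ u # v # ys) = - (c (xs @ v # u # ys) + d (xs @ v # u # ys))"
    using alternating_swap[OF c, of xs u v ys] alternating_swap[OF d, of xs u v ys]
    by (simp only: minus_add_distrib)
qed (simp add: alternating_repeat[OF c] alternating_repeat[OF d])
lemma alternating_diff: "alternating c \<Longrightarrow> alternating d \<Longrightarrow> alternating (\<lambda>vs. c vs - d vs)"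
  using alternating_add[OF _ alternating_minus, of c d] by simp
lemma alternating_sum: "(\<And>i. i \<in> I \<Longrightarrow> alternating (c i)) \<Longrightarrow> alternating (\<lambda>vs. \<Sum>i\<in>I. c i vs)"
  by (induction I rule: infinite_finite_induct) (auto intro: alternating_0 alternating_add)

lemma alternating_far_repeat: "alternating c \<Longrightarrow> c (xs @ u # ms @ u # ys) = 0"
proof (induction ms arbitrary: xs)
  case Nil then show ?case by (simp add: alternating_repeat)
next
  case (Cons m ms)
  have "c (xs @ u # m # ms @ u # ys) = - c ((xs @ [m]) @ u # ms @ u # ys)"
    using alternating_swap[OF Cons.prems, of xs u m] by simp
  also have "\<dots> = 0" using Cons.IH[OF Cons.prems, of "xs @ [m]"] by simp
  finally show ?case by simp
qed

lemma alternating_not_distinct: "alternating c \<Longrightarrow> \<not> distinct vs \<Longrightarrow> c vs = 0"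
  using not_distinct_decomp[of vs] alternating_far_repeat[of c] by fastforce

lemma alternating_far_swap: "alternating c \<Longrightarrow> c (xs @ u # ms @ v # ys) = - c (xs @ v # ms @ u # ys)"
proof (induction ms arbitrary: xs)
  case Nil then show ?case using alternating_swap[of c xs u v ys] by simp
next
  case (Cons m ms)
  have "c (xs @ u # m # ms @ v # ys) = - c ((xs @ [m]) @ u # ms @ v # ys)"
    using alternating_swap[OF Cons.prems, of xs u m] by simp
  also have "\<dots> = c ((xs @ [m]) @ v # ms @ u # ys)" using Cons.IH[OF Cons.prems, of "xs @ [m]"] by simp
  also have "\<dots> = - c (xs @ v # m # ms @ u # ys)"
    using alternating_swap[OF Cons.prems, of xs v m] by simp
  finally show ?case by simp
qed

text \<open>
  \<open>cone w e\<close> is the chain $w * e$: the alternating signed sum over the occurrences of \<open>w\<close> in the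
  argument of the values of \<open>e\<close> with that occurrence deleted.
\<close>

fun push :: "'v set \<Rightarrow> ('v \<Rightarrow> 'w) \<Rightarrow> ('v list \<Rightarrow> 'k::ab_group_add) \<Rightarrow> 'w list \<Rightarrow> 'k" where
  "push V f c [] = c []"
| "push V f c (w # ws) = (\<Sum>v\<in>{v\<in>V. f v = w}. push V f (\<lambda>vs. c (v # vs)) ws)"

fun cone :: "'v \<Rightarrow> ('v list \<Rightarrow> 'k::ab_group_add) \<Rightarrow> 'v list \<Rightarrow> 'k" where
  "cone w e [] = 0"
| "cone w e (x # xs) = (if x = w then e xs else 0) - cone w (\<lambda>ys. e (x # ys)) xs"

lemma push_zero [simp]: "push V f (\<lambda>vs. 0) ws = 0" by (induction ws) simp_all
lemma push_add: "push V f (\<lambda>vs. c vs + d vs) ws = push V f c ws + push V f d ws"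
  by (induction ws arbitrary: c d) (simp_all add: sum.distrib)
lemma push_minus: "push V f (\<lambda>vs. - c vs) ws = - push V f c ws"
  by (induction ws arbitrary: c) (simp_all add: sum_negf)
lemma push_diff: "push V f (\<lambda>vs. c vs - d vs) ws = push V f c ws - push V f d ws"
  using push_add[of V f c "\<lambda>vs. - d vs" ws] by (simp add: push_minus)
lemma push_sum: "push V f (\<lambda>vs. \<Sum>i\<in>I. c i vs) ws = (\<Sum>i\<in>I. push V f (c i) ws)"
  by (induction I rule: infinite_finite_induct) (simp_all add: push_add)
lemma additive_push: "additive_map (push V f)"
  by (auto intro!: additive.intro simp: fun_eq_iff plus_fun_def push_add)

lemma cone_zero [simp]: "cone w (\<lambda>vs. 0) ws = 0" by (induction ws) simp_all
lemma cone_add: "cone w (\<lambda>vs. c vs + d vs) ws = cone w c ws + cone w d ws"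
  by (induction ws arbitrary: c d) simp_all
lemma cone_minus: "cone w (\<lambda>vs. - c vs) ws = - cone w c ws"
  by (induction ws arbitrary: c) simp_all
lemma cone_sum: "cone w (\<lambda>vs. \<Sum>i\<in>I. c i vs) ws = (\<Sum>i\<in>I. cone w (c i) ws)"
  by (induction I rule: infinite_finite_induct) (simp_all add: cone_add)

lemma push_supp: "push V f c ws \<noteq> 0 \<Longrightarrow> \<exists>vs. c vs \<noteq> 0 \<and> map f vs = ws \<and> set vs \<subseteq> V"
proof (induction ws arbitrary: c)
  case (Cons w ws)
  then obtain v where "v \<in> V" "f v = w" "push V f (\<lambda>vs. c (v # vs)) ws \<noteq> 0"
    by (auto elim!: sum.not_neutral_contains_not_neutral)
  with Cons.IH[of "\<lambda>vs. c (v # vs)"] show ?case by (metis (no_types, lifting) list.simps(9) insert_subset list.simps(15))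
qed auto

lemma cone_supp: "cone w e ws \<noteq> 0 \<Longrightarrow> \<exists>xs ys. ws = xs @ w # ys \<and> e (xs @ ys) \<noteq> 0"
proof (induction ws arbitrary: e)
  case (Cons x xs)
  show ?case
  proof (cases "x = w \<and> e xs \<noteq> 0")
    case True then show ?thesis by (intro exI[of _ "[]"] exI[of _ xs]) auto
  next
    case False
    then have "cone w (\<lambda>ys. e (x # ys)) xs \<noteq> 0" using Cons.prems by (auto split: if_splits)
    from Cons.IH[OF this] show ?thesis by (metis append_Cons)
  qed
qed simp

lemma push_cong:
  assumes "\<And>v. v \<in> V \<Longrightarrow> f v = g v" shows "push V f c ws = push V g c ws"
proof (induction ws arbitrary: c)
  case (Cons w ws)
  have "{v \<in> V. f v = w} = {v \<in> V. g v = w}" using assms by auto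
  then show ?case by (simp add: Cons)
qed simp

lemma push_restrict:
  assumes "W \<subseteq> V" "\<And>w. finite {v \<in> V. f v = w}" "\<And>vs. c vs \<noteq> 0 \<Longrightarrow> set vs \<subseteq> W"
  shows "push V f c ws = push W f c ws"
  using assms(3)
proof (induction ws arbitrary: c)
  case (Cons w ws)
  have "push V f c (w # ws) = (\<Sum>v\<in>{v \<in> W. f v = w}. push V f (\<lambda>vs. c (v # vs)) ws)"
    unfolding push.simps
  proof (rule sum.mono_neutral_right)
    show "\<forall>v\<in>{v \<in> V. f v = w} - {v \<in> W. f v = w}. push V f (\<lambda>vs. c (v # vs)) ws = 0"
    proof
      fix v assume "v \<in> {v \<in> V. f v = w} - {v \<in> W. f v = w}"
      then have "v \<notin> W" by auto
      then have "c (v # vs) = 0" for vs using Cons.prems[of "v # vs"] by auto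
      then show "push V f (\<lambda>vs. c (v # vs)) ws = 0" by simp
    qed
  qed (use assms in auto)
  also have "\<dots> = push W f c (w # ws)" unfolding push.simps
  proof (rule sum.cong)
    fix v assume "v \<in> {v \<in> W. f v = w}"
    show "push V f (\<lambda>vs. c (v # vs)) ws = push W f (\<lambda>vs. c (v # vs)) ws"
    proof (rule Cons.IH)
      fix vs assume "c (v # vs) \<noteq> 0"
      from Cons.prems[OF this] show "set vs \<subseteq> W" by simp
    qed
  qed simp
  finally show ?case .
qed simp

lemma push_push:
  assumes "\<And>v. v \<in> V \<Longrightarrow> f v \<in> W" "\<And>w. finite {v \<in> V. f v = w}" "\<And>x. finite {w \<in> W. g w = x}"
  shows "push W g (push V f c) xs = push V (g \<circ> f) c xs"
proof (induction xs arbitrary: c)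
  case (Cons x xs)
  have fin: "finite {v \<in> V. (g \<circ> f) v = x}"
  proof (rule finite_subset)
    show "{v \<in> V. (g \<circ> f) v = x} \<subseteq> (\<Union>w\<in>{w \<in> W. g w = x}. {v \<in> V. f v = w})" using assms(1) by auto
  qed (use assms in auto)
  have "push W g (push V f c) (x # xs) =
      (\<Sum>w\<in>{w \<in> W. g w = x}. \<Sum>v\<in>{v \<in> V. f v = w}. push V (g \<circ> f) (\<lambda>vs. c (v # vs)) xs)"
    by (simp only: push.simps push_sum Cons.IH)
  also have "\<dots> = (\<Sum>w\<in>{w \<in> W. g w = x}. \<Sum>v\<in>{v \<in> {v \<in> V. (g \<circ> f) v = x}. f v = w}. push V (g \<circ> f) (\<lambda>vs. c (v # vs)) xs)"
    by (intro sum.cong) auto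
  also have "\<dots> = (\<Sum>v\<in>{v \<in> V. (g \<circ> f) v = x}. push V (g \<circ> f) (\<lambda>vs. c (v # vs)) xs)"
    by (rule sum.group) (use fin assms in auto)
  finally show ?case by (simp only: push.simps(2))
qed simp

text \<open>Alternation survives the identification of vertices by \<open>f\<close>: a repeated
  entry in the target gives an antisymmetric double sum over one and the same fibre.\<close>

lemma push_alternating: "alternating c \<Longrightarrow> (\<And>w. finite {v \<in> V. f v = w}) \<Longrightarrow> alternating (push V f c)"
proof -
  assume c: "alternating c" and fin: "\<And>w. finite {v \<in> V. f v = w}"
  have 1: "alternating d \<Longrightarrow> push V f d (u # v # ys) = - push V f d (v # u # ys)" for d u v ys
  proof -
    assume d: "alternating d"
    have "push V f d (u # v # ys) = (\<Sum>x\<in>{x\<in>V. f x = u}. \<Sum>y\<in>{y\<in>V. f y = v}. push V f (\<lambda>vs. d (x # y # vs)) ys)"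
      by simp
    also have "\<dots> = (\<Sum>y\<in>{y\<in>V. f y = v}. \<Sum>x\<in>{x\<in>V. f x = u}. push V f (\<lambda>vs. d (x # y # vs)) ys)"
      by (rule sum.swap)
    also have "\<dots> = (\<Sum>y\<in>{y\<in>V. f y = v}. \<Sum>x\<in>{x\<in>V. f x = u}. - push V f (\<lambda>vs. d (y # x # vs)) ys)"
      by (subst alternatingD(1)[OF d]) (simp only: push_minus)
    finally show ?thesis by (simp add: sum_negf)
  qed
  have 2: "alternating d \<Longrightarrow> push V f d (u # u # ys) = 0" for d u ys
  proof -
    assume d: "alternating d"
    have "(\<Sum>x\<in>{x\<in>V. f x = u}. \<Sum>y\<in>{y\<in>V. f y = u}. push V f (\<lambda>vs. d (x # y # vs)) ys) = 0"
    proof (rule sum_antisym)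
      fix x y
      show "push V f (\<lambda>vs. d (x # y # vs)) ys = - push V f (\<lambda>vs. d (y # x # vs)) ys"
        by (subst alternatingD(1)[OF d]) (simp only: push_minus)
    qed (use fin alternatingD(2)[OF d] in simp_all)
    then show ?thesis by simp
  qed
  have "alternating d \<Longrightarrow> push V f d (xs @ u # v # ys) = - push V f d (xs @ v # u # ys)
      \<and> push V f d (xs @ u # u # ys) = 0" for d xs u v ys
  proof (induction xs arbitrary: d)
    case Nil then show ?case using 1[of d u v ys] 2[of d u ys] by simp
  next
    case (Cons x xs)
    from Cons.IH[OF alternating_slice[OF Cons.prems]]
    have *: "push V f (\<lambda>vs. d (a # vs)) (xs @ u # v # ys) = - push V f (\<lambda>vs. d (a # vs)) (xs @ v # u # ys)"
      "push V f (\<lambda>vs. d (a # vs)) (xs @ u # u # ys) = 0" for a by blast+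
    have "push V f d (x # xs @ u # v # ys) = (\<Sum>a\<in>{a\<in>V. f a = x}. - push V f (\<lambda>vs. d (a # vs)) (xs @ v # u # ys))"
      unfolding push.simps by (rule sum.cong[OF refl *(1)])
    then show ?case using *(2) by (simp add: sum_negf)
  qed
  then show ?thesis using c unfolding alternating_def[of "push V f c"] by blast
qed

lemma cone_alternating: "alternating e \<Longrightarrow> alternating (cone w e)"
proof -
  assume e: "alternating e"
  have "alternating e \<Longrightarrow> cone w e (xs @ u # v # ys) = - cone w e (xs @ v # u # ys)
      \<and> cone w e (xs @ u # u # ys) = 0" for e :: "'a list \<Rightarrow> 'b" and xs u v ys
  proof (induction xs arbitrary: e)
    case Nil
    have "(\<lambda>vs. e (u # v # vs)) = (\<lambda>vs. - e (v # u # vs))" by (rule ext) (rule alternatingD(1)[OF Nil])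
    moreover have "(\<lambda>vs. e (u # u # vs)) = (\<lambda>vs. 0)" using alternatingD(2)[OF Nil] by auto
    ultimately show ?case by (simp add: cone_minus)
  next
    case (Cons x xs)
    have "e (xs @ u # v # ys) = - e (xs @ v # u # ys)" "e (xs @ u # u # ys) = 0"
      by (rule alternating_swap[OF Cons.prems], rule alternating_repeat[OF Cons.prems])
    with Cons.IH[OF alternating_slice[OF Cons.prems, of x]] show ?case by simp
  qed
  then show ?thesis using e unfolding alternating_def[of "cone w e"] by blast
qed

text \<open>The star of a vertex is the cone over its link. This isolates the part of a chain that
  changes when only the image of \<open>v\<close> is moved.\<close>

lemma cone_link: "alternating c \<Longrightarrow> cone v (\<lambda>vs. c (v # vs)) ws = (if v \<in> set ws then c ws else 0)"
proof (induction ws arbitrary: c)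
  case (Cons x xs)
  show ?case
  proof (cases "x = v")
    case True then show ?thesis using alternatingD(2)[OF Cons.prems] by simp
  next
    case False
    have "(\<lambda>ys. c (v # x # ys)) = (\<lambda>ys. - c (x # v # ys))"
      by (rule ext) (rule alternatingD(1)[OF Cons.prems])
    then show ?thesis using False Cons.IH[OF alternating_slice[OF Cons.prems, of x]] by (simp add: cone_minus)
  qed
qed simp

lemma push_cone:
  assumes v: "v \<in> V" and fin: "\<And>w. finite {v \<in> V. f v = w}"
  shows "push V f (cone v l) ws = cone (f v) (push V f l) ws"
proof (induction ws arbitrary: l)
  case (Cons w ws)
  let ?S = "{x \<in> V. f x = w}"
  have "push V f (cone v l) (w # ws) =
      (\<Sum>x\<in>?S. (if x = v then push V f l ws else 0) - cone (f v) (push V f (\<lambda>ys. l (x # ys))) ws)"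
    by (simp add: push_diff Cons if_distrib[of "\<lambda>c. push V f c ws"] cong: if_cong)
       (rule sum.cong; simp)
  also have "\<dots> = (if f v = w then push V f l ws else 0) - cone (f v) (\<lambda>ys. \<Sum>x\<in>?S. push V f (\<lambda>ys. l (x # ys)) ys) ws"
    using v fin[of w] by (simp add: sum_subtractf cone_sum sum.delta)
  finally show ?case by auto
qed simp

text \<open>The cone formula: the boundary of \<open>w * e\<close> is \<open>e\<close> minus
  \<open>w\<close> joined to the boundary of \<open>e\<close>, with the new vertex ranging over a
  finite set \<open>M\<close>.\<close>

lemma sum_cone:
  assumes "finite M"
  shows "(\<Sum>u\<in>M. cone w e (u # ws)) = (if w \<in> M then e ws else 0) - cone w (\<lambda>ys. \<Sum>u\<in>M. e (u # ys)) ws"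
  using assms by (simp add: sum_subtractf cone_sum sum.delta')

text \<open>All simplices extending \<open>v # vs\<close> have their new vertex among the neighbours
  of \<open>v\<close>. Summing over these, instead of over the support of \<open>c\<close>, makes
  the index set independent of \<open>c\<close> and the boundary additive without side
  conditions.\<close>

fun boundary :: "('v \<Rightarrow> 'v set) \<Rightarrow> ('v list \<Rightarrow> 'k::ab_group_add) \<Rightarrow> 'v list \<Rightarrow> 'k" where
  "boundary nb c [] = 0"
| "boundary nb c (v # vs) = (\<Sum>u\<in>nb v. c (u # v # vs))"

lemma additive_boundary: "additive_map (boundary nb)"
proof (rule additive.intro, rule ext)
  fix x y :: "'a list \<Rightarrow> 'b" and vs
  show "boundary nb (x + y) vs = (boundary nb x + boundary nb y) vs"
    by (cases vs) (simp_all add: sum.distrib)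
qed

definition nbr :: "'a set set \<Rightarrow> 'a set \<Rightarrow> 'a set set" where
  "nbr \<U> U = {V \<in> \<U>. U \<inter> V \<noteq> {}}"

definition locfin :: "'a set set \<Rightarrow> bool" where
  "locfin \<U> \<longleftrightarrow> (\<forall>U\<in>\<U>. finite (nbr \<U> U))"

text \<open>Local finiteness is not demanded of the chain: for a family with \<open>locfin\<close>
  each vertex lies in only finitely many simplices of given dimension. The last clause cuts the
  coefficients down to the \<open>p\<close>-torsion of the ambient group.\<close>

definition chains :: "nat \<Rightarrow> 'a set set \<Rightarrow> nat \<Rightarrow> ('a set list \<Rightarrow> 'k::ab_group_add) set" where
  "chains p \<U> q = {c. alternating c \<and>
     (\<forall>vs. c vs \<noteq> 0 \<longrightarrow> length vs = Suc q \<and> set vs \<subseteq> \<U> \<and> \<Inter>(set vs) \<noteq> {}) \<and>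
     (\<forall>vs. nmult p (c vs) = 0)}"

lemma chains_alternating: "c \<in> chains p \<U> q \<Longrightarrow> alternating c"
  and chains_supp: "c \<in> chains p \<U> q \<Longrightarrow> c vs \<noteq> 0 \<Longrightarrow> length vs = Suc q \<and> set vs \<subseteq> \<U> \<and> \<Inter>(set vs) \<noteq> {}"
  and chains_tors: "c \<in> chains p \<U> q \<Longrightarrow> nmult p (c vs) = 0"
  by (auto simp: chains_def)

lemma chains_0: "(\<lambda>_. 0) \<in> chains p \<U> q"
  by (simp add: chains_def alternating_0 additive.zero[OF additive_nmult])
lemma chains_zero: "0 \<in> chains p \<U> q" using chains_0 by (simp add: zero_fun_def)

lemma chains_diff: "c \<in> chains p \<U> q \<Longrightarrow> d \<in> chains p \<U> q \<Longrightarrow> (\<lambda>vs. c vs - d vs) \<in> chains p \<U> q"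
proof -
  assume c: "c \<in> chains p \<U> q" and d: "d \<in> chains p \<U> q"
  have "c vs \<noteq> 0 \<or> d vs \<noteq> 0" if "c vs - d vs \<noteq> 0" for vs using that by auto
  then show ?thesis
    using chains_supp[OF c] chains_supp[OF d] chains_alternating[OF c] chains_alternating[OF d]
      chains_tors[OF c] chains_tors[OF d]
    unfolding chains_def by (simp add: alternating_diff additive.diff[OF additive_nmult]) blast
qed
lemma chains_minus: "c \<in> chains p \<U> q \<Longrightarrow> d \<in> chains p \<U> q \<Longrightarrow> c - d \<in> chains p \<U> q"
  using chains_diff[of c p \<U> q d] by (simp add: fun_diff_def)
lemma chains_uminus: "c \<in> chains p \<U> q \<Longrightarrow> - c \<in> chains p \<U> q"
  using chains_minus[OF chains_zero, of c p \<U> q] by simp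
lemma chains_plus: "c \<in> chains p \<U> q \<Longrightarrow> d \<in> chains p \<U> q \<Longrightarrow> c + d \<in> chains p \<U> q"
  using chains_minus[OF _ chains_uminus, of c p \<U> q d] by simp
lemma chains_sum: "(\<And>i. i \<in> I \<Longrightarrow> f i \<in> chains p \<U> q) \<Longrightarrow> sum f I \<in> chains p \<U> q"
  by (induction I rule: infinite_finite_induct) (simp_all add: chains_zero chains_plus)

lemma chains_nbr:
  assumes "c \<in> chains p \<U> q" "c (u # v # vs) \<noteq> 0"
  shows "u \<in> nbr \<U> v" "u \<in> \<U>" "v \<in> \<U>"
  using chains_supp[OF assms] by (auto simp: nbr_def)

lemma boundary_eq:
  assumes c: "c \<in> chains p \<U> q" and lf: "locfin \<U>" and N: "finite N" "\<And>u. c (u # v # vs) \<noteq> 0 \<Longrightarrow> u \<in> N"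
  shows "boundary (nbr \<U>) c (v # vs) = (\<Sum>u\<in>N. c (u # v # vs))"
proof (cases "v \<in> \<U>")
  case True
  then have "finite (nbr \<U> v)" using lf by (simp add: locfin_def)
  then have "(\<Sum>u\<in>nbr \<U> v. c (u # v # vs)) = (\<Sum>u\<in>{u. c (u # v # vs) \<noteq> 0}. c (u # v # vs))"
    using chains_nbr[OF c] by (intro sum.mono_neutral_right) auto
  also have "\<dots> = (\<Sum>u\<in>N. c (u # v # vs))" using N by (intro sum.mono_neutral_left) auto
  finally show ?thesis by simp
next
  case False
  then have "c (u # v # vs) = 0" for u using chains_nbr[OF c] by blast
  then show ?thesis by simp
qed

lemma boundary_supp: "boundary nb c vs \<noteq> 0 \<Longrightarrow> \<exists>u v ys. vs = v # ys \<and> c (u # v # ys) \<noteq> 0"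
  by (cases vs) (auto elim!: sum.not_neutral_contains_not_neutral)

lemma boundary_chains:
  assumes c: "c \<in> chains p \<U> (Suc q)" and lf: "locfin \<U>"
  shows "boundary (nbr \<U>) c \<in> chains p \<U> q"
proof -
  have alt: "alternating c" by (rule chains_alternating[OF c])
  have "alternating (boundary (nbr \<U>) c)"
  proof (rule alternatingI)
    fix u v ys
    show "boundary (nbr \<U>) c (u # v # ys) = - boundary (nbr \<U>) c (v # u # ys)"
    proof (cases "u \<in> \<U> \<and> v \<in> \<U>")
      case True
      \<comment> \<open>The two orders of \<open>u\<close> and \<open>v\<close> lead to sums over
        neighbours of different vertices; \<open>boundary_eq\<close> brings both to this common
        index set.\<close>
      define N where "N = nbr \<U> u \<union> nbr \<U> v"
      have N: "finite N" using True lf by (simp add: N_def locfin_def)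
      have swap: "c (x # u # v # ys) = - c (x # v # u # ys)" for x
        by (rule alternatingD(1)[OF alternating_slice[OF alt]])
      have "boundary (nbr \<U>) c (u # v # ys) = (\<Sum>x\<in>N. c (x # u # v # ys))"
        by (rule boundary_eq[OF c lf N]) (use chains_nbr[OF c] in \<open>auto simp: N_def\<close>)
      also have "\<dots> = (\<Sum>x\<in>N. - c (x # v # u # ys))" by (rule sum.cong[OF refl swap])
      also have "\<dots> = - (\<Sum>x\<in>N. c (x # v # u # ys))" by (rule sum_negf)
      also have "(\<Sum>x\<in>N. c (x # v # u # ys)) = boundary (nbr \<U>) c (v # u # ys)"
        by (rule boundary_eq[OF c lf N, symmetric]) (use chains_nbr[OF c] in \<open>auto simp: N_def\<close>)
      finally show ?thesis .
    next
      case False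
      then have "c (x # u # v # ys) = 0" "c (x # v # u # ys) = 0" for x
        using chains_supp[OF c, of "x # u # v # ys"] chains_supp[OF c, of "x # v # u # ys"] by auto
      then show ?thesis by simp
    qed
    show "boundary (nbr \<U>) c (u # u # ys) = 0"
      using alternatingD(2)[OF alternating_slice[OF alt]] by simp
    show "alternating (\<lambda>ys. boundary (nbr \<U>) c (u # ys))"
      unfolding boundary.simps by (intro alternating_sum alternating_slice alt)
  qed
  moreover have "length vs = Suc q \<and> set vs \<subseteq> \<U> \<and> \<Inter>(set vs) \<noteq> {}" if "boundary (nbr \<U>) c vs \<noteq> 0" for vs
    using boundary_supp[OF that] chains_supp[OF c] by fastforce
  moreover have "nmult p (boundary (nbr \<U>) c vs) = 0" for vs
    by (cases vs) (simp_all add: additive.sum[OF additive_nmult] additive.zero[OF additive_nmult] chains_tors[OF c])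
  ultimately show ?thesis by (simp add: chains_def)
qed

lemma boundary_0_chain: "c \<in> chains p \<U> 0 \<Longrightarrow> boundary nb c = 0"
  using boundary_supp[of nb c] chains_supp[of c p \<U> 0] by (fastforce simp: fun_eq_iff)

lemma boundary_boundary:
  assumes c: "c \<in> chains p \<U> q" and lf: "locfin \<U>"
  shows "boundary (nbr \<U>) (boundary (nbr \<U>) c) = 0"
proof
  fix vs show "boundary (nbr \<U>) (boundary (nbr \<U>) c) vs = 0 vs"
  proof (cases vs)
    case (Cons v ys)
    show ?thesis
    proof (cases "v \<in> \<U>")
      case True
      have fin: "finite (nbr \<U> v)" using True lf by (simp add: locfin_def)
      have "boundary (nbr \<U>) (boundary (nbr \<U>) c) (v # ys) =
          (\<Sum>u\<in>nbr \<U> v. \<Sum>x\<in>nbr \<U> v. c (x # u # v # ys))"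
        unfolding boundary.simps(2)[of _ "boundary (nbr \<U>) c"]
      proof (rule sum.cong[OF refl])
        fix u
        show "boundary (nbr \<U>) c (u # v # ys) = (\<Sum>x\<in>nbr \<U> v. c (x # u # v # ys))"
        proof (rule boundary_eq[OF c lf fin])
          fix x assume "c (x # u # v # ys) \<noteq> 0"
          from chains_supp[OF c this] show "x \<in> nbr \<U> v" by (auto simp: nbr_def)
        qed
      qed
      also have "\<dots> = 0"
        by (rule sum_antisym[OF fin alternatingD[OF chains_alternating[OF c]]])
      finally show ?thesis using Cons by simp
    next
      case False
      then have "c (x # u # v # ys) = 0" for x u using chains_supp[OF c, of "x # u # v # ys"] by auto
      then show ?thesis using Cons by simp
    qed
  qed simp
qed

definition simp_map :: "'a set set \<Rightarrow> 'b set set \<Rightarrow> ('a set \<Rightarrow> 'b set) \<Rightarrow> bool" where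
  "simp_map \<U> \<V> f \<longleftrightarrow> (\<forall>w. finite {U \<in> \<U>. f U = w}) \<and>
     (\<forall>\<sigma>\<subseteq>\<U>. finite \<sigma> \<longrightarrow> \<sigma> \<noteq> {} \<longrightarrow> \<Inter>\<sigma> \<noteq> {} \<longrightarrow> f ` \<sigma> \<subseteq> \<V> \<and> \<Inter>(f ` \<sigma>) \<noteq> {})"

lemma simp_map_fin: "simp_map \<U> \<V> f \<Longrightarrow> finite {U \<in> \<U>. f U = w}"
  by (simp add: simp_map_def)

lemma simp_map_simplex:
  assumes "simp_map \<U> \<V> f" "c \<in> chains p \<U> q" "c vs \<noteq> 0"
  shows "set (map f vs) \<subseteq> \<V> \<and> \<Inter>(set (map f vs)) \<noteq> {}"
proof -
  have vs: "length vs = Suc q" "set vs \<subseteq> \<U>" "\<Inter>(set vs) \<noteq> {}" using chains_supp[OF assms(2,3)] by auto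
  then have "set vs \<noteq> {}" by auto
  with assms(1) vs show ?thesis unfolding simp_map_def by simp
qed

lemma push_chains:
  assumes f: "simp_map \<U> \<V> f" and c: "c \<in> chains p \<U> q"
  shows "push \<U> f c \<in> chains p \<V> q"
proof -
  have "length ws = Suc q \<and> set ws \<subseteq> \<V> \<and> \<Inter>(set ws) \<noteq> {}" if ne: "push \<U> f c ws \<noteq> 0" for ws
  proof -
    obtain vs where vs: "c vs \<noteq> 0" "map f vs = ws" using push_supp[OF ne] by blast
    show ?thesis using chains_supp[OF c vs(1)] simp_map_simplex[OF f c vs(1)] vs(2) by auto
  qed
  moreover have "nmult p (push \<U> f d ws) = 0" if "\<forall>vs. nmult p (d vs) = 0" for d :: "'a set list \<Rightarrow> 'c" and ws
    using that by (induction ws arbitrary: d) (simp_all add: additive.sum[OF additive_nmult])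
  ultimately show ?thesis
    using push_alternating[OF chains_alternating[OF c], of \<U> f] simp_map_fin[OF f] chains_tors[OF c]
    by (simp add: chains_def)
qed

lemma boundary_push:
  assumes f: "simp_map \<U> \<V> f" and c: "c \<in> chains p \<U> q" and lf: "locfin \<U>" "locfin \<V>"
  shows "boundary (nbr \<V>) (push \<U> f c) = push \<U> f (boundary (nbr \<U>) c)"
proof
  fix ws show "boundary (nbr \<V>) (push \<U> f c) ws = push \<U> f (boundary (nbr \<U>) c) ws"
  proof (cases ws)
    case (Cons w ys)
    let ?S = "{v \<in> \<U>. f v = w}"
    define N where "N = (\<Union>v\<in>?S. f ` nbr \<U> v)"
    have "finite (nbr \<U> v)" if "v \<in> \<U>" for v using lf that by (simp add: locfin_def)
    then have N: "finite N" unfolding N_def using simp_map_fin[OF f] by auto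
    have "boundary (nbr \<V>) (push \<U> f c) (w # ys) = (\<Sum>u\<in>N. push \<U> f c (u # w # ys))"
    proof (rule boundary_eq[OF push_chains[OF f c] lf(2) N])
      fix u assume "push \<U> f c (u # w # ys) \<noteq> 0"
      from push_supp[OF this] obtain vs where vs: "c vs \<noteq> 0" "map f vs = u # w # ys"
        by (elim exE conjE)
      then obtain a b zs where "vs = a # b # zs" by (cases vs; cases "tl vs") auto
      then show "u \<in> N" using vs chains_nbr[OF c, of a b zs] by (auto simp: N_def)
    qed
    also have "\<dots> = (\<Sum>v\<in>?S. \<Sum>u\<in>N. \<Sum>x\<in>{x \<in> \<U>. f x = u}. push \<U> f (\<lambda>vs. c (x # v # vs)) ys)"
      by (simp only: push.simps) (subst sum.swap, subst (2) sum.swap, rule refl)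
    also have "\<dots> = (\<Sum>v\<in>?S. \<Sum>x\<in>nbr \<U> v. push \<U> f (\<lambda>vs. c (x # v # vs)) ys)"
    proof (rule sum.cong[OF refl])
      fix v assume v: "v \<in> ?S"
      define T where "T = {x \<in> \<U>. f x \<in> N}"
      have T: "finite T"
        by (rule finite_subset[of _ "\<Union>u\<in>N. {x \<in> \<U>. f x = u}"]) (use N simp_map_fin[OF f] in \<open>auto simp: T_def\<close>)
      have "(\<Sum>u\<in>N. \<Sum>x\<in>{x \<in> \<U>. f x = u}. push \<U> f (\<lambda>vs. c (x # v # vs)) ys)
          = (\<Sum>u\<in>N. \<Sum>x\<in>{x \<in> T. f x = u}. push \<U> f (\<lambda>vs. c (x # v # vs)) ys)"
        by (intro sum.cong) (auto simp: T_def)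
      also have "\<dots> = (\<Sum>x\<in>T. push \<U> f (\<lambda>vs. c (x # v # vs)) ys)"
        by (rule sum.group[OF T N]) (auto simp: T_def)
      also have "\<dots> = (\<Sum>x\<in>nbr \<U> v. push \<U> f (\<lambda>vs. c (x # v # vs)) ys)"
      proof (rule sum.mono_neutral_right[OF T])
        show "nbr \<U> v \<subseteq> T" using v by (auto simp: T_def N_def nbr_def)
        show "\<forall>x\<in>T - nbr \<U> v. push \<U> f (\<lambda>vs. c (x # v # vs)) ys = 0"
        proof
          fix x assume "x \<in> T - nbr \<U> v"
          then have "c (x # v # vs) = 0" for vs using chains_nbr[OF c] by blast
          then show "push \<U> f (\<lambda>vs. c (x # v # vs)) ys = 0" by simp
        qed
      qed
      finally show "(\<Sum>u\<in>N. \<Sum>x\<in>{x \<in> \<U>. f x = u}. push \<U> f (\<lambda>vs. c (x # v # vs)) ys)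
        = (\<Sum>x\<in>nbr \<U> v. push \<U> f (\<lambda>vs. c (x # v # vs)) ys)" .
    qed
    also have "\<dots> = push \<U> f (boundary (nbr \<U>) c) (w # ys)" by (simp add: push_sum)
    finally show ?thesis using Cons by simp
  qed simp
qed

section \<open>Contiguous simplicial maps agree on homology\<close>

lemma push_tors: "\<forall>vs. nmult p (d vs) = 0 \<Longrightarrow> nmult p (push V f d ws) = 0"
  by (induction ws arbitrary: d) (simp_all add: additive.sum[OF additive_nmult])

lemma cone_tors: "\<forall>vs. nmult p (d vs) = 0 \<Longrightarrow> nmult p (cone v d ws) = 0"
  by (induction ws arbitrary: d)
    (simp_all add: additive.diff[OF additive_nmult] additive.zero[OF additive_nmult])

lemma push_cong_on:
  assumes "\<And>v x. v \<in> V \<Longrightarrow> x \<in> set ws \<Longrightarrow> f v = x \<longleftrightarrow> g v = x"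
  shows "push V f c ws = push V g c ws"
  using assms
proof (induction ws arbitrary: c)
  case (Cons w ws)
  have "{v \<in> V. f v = w} = {v \<in> V. g v = w}" using Cons.prems by auto
  then show ?case using Cons by simp
qed simp

lemma push_sum_first:
  assumes fin: "\<And>w. finite {v \<in> V. f v = w}" and T: "finite T" "T \<subseteq> V" "f ` T \<subseteq> N" and N: "finite N"
    and c: "\<And>x vs. c (x # vs) \<noteq> 0 \<Longrightarrow> x \<in> T"
  shows "(\<Sum>u\<in>N. push V f c (u # ys)) = (\<Sum>x\<in>T. push V f (\<lambda>vs. c (x # vs)) ys)"
proof -
  have "push V f c (u # ys) = (\<Sum>x\<in>{x \<in> T. f x = u}. push V f (\<lambda>vs. c (x # vs)) ys)" for u
    unfolding push.simps
  proof (rule sum.mono_neutral_right)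
    show "\<forall>x\<in>{v \<in> V. f v = u} - {x \<in> T. f x = u}. push V f (\<lambda>vs. c (x # vs)) ys = 0"
    proof
      fix x assume "x \<in> {v \<in> V. f v = u} - {x \<in> T. f x = u}"
      then have "c (x # vs) = 0" for vs using c by blast
      then show "push V f (\<lambda>vs. c (x # vs)) ys = 0" by simp
    qed
  qed (use fin T in auto)
  then show ?thesis using sum.group[OF T(1) N T(3)] by simp
qed

theorem contiguous_homologous:
  fixes c :: "'a set list \<Rightarrow> 'k::ab_group_add"
  assumes lf: "locfin \<U>" "locfin \<V>" and cU: "countable \<U>"
    and f: "simp_map \<U> \<V> f" and g: "simp_map \<U> \<V> g"
    and contig: "\<And>\<sigma>. \<sigma> \<subseteq> \<U> \<Longrightarrow> finite \<sigma> \<Longrightarrow> \<sigma> \<noteq> {} \<Longrightarrow> \<Inter>\<sigma> \<noteq> {} \<Longrightarrow> \<Inter>(f ` \<sigma> \<union> g ` \<sigma>) \<noteq> {}"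
    and c: "c \<in> chains p \<U> q" and bc: "boundary (nbr \<U>) c = 0"
  shows "\<exists>h\<in>chains p \<V> (Suc q). boundary (nbr \<V>) h = push \<U> g c - push \<U> f c"
proof -
  \<comment> \<open>The vertices are moved from their \<open>f\<close>-image to their \<open>g\<close>-image one at a time, in the order of an
    enumeration \<open>\<nu>\<close>; moving \<open>v\<close> changes the pushed chain by the boundary of \<open>hv v\<close>. Local
    finiteness makes the infinite sum of the \<open>hv v\<close> meaningful.\<close>
  define \<nu> where "\<nu> = to_nat_on \<U>"
  have inj: "inj_on \<nu> \<U>" unfolding \<nu>_def by (rule inj_on_to_nat_on[OF cU])
  define F where "F = (\<lambda>n U. if \<nu> U < n then g U else f U)"
  have finF: "finite {U \<in> \<U>. F n U = w}" for n w
    by (rule finite_subset[of _ "{U \<in> \<U>. f U = w} \<union> {U \<in> \<U>. g U = w}"])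
       (use simp_map_fin[OF f] simp_map_fin[OF g] in \<open>auto simp: F_def\<close>)
  define e where "e = (\<lambda>v. push \<U> (F (\<nu> v)) (\<lambda>vs. c (v # vs)))"
  \<comment> \<open>The prism over \<open>v\<close>: the edge from \<open>f v\<close> to
    \<open>g v\<close> joined to the pushed link. By the cone formula its boundary is
    \<open>g v * e v\<close> minus \<open>f v * e v\<close>, provided the link is a cycle.\<close>
  define hv where "hv = (\<lambda>v. cone (f v) (cone (g v) (e v)))"
  \<comment> \<open>A nonzero value \<open>hv v ws\<close> forces \<open>g v\<close> to occur in
    \<open>ws\<close>, so this index set contains every contribution; it is finite because
    \<open>g\<close> has finite fibres.\<close>
  define h where "h = (\<lambda>ws. \<Sum>v\<in>{v \<in> \<U>. g v \<in> set ws}. hv v ws)"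
  have alt: "alternating c" by (rule chains_alternating[OF c])
  have supp: "\<exists>vs. c (v # vs) \<noteq> 0 \<and> length ws = Suc (length (v # vs)) \<and> g v \<in> set ws
      \<and> set ws \<subseteq> f ` set (v # vs) \<union> g ` set (v # vs)" if ne: "hv v ws \<noteq> 0" for v ws
  proof -
    from cone_supp[OF ne[unfolded hv_def]] obtain xs ys
      where 1: "ws = xs @ f v # ys" "cone (g v) (e v) (xs @ ys) \<noteq> 0" by blast
    from cone_supp[OF 1(2)] obtain as bs
      where 2: "xs @ ys = as @ g v # bs" "e v (as @ bs) \<noteq> 0" by blast
    from push_supp[OF 2(2)[unfolded e_def]] obtain vs
      where 3: "c (v # vs) \<noteq> 0" "map (F (\<nu> v)) vs = as @ bs" by blast
    have s: "set as \<union> set bs = F (\<nu> v) ` set vs" using arg_cong[OF 3(2), of set] by auto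
    have "set xs \<union> set ys = insert (g v) (set as \<union> set bs)" using arg_cong[OF 2(1), of set] by auto
    then have "set ws = insert (f v) (insert (g v) (F (\<nu> v) ` set vs))" using 1(1) s by auto
    moreover have "F (\<nu> v) ` set vs \<subseteq> f ` set vs \<union> g ` set vs" by (auto simp: F_def)
    moreover have "length ws = Suc (length (v # vs))"
      using arg_cong[OF 3(2), of length] arg_cong[OF 2(1), of length] 1(1) by simp
    ultimately show ?thesis using 3(1) by (intro exI[of _ vs]) auto
  qed
  have hv_chain: "hv v \<in> chains p \<V> (Suc q)" for v
  proof -
    have "length ws = Suc (Suc q) \<and> set ws \<subseteq> \<V> \<and> \<Inter>(set ws) \<noteq> {}" if "hv v ws \<noteq> 0" for ws
    proof -
      obtain vs where vs: "c (v # vs) \<noteq> 0" "length ws = Suc (length (v # vs))"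
        "set ws \<subseteq> f ` set (v # vs) \<union> g ` set (v # vs)" using supp[OF \<open>hv v ws \<noteq> 0\<close>] by blast
      note s = chains_supp[OF c vs(1)]
      have "\<Inter>(f ` set (v # vs) \<union> g ` set (v # vs)) \<noteq> {}" using s by (intro contig) auto
      then have ne: "\<Inter>(set ws) \<noteq> {}" using Inter_anti_mono[OF vs(3)] by (metis subset_empty)
      have "f ` set (v # vs) \<union> g ` set (v # vs) \<subseteq> \<V>"
        using simp_map_simplex[OF f c vs(1)] simp_map_simplex[OF g c vs(1)] by auto
      then have "set ws \<subseteq> \<V>" using vs(3) by (rule subset_trans[rotated])
      then show ?thesis using vs(2) s ne by simp
    qed
    moreover have "alternating (hv v)" unfolding hv_def e_def
      by (intro cone_alternating push_alternating alternating_slice alt finF)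
    moreover have "nmult p (hv v ws) = 0" for ws unfolding hv_def e_def
      using chains_tors[OF c] by (intro cone_tors push_tors allI) auto
    ultimately show ?thesis by (simp add: chains_def)
  qed
  have h_chain: "h \<in> chains p \<V> (Suc q)"
  proof -
    have "alternating h" unfolding alternating_def
    proof (intro conjI allI)
      fix xs u v ys
      have "{x \<in> \<U>. g x \<in> set (xs @ u # v # ys)} = {x \<in> \<U>. g x \<in> set (xs @ v # u # ys)}" by auto
      then show "h (xs @ u # v # ys) = - h (xs @ v # u # ys)" unfolding h_def
        by (simp only: sum_negf[symmetric]) (rule sum.cong[OF refl alternating_swap[OF chains_alternating[OF hv_chain]]])
      show "h (xs @ u # u # ys) = 0" unfolding h_def
        by (rule sum.neutral) (use alternating_repeat[OF chains_alternating[OF hv_chain]] in blast)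
    qed
    moreover have "length ws = Suc (Suc q) \<and> set ws \<subseteq> \<V> \<and> \<Inter>(set ws) \<noteq> {}" if "h ws \<noteq> 0" for ws
    proof -
      from sum.not_neutral_contains_not_neutral[OF that[unfolded h_def]] obtain v where "hv v ws \<noteq> 0" by blast
      then show ?thesis by (rule chains_supp[OF hv_chain])
    qed
    moreover have "nmult p (h ws) = 0" for ws
      unfolding h_def by (simp add: additive.sum[OF additive_nmult] chains_tors[OF hv_chain])
    ultimately show ?thesis by (simp add: chains_def)
  qed
  have step: "boundary (nbr \<V>) (hv v) (w # ws) =
      push \<U> (F (Suc (\<nu> v))) c (w # ws) - push \<U> (F (\<nu> v)) c (w # ws)" if v: "v \<in> \<U>" for v w ws
  proof -
    let ?n = "\<nu> v"
    define l where "l = (\<lambda>vs. c (v # vs))"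
    define c0 where "c0 = (\<lambda>vs. if v \<in> set vs then 0 else c vs)"
    have Fv: "F (Suc ?n) v = g v" "F ?n v = f v" by (auto simp: F_def)
    have Fo: "F (Suc ?n) U = F ?n U" if "U \<in> \<U> - {v}" for U
    proof -
      have "\<nu> U \<noteq> \<nu> v" using that v inj by (auto simp: inj_on_def)
      then show ?thesis by (auto simp: F_def)
    qed
    have same: "push \<U> (F (Suc ?n)) d = push \<U> (F ?n) d"
      if "\<And>vs. d vs \<noteq> 0 \<Longrightarrow> set vs \<subseteq> \<U> - {v}" for d :: "'a set list \<Rightarrow> 'k"
    proof
      fix zs
      have "push \<U> (F (Suc ?n)) d zs = push (\<U> - {v}) (F (Suc ?n)) d zs"
        by (rule push_restrict[OF _ finF that]) auto
      also have "\<dots> = push (\<U> - {v}) (F ?n) d zs" by (rule push_cong) (rule Fo)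
      also have "\<dots> = push \<U> (F ?n) d zs" by (rule push_restrict[OF _ finF that, symmetric]) auto
      finally show "push \<U> (F (Suc ?n)) d zs = push \<U> (F ?n) d zs" .
    qed
    have same_l: "push \<U> (F (Suc ?n)) l = push \<U> (F ?n) l"
    proof (rule same)
      fix vs assume "l vs \<noteq> 0"
      then have ne: "c (v # vs) \<noteq> 0" by (simp add: l_def)
      then have "distinct (v # vs)" using alternating_not_distinct[OF alt] by blast
      with chains_supp[OF c ne] show "set vs \<subseteq> \<U> - {v}" by auto
    qed
    have same_c0: "push \<U> (F (Suc ?n)) c0 = push \<U> (F ?n) c0"
      by (rule same) (use chains_supp[OF c] in \<open>auto simp: c0_def split: if_splits\<close>)
    \<comment> \<open>Splitting into simplices avoiding \<open>v\<close> and the star of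
      \<open>v\<close>. The stages before and after moving \<open>v\<close> agree on
      \<open>c0\<close> and on the link, so only the cone point changes.\<close>
    have "c = (\<lambda>vs. c0 vs + cone v l vs)"
      unfolding l_def c0_def by (auto simp: cone_link[OF alt])
    then have split: "push \<U> G c zs = push \<U> G c0 zs + cone (G v) (push \<U> G l) zs"
      if "\<And>w. finite {U \<in> \<U>. G U = w}" for G :: "'a set \<Rightarrow> 'b set" and zs
      using push_add[of \<U> G c0 "cone v l" zs] push_cone[OF v that, of l zs] by simp
    have diff: "push \<U> (F (Suc ?n)) c (w # ws) - push \<U> (F ?n) c (w # ws) =
        cone (g v) (e v) (w # ws) - cone (f v) (e v) (w # ws)"
      using split[OF finF, of "Suc ?n"] split[OF finF, of ?n] same_l same_c0 Fv
      by (simp add: e_def l_def del: cone.simps push.simps)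
    define N where "N = {f v, g v} \<union> F ?n ` nbr \<U> v"
    have fin: "finite (nbr \<U> v)" using v lf by (simp add: locfin_def)
    then have N: "finite N" by (simp add: N_def)
    \<comment> \<open>The link of a vertex in a cycle is a cycle: moving \<open>v\<close> to the
      second position turns this sum into a negated boundary coefficient of
      \<open>c\<close>.\<close>
    have e0: "(\<Sum>u\<in>N. e v (u # ys)) = 0" for ys
    proof -
      have "(\<Sum>u\<in>N. e v (u # ys)) = (\<Sum>x\<in>nbr \<U> v. push \<U> (F ?n) (\<lambda>vs. c (v # x # vs)) ys)"
        unfolding e_def
      proof (rule push_sum_first[OF finF fin _ _ N])
        fix x vs assume "c (v # x # vs) \<noteq> 0"
        from chains_supp[OF c this] show "x \<in> nbr \<U> v" by (auto simp: nbr_def)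
      qed (auto simp: N_def nbr_def)
      also have "\<dots> = push \<U> (F ?n) (\<lambda>vs. \<Sum>x\<in>nbr \<U> v. c (v # x # vs)) ys" by (simp add: push_sum)
      also have "(\<lambda>vs. \<Sum>x\<in>nbr \<U> v. c (v # x # vs)) = (\<lambda>vs. - boundary (nbr \<U>) c (v # vs))"
        unfolding boundary.simps sum_negf[symmetric]
        by (rule ext, rule sum.cong[OF refl], rule alternatingD(1)[OF alt])
      finally show ?thesis using bc by simp
    qed
    have inner: "(\<Sum>u\<in>N. cone (g v) (e v) (u # ys)) = e v ys" for ys
      using N unfolding sum_cone[OF N] e0 by (simp add: N_def)
    have "boundary (nbr \<V>) (hv v) (w # ws) = (\<Sum>u\<in>N. hv v (u # w # ws))"
    proof (rule boundary_eq[OF hv_chain lf(2) N])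
      fix u assume ne: "hv v (u # w # ws) \<noteq> 0"
      from cone_supp[OF ne[unfolded hv_def]] obtain xs ys
        where 1: "u # w # ws = xs @ f v # ys" "cone (g v) (e v) (xs @ ys) \<noteq> 0" by blast
      show "u \<in> N"
      proof (cases xs)
        case Nil then show ?thesis using 1 by (simp add: N_def)
      next
        case (Cons x xs')
        then have u: "x = u" using 1 by simp
        from cone_supp[OF 1(2)] obtain as bs
          where 2: "xs @ ys = as @ g v # bs" "e v (as @ bs) \<noteq> 0" by blast
        show ?thesis
        proof (cases as)
          case Nil then show ?thesis using 2 Cons u by (simp add: N_def)
        next
          case (Cons a as')
          then have a: "a = u" using 2 \<open>xs = x # xs'\<close> u by simp
          from push_supp[OF 2(2)[unfolded e_def]] obtain vs
            where 3: "c (v # vs) \<noteq> 0" "map (F ?n) vs = as @ bs" by blast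
          then obtain y ys' where y: "vs = y # ys'" "F ?n y = u" using Cons a by (cases vs) auto
          have "y \<in> nbr \<U> v" using chains_supp[OF c 3(1)] y by (auto simp: nbr_def)
          then show ?thesis using y by (auto simp: N_def)
        qed
      qed
    qed
    also have "\<dots> = (if f v \<in> N then cone (g v) (e v) (w # ws) else 0)
        - cone (f v) (\<lambda>ys. \<Sum>u\<in>N. cone (g v) (e v) (u # ys)) (w # ws)"
      unfolding hv_def by (rule sum_cone[OF N])
    also have "(\<lambda>ys. \<Sum>u\<in>N. cone (g v) (e v) (u # ys)) = e v" by (rule ext) (rule inner)
    also have "(if f v \<in> N then cone (g v) (e v) (w # ws) else 0) = cone (g v) (e v) (w # ws)"
      unfolding N_def by (rule if_P) blast
    finally show ?thesis unfolding diff .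
  qed
  have "boundary (nbr \<V>) h ws = push \<U> g c ws - push \<U> f c ws" for ws
  proof (cases ws)
    case Nil
    have "push \<U> f c [] = 0" "push \<U> g c [] = 0" using chains_supp[OF c, of "[]"] by auto
    then show ?thesis using Nil by simp
  next
    case (Cons w ys)
    show ?thesis
    proof (cases "w \<in> \<V>")
      case False
      have "push \<U> f c ws = 0" "push \<U> g c ws = 0" "h (u # ws) = 0" for u
        using chains_supp[OF push_chains[OF f c], of ws] chains_supp[OF push_chains[OF g c], of ws]
          chains_supp[OF h_chain, of "u # ws"] False Cons by auto
      then show ?thesis using Cons by simp
    next
      case True
      have fw: "finite (nbr \<V> w)" using True lf by (simp add: locfin_def)
      have finS: "finite {v \<in> \<U>. G v \<in> A}" if "finite A" "simp_map \<U> \<V> G" for G A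
        by (rule finite_subset[of _ "\<Union>a\<in>A. {v \<in> \<U>. G v = a}"]) (use that simp_map_fin[OF that(2)] in auto)
      define S where "S = {v \<in> \<U>. g v \<in> set ws \<union> nbr \<V> w}"
      define S' where "S' = S \<union> {v \<in> \<U>. f v \<in> set ws}"
      have S: "finite S" "finite S'" unfolding S'_def S_def by (auto intro!: finS fw f g simp del: Un_iff)
      have hS: "h (u # ws) = (\<Sum>v\<in>S. hv v (u # ws))" if "u \<in> nbr \<V> w" for u
        unfolding h_def
      proof (rule sum.mono_neutral_left[OF S(1)])
        show "\<forall>v\<in>S - {v \<in> \<U>. g v \<in> set (u # ws)}. hv v (u # ws) = 0"
          using supp by (fastforce simp: S_def)
      qed (use that in \<open>auto simp: S_def\<close>)
      \<comment> \<open>From stage \<open>M\<close> on, every vertex whose \<open>f\<close>-image or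
        \<open>g\<close>-image occurs in \<open>ws\<close> has been moved or has never mattered.
        Evaluated at \<open>ws\<close>, the intermediate map \<open>F M\<close> is therefore as good
        as \<open>g\<close>, although other vertices may still be waiting.\<close>
      obtain M where M: "\<And>v. v \<in> S' \<Longrightarrow> \<nu> v < M"
        using finite_nat_set_iff_bounded[of "\<nu> ` S'"] S by auto
      have z: "push \<U> (F (Suc n)) c ws - push \<U> (F n) c ws = 0" if n: "n \<notin> \<nu> ` S" for n
      proof (cases "n \<in> \<nu> ` \<U>")
        case True
        then obtain v where v: "v \<in> \<U>" "n = \<nu> v" "v \<notin> S" using n by auto
        have "hv v (u # ws) = 0" if "u \<in> nbr \<V> w" for u
          using supp[of v "u # ws"] v that by (auto simp: S_def)
        then show ?thesis using step[OF v(1), of w ys] v(2) Cons by simp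
      next
        case False
        then have "F (Suc n) U = F n U" if "U \<in> \<U>" for U
          using that by (auto simp: F_def less_Suc_eq)
        then show ?thesis using push_cong[of \<U> "F (Suc n)" "F n" c ws] by simp
      qed
      have "boundary (nbr \<V>) h ws = (\<Sum>u\<in>nbr \<V> w. h (u # ws))" using Cons by simp
      also have "\<dots> = (\<Sum>u\<in>nbr \<V> w. \<Sum>v\<in>S. hv v (u # ws))" by (rule sum.cong[OF refl hS])
      also have "\<dots> = (\<Sum>v\<in>S. \<Sum>u\<in>nbr \<V> w. hv v (u # ws))" by (rule sum.swap)
      also have "\<dots> = (\<Sum>v\<in>S. boundary (nbr \<V>) (hv v) ws)" using Cons by simp
      also have "\<dots> = (\<Sum>v\<in>S. push \<U> (F (Suc (\<nu> v))) c ws - push \<U> (F (\<nu> v)) c ws)"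
        using Cons step by (intro sum.cong[OF refl]) (simp add: S_def)
      also have "\<dots> = (\<Sum>n\<in>\<nu> ` S. push \<U> (F (Suc n)) c ws - push \<U> (F n) c ws)"
        using inj by (subst sum.reindex) (auto simp: S_def inj_on_def)
      also have "\<dots> = (\<Sum>n<M. push \<U> (F (Suc n)) c ws - push \<U> (F n) c ws)"
        by (rule sum.mono_neutral_left) (use M z in \<open>auto simp: S'_def\<close>)
      also have "\<dots> = push \<U> (F M) c ws - push \<U> (F 0) c ws" by (rule sum_lessThan_telescope)
      also have "push \<U> (F 0) c ws = push \<U> f c ws" by (rule push_cong) (simp add: F_def)
      also have "push \<U> (F M) c ws = push \<U> g c ws"
      proof (rule push_cong_on)
        fix v x assume v: "v \<in> \<U>" "x \<in> set ws"
        show "F M v = x \<longleftrightarrow> g v = x"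
        proof (cases "\<nu> v < M")
          case False
          then have "v \<notin> S'" using M by auto
          then show ?thesis using v False by (auto simp: S'_def S_def F_def)
        qed (simp add: F_def)
      qed
      finally show ?thesis .
    qed
  qed
  then show ?thesis using h_chain by (auto simp: fun_eq_iff)
qed

section \<open>Refining systems of families of sets\<close>

definition lf_family :: "'a::metric_space set set \<Rightarrow> bool" where
  "lf_family \<U> \<longleftrightarrow> (\<forall>U\<in>\<U>. U \<noteq> {} \<and> bounded U) \<and> (\<forall>B. bounded B \<longrightarrow> finite {U \<in> \<U>. U \<inter> B \<noteq> {}})"

lemma lf_family_subset: "lf_family \<U> \<Longrightarrow> \<V> \<subseteq> \<U> \<Longrightarrow> lf_family \<V>"
  unfolding lf_family_def by (auto intro: finite_subset[rotated])

lemma lf_family_finite: "lf_family \<U> \<Longrightarrow> bounded B \<Longrightarrow> finite {U \<in> \<U>. U \<inter> B \<noteq> {}}"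
  and lf_family_bounded: "lf_family \<U> \<Longrightarrow> U \<in> \<U> \<Longrightarrow> bounded U"
  and lf_family_ne: "lf_family \<U> \<Longrightarrow> U \<in> \<U> \<Longrightarrow> U \<noteq> {}"
  by (auto simp: lf_family_def)

lemma lf_family_locfin: assumes "lf_family \<U>" shows "locfin \<U>"
  unfolding locfin_def nbr_def
proof
  fix U assume "U \<in> \<U>"
  from lf_family_finite[OF assms lf_family_bounded[OF assms this]]
  show "finite {V \<in> \<U>. U \<inter> V \<noteq> {}}" by (simp add: Int_commute)
qed

text \<open>Every member meets one of the balls of natural radius about a fixed point, and each such
  ball meets finitely many members. Countability supplies the enumeration along which
  \<open>contiguous_homologous\<close> moves the vertices.\<close>

lemma lf_family_countable:
  fixes \<U> :: "'a::metric_space set set"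
  assumes "lf_family \<U>" shows "countable \<U>"
proof -
  obtain a :: 'a where True by simp
  have "\<U> \<subseteq> (\<Union>n::nat. {U \<in> \<U>. U \<inter> cball a (real n) \<noteq> {}})"
  proof
    fix U assume U: "U \<in> \<U>"
    then obtain x where x: "x \<in> U" using lf_family_ne[OF assms] by blast
    obtain n :: nat where "dist a x \<le> real n" using real_arch_simple by blast
    with x have "U \<inter> cball a (real n) \<noteq> {}" by auto
    with U show "U \<in> (\<Union>n::nat. {U \<in> \<U>. U \<inter> cball a (real n) \<noteq> {}})" by blast
  qed
  moreover have "countable (\<Union>n::nat. {U \<in> \<U>. U \<inter> cball a (real n) \<noteq> {}})"
    using lf_family_finite[OF assms bounded_cball] by (intro countable_UN) (auto intro: countable_finite)
  ultimately show ?thesis by (rule countable_subset)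
qed

definition refinement :: "'a set set \<Rightarrow> 'a set set \<Rightarrow> ('a set \<Rightarrow> 'a set) \<Rightarrow> bool" where
  "refinement \<U> \<V> f \<longleftrightarrow> (\<forall>U\<in>\<U>. f U \<in> \<V> \<and> U \<subseteq> f U)"

lemma refinement_comp: "refinement \<U> \<V> f \<Longrightarrow> refinement \<V> \<W> g \<Longrightarrow> refinement \<U> \<W> (g \<circ> f)"
  unfolding refinement_def by (metis comp_apply subset_trans)

text \<open>Properness holds because the sets sent to \<open>w\<close> are nonempty subsets of the
  bounded set \<open>w\<close>; simplices go to simplices because a common point stays common after
  enlarging the sets.\<close>

lemma refinement_simp_map:
  assumes U: "lf_family \<U>" and V: "lf_family \<V>" and f: "refinement \<U> \<V> f"
  shows "simp_map \<U> \<V> f"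
  unfolding simp_map_def
proof (intro conjI allI impI)
  fix w
  show "finite {U \<in> \<U>. f U = w}"
  proof (cases "w \<in> \<V>")
    case True
    have "{U \<in> \<U>. f U = w} \<subseteq> {U \<in> \<U>. U \<inter> w \<noteq> {}}"
      using f lf_family_ne[OF U] by (fastforce simp: refinement_def)
    then show ?thesis
      using lf_family_finite[OF U lf_family_bounded[OF V True]] by (rule finite_subset)
  next
    case False
    then have e: "{U \<in> \<U>. f U = w} = {}" using f by (auto simp: refinement_def)
    show ?thesis unfolding e by simp
  qed
next
  fix \<sigma> assume s: "\<sigma> \<subseteq> \<U>" "\<Inter>\<sigma> \<noteq> {}"
  show "f ` \<sigma> \<subseteq> \<V>" using f s by (auto simp: refinement_def)
  have "\<Inter>\<sigma> \<subseteq> \<Inter>(f ` \<sigma>)" using f s by (fastforce simp: refinement_def)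
  then show "\<Inter>(f ` \<sigma>) \<noteq> {}" using s by auto
qed

definition cycles :: "nat \<Rightarrow> 'a set set \<Rightarrow> nat \<Rightarrow> ('a set list \<Rightarrow> 'k::ab_group_add) set" where
  "cycles p \<U> q = {c \<in> chains p \<U> q. boundary (nbr \<U>) c = 0}"

definition homologous :: "nat \<Rightarrow> 'a set set \<Rightarrow> nat \<Rightarrow> ('a set list \<Rightarrow> 'k::ab_group_add) \<Rightarrow> ('a set list \<Rightarrow> 'k) \<Rightarrow> bool" where
  "homologous p \<U> q x y \<longleftrightarrow> (\<exists>e\<in>chains p \<U> (Suc q). boundary (nbr \<U>) e = x - y)"

lemma homologous_sym: "homologous p \<U> q x y \<Longrightarrow> homologous p \<U> q y x"
  unfolding homologous_def
proof (elim bexE)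
  fix e assume e: "e \<in> chains p \<U> (Suc q)" "boundary (nbr \<U>) e = x - y"
  then show "\<exists>e\<in>chains p \<U> (Suc q). boundary (nbr \<U>) e = y - x"
    by (intro bexI[of _ "- e"]) (auto simp: additive.minus[OF additive_boundary] chains_uminus)
qed

lemma homologous_trans:
  assumes "homologous p \<U> q x y" "homologous p \<U> q y z" shows "homologous p \<U> q x z"
proof -
  obtain e f where "e \<in> chains p \<U> (Suc q)" "boundary (nbr \<U>) e = x - y"
    "f \<in> chains p \<U> (Suc q)" "boundary (nbr \<U>) f = y - z" using assms by (auto simp: homologous_def)
  then show ?thesis unfolding homologous_def
    by (intro bexI[of _ "e + f"]) (auto simp: additive.add[OF additive_boundary] chains_plus)
qed

lemma homologous_refl: "homologous p \<U> q x x"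
  unfolding homologous_def by (rule bexI[of _ 0]) (auto simp: additive.zero[OF additive_boundary] chains_zero)

lemma push_homologous:
  assumes "simp_map \<U> \<V> f" "locfin \<U>" "locfin \<V>" "homologous p \<U> q x y"
  shows "homologous p \<V> q (push \<U> f x) (push \<U> f y)"
proof -
  obtain e where e: "e \<in> chains p \<U> (Suc q)" "boundary (nbr \<U>) e = x - y"
    using assms by (auto simp: homologous_def)
  then show ?thesis unfolding homologous_def
    using boundary_push[OF assms(1) e(1) assms(2,3)] push_chains[OF assms(1) e(1)]
    by (intro bexI[of _ "push \<U> f e"]) (auto simp: additive.diff[OF additive_push])
qed

lemma push_cycles:
  assumes "simp_map \<U> \<V> f" "locfin \<U>" "locfin \<V>" "c \<in> cycles p \<U> q"
  shows "push \<U> f c \<in> cycles p \<V> q"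
  using assms boundary_push[OF assms(1) _ assms(2,3), of c p q] push_chains[OF assms(1), of c p q]
  by (simp add: cycles_def additive.zero[OF additive_push])

text \<open>A common point of a simplex lies in every set that either refinement assigns to its
  vertices, so any two refinements are contiguous.\<close>

lemma refinements_homologous:
  assumes U: "lf_family \<U>" and V: "lf_family \<V>" and f: "refinement \<U> \<V> f" and g: "refinement \<U> \<V> g"
    and c: "c \<in> cycles p \<U> q"
  shows "homologous p \<V> q (push \<U> g c) (push \<U> f c)"
  unfolding homologous_def
proof (rule contiguous_homologous)
  fix \<sigma> assume s: "\<sigma> \<subseteq> \<U>" "\<Inter>\<sigma> \<noteq> {}"
  have "\<Inter>\<sigma> \<subseteq> \<Inter>(f ` \<sigma> \<union> g ` \<sigma>)" using f g s by (fastforce simp: refinement_def)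
  then show "\<Inter>(f ` \<sigma> \<union> g ` \<sigma>) \<noteq> {}" using s by auto
qed (use c in \<open>auto simp: cycles_def lf_family_locfin[OF U] lf_family_locfin[OF V] lf_family_countable[OF U]
      refinement_simp_map[OF U V f] refinement_simp_map[OF U V g]\<close>)

section \<open>Direct systems of nerves\<close>

locale refining_system =
  fixes \<U> :: "nat \<Rightarrow> 'a::metric_space set set" and \<rho> :: "nat \<Rightarrow> 'a set \<Rightarrow> 'a set"
  assumes lf: "lf_family (\<U> n)" and ref: "refinement (\<U> n) (\<U> (Suc n)) (\<rho> n)"
begin

lemma lfin: "locfin (\<U> n)" by (rule lf_family_locfin[OF lf])

abbreviation tr where "tr n k \<equiv> fold \<rho> [n..<k]"

lemma tr_Suc: "n \<le> k \<Longrightarrow> tr n (Suc k) = \<rho> k \<circ> tr n k" by auto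

lemma tr_refinement: "n \<le> k \<Longrightarrow> refinement (\<U> n) (\<U> k) (tr n k)"
proof (induction k)
  case 0 then show ?case by (simp add: refinement_def)
next
  case (Suc k)
  show ?case
  proof (cases "n = Suc k")
    case True then show ?thesis by (simp add: refinement_def)
  next
    case False
    then have "n \<le> k" using Suc.prems by simp
    then show ?thesis using refinement_comp[OF Suc.IH ref] unfolding tr_Suc[OF \<open>n \<le> k\<close>] by blast
  qed
qed

lemma tr_simp_map: "n \<le> k \<Longrightarrow> simp_map (\<U> n) (\<U> k) (tr n k)"
  by (rule refinement_simp_map[OF lf lf tr_refinement])

lemma tr_tr: "n \<le> k \<Longrightarrow> k \<le> l \<Longrightarrow> tr k l \<circ> tr n k = tr n l"
proof (induction l)
  case 0 then show ?case by (simp add: fun_eq_iff)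
next
  case (Suc l)
  show ?case
  proof (cases "k = Suc l")
    case True then show ?thesis by (simp add: fun_eq_iff)
  next
    case False
    then have "k \<le> l" "n \<le> l" using Suc.prems by simp_all
    then show ?thesis using Suc by (simp add: tr_Suc fun_eq_iff del: upt_Suc)
  qed
qed

definition trp :: "nat \<Rightarrow> nat \<Rightarrow> ('a set list \<Rightarrow> 'k::ab_group_add) \<Rightarrow> 'a set list \<Rightarrow> 'k" where
  "trp n k c = push (\<U> n) (tr n k) c"

lemma trp_trp:
  assumes "n \<le> k" "k \<le> l" shows "trp k l (trp n k c) = trp n l c"
proof
  fix ws
  show "trp k l (trp n k c) ws = trp n l c ws" unfolding trp_def tr_tr[OF assms, symmetric]
    by (rule push_push) (use tr_refinement[OF assms(1)] simp_map_fin[OF tr_simp_map] assms in \<open>auto simp: refinement_def\<close>)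
qed

lemma trp_chains: "n \<le> k \<Longrightarrow> c \<in> chains p (\<U> n) q \<Longrightarrow> trp n k c \<in> chains p (\<U> k) q"
  unfolding trp_def by (rule push_chains[OF tr_simp_map])


lemma boundary_trp: "n \<le> k \<Longrightarrow> c \<in> chains p (\<U> n) q \<Longrightarrow>
    boundary (nbr (\<U> k)) (trp n k c) = trp n k (boundary (nbr (\<U> n)) c)"
  unfolding trp_def by (rule boundary_push[OF tr_simp_map _ lfin lfin])

lemma trp_homologous: "n \<le> k \<Longrightarrow> homologous p (\<U> n) q x y \<Longrightarrow> homologous p (\<U> k) q (trp n k x) (trp n k y)"
  unfolding trp_def by (rule push_homologous[OF tr_simp_map lfin lfin])

lemma additive_trp: "additive_map (trp n k)"
  unfolding trp_def by (rule additive_push)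

lemma push_id: "(\<And>vs. c vs \<noteq> 0 \<Longrightarrow> set vs \<subseteq> V) \<Longrightarrow> push V (\<lambda>x. x) c ws = c ws"
proof (induction ws arbitrary: c)
  case (Cons w ws)
  have "push V (\<lambda>x. x) c (w # ws) = (\<Sum>v\<in>{v \<in> V. v = w}. push V (\<lambda>x. x) (\<lambda>vs. c (v # vs)) ws)" by simp
  also have "\<dots> = c (w # ws)"
  proof (cases "w \<in> V")
    case True
    have "push V (\<lambda>x. x) (\<lambda>vs. c (w # vs)) ws = c (w # ws)"
    proof (rule Cons.IH)
      fix vs assume "c (w # vs) \<noteq> 0"
      from Cons.prems[OF this] show "set vs \<subseteq> V" by simp
    qed
    moreover have e: "{v \<in> V. v = w} = {w}" using True by auto
    ultimately show ?thesis unfolding e by simp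
  next
    case False
    then have e: "{v \<in> V. v = w} = {}" by auto
    show ?thesis unfolding e using Cons.prems[of "w # ws"] False by auto
  qed
  finally show ?case .
qed simp

lemma trp_self: "c \<in> chains p (\<U> n) q \<Longrightarrow> trp n n c = c"
  unfolding trp_def using push_id[of c "\<U> n"] chains_supp[of c p "\<U> n" q] by (auto simp: id_def)

text \<open>
  Classes in the direct limit of the homology groups are distinguished by at most \<open>M\<close> labels.
\<close>

definition class_bound :: "'k::ab_group_add itself \<Rightarrow> nat \<Rightarrow> nat \<Rightarrow> nat \<Rightarrow> bool" where
  "class_bound T p q M \<longleftrightarrow> (\<exists>cl :: nat \<Rightarrow> ('a set list \<Rightarrow> 'k) \<Rightarrow> nat.
     \<forall>n n'. \<forall>c\<in>cycles p (\<U> n) q. \<forall>c'\<in>cycles p (\<U> n') q. cl n c < M \<and>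
       (cl n c = cl n' c' \<longrightarrow> (\<exists>k\<ge>max n n'. homologous p (\<U> k) q (trp n k c) (trp n' k c'))))"

end

text \<open>Cycles of the second system inherit the label of their image in the first. Equal labels
  make the images homologous at some stage of the first system; mapping back, each round trip is
  itself a refinement and hence homologous to the transition map of the second system.\<close>

lemma class_bound_transfer:
  assumes U: "refining_system \<U> \<rho>" and V: "refining_system \<V> \<sigma>"
    and UV: "\<And>n. \<exists>k f. refinement (\<U> n) (\<V> k) f" and VU: "\<And>n. \<exists>k f. refinement (\<V> n) (\<U> k) f"
    and cb: "refining_system.class_bound \<U> \<rho> TYPE('k::ab_group_add) p q M"
  shows "refining_system.class_bound \<V> \<sigma> TYPE('k) p q M"
proof -
  interpret U: refining_system \<U> \<rho> by (rule U)
  interpret V: refining_system \<V> \<sigma> by (rule V)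
  obtain cl :: "nat \<Rightarrow> ('a set list \<Rightarrow> 'k) \<Rightarrow> nat" where
    cl0: "\<forall>n n'. \<forall>c\<in>cycles p (\<U> n) q. \<forall>c'\<in>cycles p (\<U> n') q. cl n c < M \<and>
       (cl n c = cl n' c' \<longrightarrow> (\<exists>k\<ge>max n n'. homologous p (\<U> k) q (U.trp n k c) (U.trp n' k c')))"
    using cb unfolding U.class_bound_def by (elim exE)
  have cl: "\<And>n n' c c'. c \<in> cycles p (\<U> n) q \<Longrightarrow> c' \<in> cycles p (\<U> n') q \<Longrightarrow> cl n c < M \<and>
       (cl n c = cl n' c' \<longrightarrow> (\<exists>k\<ge>max n n'. homologous p (\<U> k) q (U.trp n k c) (U.trp n' k c')))"
    using cl0 by blast
  obtain b g where g: "\<And>n. refinement (\<V> n) (\<U> (b n)) (g n)" using VU by metis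
  have gs: "simp_map (\<V> n) (\<U> (b n)) (g n)" for n by (rule refinement_simp_map[OF V.lf U.lf g])
  define cl' where "cl' = (\<lambda>n c. cl (b n) (push (\<V> n) (g n) c))"
  show ?thesis unfolding V.class_bound_def
  proof (intro exI[of _ cl'] allI ballI conjI impI)
    fix n n' and c c' :: "'a set list \<Rightarrow> 'k"
    assume c: "c \<in> cycles p (\<V> n) q" and c': "c' \<in> cycles p (\<V> n') q"
    define d where "d = push (\<V> n) (g n) c"
    define d' where "d' = push (\<V> n') (g n') c'"
    have d: "d \<in> cycles p (\<U> (b n)) q" "d' \<in> cycles p (\<U> (b n')) q"
      unfolding d_def d'_def by (rule push_cycles[OF gs V.lfin U.lfin]; fact)+
    show "cl' n c < M" using cl[OF d] by (simp add: cl'_def d_def)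
    assume "cl' n c = cl' n' c'"
    then obtain k where k: "k \<ge> b n" "k \<ge> b n'"
      and hk: "homologous p (\<U> k) q (U.trp (b n) k d) (U.trp (b n') k d')"
      using cl[OF d] by (auto simp: cl'_def d_def d'_def)
    obtain l0 f0 where f0: "refinement (\<U> k) (\<V> l0) f0" using UV by blast
    define l where "l = max l0 (max n n')"
    define f where "f = V.tr l0 l \<circ> f0"
    have f: "refinement (\<U> k) (\<V> l) f" unfolding f_def
      by (rule refinement_comp[OF f0 V.tr_refinement]) (simp add: l_def)
    have fs: "simp_map (\<U> k) (\<V> l) f" by (rule refinement_simp_map[OF U.lf V.lf f])
    have 1: "homologous p (\<V> l) q (push (\<U> k) f (U.trp (b a) k (push (\<V> a) (g a) x))) (V.trp a l x)"
      if a: "b a \<le> k" "a \<le> l" and x: "x \<in> cycles p (\<V> a) q" for a and x :: "'a set list \<Rightarrow> 'k"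
    proof -
      have r: "refinement (\<V> a) (\<U> k) (U.tr (b a) k \<circ> g a)"
        by (rule refinement_comp[OF g U.tr_refinement[OF a(1)]])
      have e1: "U.trp (b a) k (push (\<V> a) (g a) x) = push (\<V> a) (U.tr (b a) k \<circ> g a) x"
        unfolding U.trp_def
      proof (rule ext, rule push_push)
        show "g a v \<in> \<U> (b a)" if "v \<in> \<V> a" for v using g that by (auto simp: refinement_def)
      qed (use simp_map_fin[OF gs] simp_map_fin[OF U.tr_simp_map] a in auto)
      have e2: "push (\<U> k) f (push (\<V> a) (U.tr (b a) k \<circ> g a) x) = push (\<V> a) (f \<circ> (U.tr (b a) k \<circ> g a)) x"
      proof (rule ext, rule push_push)
        show "(U.tr (b a) k \<circ> g a) v \<in> \<U> k" if "v \<in> \<V> a" for v using r that by (auto simp: refinement_def)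
      qed (rule simp_map_fin[OF refinement_simp_map[OF V.lf U.lf r]], rule simp_map_fin[OF fs])
      show ?thesis unfolding e1 e2 V.trp_def
        by (rule refinements_homologous[OF V.lf V.lf V.tr_refinement[OF a(2)] refinement_comp[OF r f] x])
    qed
    have "homologous p (\<V> l) q (push (\<U> k) f (U.trp (b n) k d)) (push (\<U> k) f (U.trp (b n') k d'))"
      by (rule push_homologous[OF fs U.lfin V.lfin hk])
    moreover have l: "n \<le> l" "n' \<le> l" by (simp_all add: l_def)
    ultimately have "homologous p (\<V> l) q (V.trp n l c) (V.trp n' l c')"
      using homologous_trans[OF homologous_trans[OF homologous_sym[OF 1[OF k(1) l(1) c]]] 1[OF k(2) l(2) c']]
      unfolding d_def d'_def by blast
    moreover have "max n n' \<le> l" by (simp add: l_def)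
    ultimately show "\<exists>k\<ge>max n n'. homologous p (\<V> k) q (V.trp n k c) (V.trp n' k c')" by blast
  qed
qed

section \<open>Equivariant coloured coverings\<close>

lemma infdist_isometry:
  assumes "\<And>x y. dist (g x) (g y) = dist x y" shows "infdist (g x) (g ` A) = infdist x A"
  by (simp add: infdist_def image_image assms)

lemma infdist_less_obtain:
  assumes "A \<noteq> {}" "infdist x A < t" obtains a where "a \<in> A" "dist x a < t"
proof -
  have "bdd_below (dist x ` A)" by (rule bdd_belowI[of _ 0]) auto
  with assms that show ?thesis by (auto simp: infdist_notempty cINF_less_iff)
qed

text \<open>Properness makes the closure compact, so finitely many balls of radius
  \<open>\<delta>/2\<close> cover it, and each of them contains at most one point of
  \<open>A\<close>.\<close>

lemma finite_uniformly_discrete: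
  fixes A :: "'a::metric_space set"
  assumes "proper_space (UNIV :: 'a set)" "bounded A" "\<delta> > 0"
    and sep: "\<And>x y. x \<in> A \<Longrightarrow> y \<in> A \<Longrightarrow> x \<noteq> y \<Longrightarrow> \<delta> \<le> dist x y"
  shows "finite A"
proof -
  have "compact (closure A)"
    using assms(1,2) by (auto simp: proper_space_def intro: bounded_closure)
  then obtain k where k: "finite k" "closure A \<subseteq> (\<Union>x\<in>k. ball x (\<delta>/2))"
    using assms(3) unfolding compact_eq_totally_bounded by (metis half_gt_zero)
  have "\<forall>a\<in>A. \<exists>x\<in>k. dist x a < \<delta>/2" using k(2) closure_subset[of A] by force
  then obtain c where c: "\<And>a. a \<in> A \<Longrightarrow> c a \<in> k \<and> dist (c a) a < \<delta>/2" by metis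
  have "inj_on c A"
  proof (rule inj_onI, rule ccontr)
    fix x y assume xy: "x \<in> A" "y \<in> A" "c x = c y" "x \<noteq> y"
    have "dist x y \<le> dist (c x) x + dist (c x) y" by (metis dist_triangle dist_commute)
    with c[OF xy(1)] c[OF xy(2)] xy(3) sep[OF xy(1,2,4)] show False by auto
  qed
  moreover have "finite (c ` A)" using c k(1) by (auto intro: finite_subset[of _ k])
  ultimately show ?thesis by (rule finite_imageD[rotated])
qed

locale isometry_group =
  fixes \<Gamma> :: "('a::metric_space \<Rightarrow> 'a) set"
  assumes finite_G: "finite \<Gamma>" and id_G: "id \<in> \<Gamma>"
    and comp_G: "g \<in> \<Gamma> \<Longrightarrow> h \<in> \<Gamma> \<Longrightarrow> g \<circ> h \<in> \<Gamma>"
    and inv_G: "g \<in> \<Gamma> \<Longrightarrow> \<exists>h\<in>\<Gamma>. g \<circ> h = id \<and> h \<circ> g = id"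
    and isom_G: "g \<in> \<Gamma> \<Longrightarrow> dist (g x) (g y) = dist x y"
begin

lemma equivariant_subset_eq:
  assumes sub: "\<And>g x. g \<in> \<Gamma> \<Longrightarrow> g ` W x \<subseteq> W (g x)" and g: "g \<in> \<Gamma>"
  shows "g ` W x = W (g x)"
proof
  obtain h where h: "h \<in> \<Gamma>" "g \<circ> h = id" "h \<circ> g = id" using inv_G[OF g] by blast
  have "h (g x) = x" using h(3) by (simp add: fun_eq_iff)
  then have "h ` W (g x) \<subseteq> W x" using sub[OF h(1), of "g x"] by simp
  then have "g ` h ` W (g x) \<subseteq> g ` W x" by blast
  then show "W (g x) \<subseteq> g ` W x" using h(2) by (simp add: image_comp)
qed (rule sub[OF g])

text \<open>Translating a decomposition by the group makes it invariant but destroys the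
  disjointness of its colours, so the pieces themselves cannot serve. The new sets are level sets of
  the equivariant function that sends a point to the set of translated pieces within a given
  distance, thickened by \<open>r\<close>. A point is close to at most
  \<open>Suc l * card \<Gamma>\<close> translated pieces, one for each old colour and group element;
  one more distance gap than that gives the number \<open>N\<close> of colours.\<close>

theorem equivariant_cover:
  assumes proper: "proper_space (UNIV :: 'a set)" and asd: "asdim_le (UNIV :: 'a set) l"
  defines "N \<equiv> Suc (Suc l * card \<Gamma>)"
  assumes r: "r > 0"
  shows "\<exists>(V :: nat \<Rightarrow> 'a set set) D.
      (\<forall>t<N. \<forall>U\<in>V t. \<forall>g\<in>\<Gamma>. g ` U \<in> V t) \<and>
      (\<forall>t<N. \<forall>U\<in>V t. \<forall>U'\<in>V t. U \<inter> U' \<noteq> {} \<longrightarrow> U = U') \<and>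
      (\<forall>t<N. \<forall>U\<in>V t. U \<noteq> {} \<and> (\<forall>x\<in>U. \<forall>y\<in>U. dist x y \<le> D)) \<and>
      (\<forall>t<N. \<forall>B. bounded B \<longrightarrow> finite {U \<in> V t. U \<inter> B \<noteq> {}}) \<and>
      (\<forall>x. \<exists>t<N. \<exists>U\<in>V t. cball x r \<subseteq> U)"
proof -
  \<comment> \<open>Larger than \<open>2 * r\<close>, so that distinct cores, which are
    \<open>\<delta>\<close> apart, stay disjoint after thickening by \<open>r\<close>.\<close>
  define \<delta> where "\<delta> = 2 * r + 1"
  have \<delta>: "\<delta> > 0" "2 * r < \<delta>" using r by (simp_all add: \<delta>_def)
  \<comment> \<open>The \<open>N\<close> gaps of width \<open>\<delta>\<close> fill the distances up
    to \<open>L\<close>; the decomposition is taken at scale \<open>2 * L\<close>.\<close>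
  define L where "L = real N * \<delta>"
  have "N > 0" by (simp add: N_def)
  then have L: "L > 0" using \<delta> by (simp add: L_def)
  have "2 * L > 0" using L by simp
  from asd[unfolded asdim_le_def, THEN spec, THEN mp, OF this]
  obtain P0 :: "nat \<Rightarrow> 'a set set" where P0: "UNIV = (\<Union>k\<le>l. \<Union>(P0 k))"
      "\<forall>k\<le>l. \<exists>D. \<forall>V\<in>P0 k. \<forall>x\<in>V. \<forall>y\<in>V. dist x y \<le> D"
      "\<forall>k\<le>l. \<forall>V\<in>P0 k. \<forall>W\<in>P0 k. V \<noteq> W \<longrightarrow> V \<inter> W = {} \<and> (\<forall>x\<in>V. \<forall>y\<in>W. 2 * L \<le> dist x y)"
    by (elim exE conjE)
  define D1 where "D1 = (\<lambda>k. SOME D. \<forall>V\<in>P0 k. \<forall>x\<in>V. \<forall>y\<in>V. dist x y \<le> D)"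
  have D1: "dist x y \<le> D1 k" if "k \<le> l" "V \<in> P0 k" "x \<in> V" "y \<in> V" for k V x y
  proof -
    have "\<exists>D. \<forall>V\<in>P0 k. \<forall>x\<in>V. \<forall>y\<in>V. dist x y \<le> D" using P0(2) that(1) by blast
    from someI_ex[OF this] show ?thesis using that(2-4) unfolding D1_def by blast
  qed
  define D0 where "D0 = Max (D1 ` {..l})"
  have D0: "dist x y \<le> D0" if "k \<le> l" "V \<in> P0 k" "x \<in> V" "y \<in> V" for k V x y
  proof -
    have "D1 k \<le> D0" unfolding D0_def using that(1) by (intro Max_ge) auto
    then show ?thesis using D1[OF that] by simp
  qed
  define Ps where "Ps = {g ` P | g P k. g \<in> \<Gamma> \<and> k \<le> l \<and> P \<in> P0 k \<and> P \<noteq> {}}"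
  have Ps_ne: "P \<noteq> {}" if "P \<in> Ps" for P using that by (auto simp: Ps_def)
  have Ps_inv: "g ` P \<in> Ps" if "g \<in> \<Gamma>" "P \<in> Ps" for g P
  proof -
    obtain g' P' k where P': "P = g' ` P'" "g' \<in> \<Gamma>" "k \<le> l" "P' \<in> P0 k" "P' \<noteq> {}"
      using \<open>P \<in> Ps\<close> by (auto simp: Ps_def)
    then have "g ` P = (g \<circ> g') ` P'" by (simp add: image_comp)
    then show ?thesis unfolding Ps_def using P' comp_G[OF that(1) P'(2)] by blast
  qed
  have Ps_diam: "dist x y \<le> D0" if "P \<in> Ps" "x \<in> P" "y \<in> P" for P x y
    using that D0 by (auto simp: Ps_def isom_G)
  have Ps_cover: "\<exists>P\<in>Ps. x \<in> P" for x
  proof -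
    have "x \<in> (\<Union>k\<le>l. \<Union>(P0 k))" using P0(1) by blast
    then obtain k P where kP: "k \<le> l" "P \<in> P0 k" "x \<in> P" by auto
    then have "id ` P \<in> Ps" using id_G unfolding Ps_def by blast
    then show ?thesis using kP(3) by auto
  qed
  define Q where "Q = (\<lambda>x. {P \<in> Ps. infdist x P < L})"
  have Q: "finite (Q x) \<and> card (Q x) < N" for x
  proof -
    \<comment> \<open>For fixed \<open>g\<close> and \<open>k\<close> at most one translated piece
      is closer than \<open>L\<close> to \<open>x\<close>: two of them would be less than
      \<open>2 * L\<close> apart. Hence a pair \<open>(g, k)\<close> determines the piece.\<close>
    define pick where "pick = (\<lambda>(g, k). g ` (THE P. P \<in> P0 k \<and> P \<noteq> {} \<and> infdist x (g ` P) < L))"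
    have "Q x \<subseteq> pick ` (\<Gamma> \<times> {..l})"
    proof
      fix A assume "A \<in> Q x"
      then obtain g P k where gP: "A = g ` P" "g \<in> \<Gamma>" "k \<le> l" "P \<in> P0 k" "P \<noteq> {}" "infdist x (g ` P) < L"
        by (auto simp: Q_def Ps_def)
      have "(THE P. P \<in> P0 k \<and> P \<noteq> {} \<and> infdist x (g ` P) < L) = P"
      proof (rule the_equality)
        fix P' assume P': "P' \<in> P0 k \<and> P' \<noteq> {} \<and> infdist x (g ` P') < L"
        obtain u where u: "u \<in> P" "dist x (g u) < L"
          using infdist_less_obtain[of "g ` P" x L] gP by (metis image_is_empty imageE)
        obtain v where v: "v \<in> P'" "dist x (g v) < L"
          using infdist_less_obtain[of "g ` P'" x L] P' by (metis image_is_empty imageE)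
        have "dist u v = dist (g u) (g v)" using isom_G[OF gP(2)] by simp
        also have "\<dots> \<le> dist x (g u) + dist x (g v)" by (metis dist_triangle dist_commute)
        also have "\<dots> < 2 * L" using u v by simp
        finally have "\<not> 2 * L \<le> dist u v" by simp
        moreover have "2 * L \<le> dist u v" if "P \<noteq> P'"
          using P0(3)[rule_format, OF gP(3,4) _ that] P' u(1) v(1) by blast
        ultimately show "P' = P" by blast
      qed (use gP in auto)
      then have "A = pick (g, k)" by (simp add: pick_def gP(1))
      then show "A \<in> pick ` (\<Gamma> \<times> {..l})" using gP by auto
    qed
    moreover have "finite (\<Gamma> \<times> {..l})" using finite_G by simp
    ultimately have "finite (Q x)" "card (Q x) \<le> card (\<Gamma> \<times> {..l})"
      using finite_subset surj_card_le by (blast, metis)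
    then show ?thesis by (simp add: N_def card_cartesian_product mult.commute)
  qed
  define X where "X = (\<lambda>t::nat. {x. \<forall>P\<in>Ps. \<not> (real t * \<delta> < infdist x P \<and> infdist x P < real t * \<delta> + \<delta>)})"
  define s where "s = (\<lambda>(t::nat) x. {P \<in> Ps. infdist x P \<le> real t * \<delta>})"
  have cover: "\<exists>t<N. x \<in> X t" for x
  proof -
    define F where "F = (\<lambda>P. nat \<lfloor>infdist x P / \<delta>\<rfloor>)"
    have "card (F ` Q x) < card {..<N}" using Q[of x] card_image_le[of "Q x" F] by simp
    then have "\<not> {..<N} \<subseteq> F ` Q x" using Q[of x] card_mono[of "F ` Q x" "{..<N}"] by auto
    then obtain t where t: "t < N" "t \<notin> F ` Q x" by auto
    have "x \<in> X t"
    proof (rule ccontr)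
      assume "x \<notin> X t"
      then obtain P where P: "P \<in> Ps" "t * \<delta> < infdist x P" "infdist x P < real t * \<delta> + \<delta>"
        unfolding X_def by blast
      have "real (t + 1) * \<delta> \<le> L" unfolding L_def using t(1) \<delta> by (intro mult_right_mono) auto
      then have "real t * \<delta> + \<delta> \<le> L" by (simp add: algebra_simps)
      then have "P \<in> Q x" using P by (auto simp: Q_def)
      moreover have "\<lfloor>infdist x P / \<delta>\<rfloor> = int t"
        using P \<delta> by (intro floor_unique) (auto simp: field_simps)
      ultimately show False using t(2) by (auto simp: F_def image_iff)
    qed
    then show ?thesis using t(1) by blast
  qed
  \<comment> \<open>On \<open>X t\<close> no piece has distance in the gap above \<open>t * \<delta>\<close>, so the set \<open>s t\<close> of nearby pieces is
    locally constant there at scale \<open>\<delta>\<close>. Fewer than \<open>N\<close> pieces are close to a given point, so one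
    of its \<open>N\<close> gaps is unoccupied.\<close>
  define W where "W = (\<lambda>t x. {y \<in> X t. s t y = s t x})"
  have sep: "\<delta> \<le> dist y z" if "y \<in> X t" "z \<in> X t" "s t y \<noteq> s t z" for t y z
  proof -
    have *: "\<delta> \<le> dist y z" if yz: "y \<in> X t" "z \<in> X t" "P \<in> s t y" "P \<notin> s t z" for y z P
    proof -
      have "P \<in> Ps" "infdist y P \<le> real t * \<delta>" "infdist z P \<ge> real t * \<delta> + \<delta>"
        using yz by (auto simp: s_def X_def not_le not_less)
      then show ?thesis using infdist_triangle[of z P y] by (simp add: algebra_simps dist_commute)
    qed
    show ?thesis using that *[of y z] *[of z y] by (auto simp: dist_commute)
  qed
  define thick where "thick = (\<lambda>A::'a set. {z. \<exists>w\<in>A. dist z w \<le> r})"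
  define V where "V = (\<lambda>t. {thick (W t x) | x. x \<in> X t})"
  have X_inv: "g x \<in> X t" if g: "g \<in> \<Gamma>" and x: "x \<in> X t" for g x t
    unfolding X_def
  proof (intro CollectI ballI)
    fix P assume P: "P \<in> Ps"
    obtain h where h: "h \<in> \<Gamma>" "g \<circ> h = id" using inv_G[OF g] by blast
    then have e: "g ` (h ` P) = P" by (simp add: image_comp)
    have "infdist (g x) P = infdist x (h ` P)"
      using infdist_isometry[of g x "h ` P"] isom_G[OF g] unfolding e by blast
    then show "\<not> (real t * \<delta> < infdist (g x) P \<and> infdist (g x) P < real t * \<delta> + \<delta>)"
      using x Ps_inv[OF h(1) P] by (auto simp: X_def)
  qed
  have s_inv: "s t (g x) = (`) g ` s t x" if g: "g \<in> \<Gamma>" for g x t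
  proof
    obtain h where h: "h \<in> \<Gamma>" "g \<circ> h = id" "h \<circ> g = id" using inv_G[OF g] by blast
    show "(`) g ` s t x \<subseteq> s t (g x)"
      using Ps_inv[OF g] infdist_isometry[of g x] isom_G[OF g] by (auto simp: s_def)
    show "s t (g x) \<subseteq> (`) g ` s t x"
    proof
      fix P assume P: "P \<in> s t (g x)"
      have e: "g ` (h ` P) = P" using h by (simp add: image_comp)
      have "infdist (g x) P = infdist x (h ` P)"
        using infdist_isometry[of g x "h ` P"] isom_G[OF g] unfolding e by blast
      then have "h ` P \<in> s t x" using P Ps_inv[OF h(1)] by (auto simp: s_def)
      then show "P \<in> (`) g ` s t x" using e by (metis imageI)
    qed
  qed
  have W_inv: "g ` W t x = W t (g x)" if "g \<in> \<Gamma>" for g t x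
    by (rule equivariant_subset_eq[OF _ that]) (auto simp: W_def X_inv s_inv)
  have thick_inv: "g ` thick A = thick (g ` A)" if g: "g \<in> \<Gamma>" for g A
  proof
    obtain h where h: "h \<in> \<Gamma>" "g \<circ> h = id" using inv_G[OF g] by blast
    show "g ` thick A \<subseteq> thick (g ` A)" using isom_G[OF g] by (auto simp: thick_def)
    show "thick (g ` A) \<subseteq> g ` thick A"
    proof
      fix z assume "z \<in> thick (g ` A)"
      then obtain w where w: "w \<in> A" "dist z (g w) \<le> r" by (auto simp: thick_def)
      have z: "z = g (h z)" using h(2) by (simp add: fun_eq_iff)
      then have "dist (h z) w \<le> r" using w(2) isom_G[OF g, of "h z" w] by simp
      then show "z \<in> g ` thick A" using w(1) z by (auto simp: thick_def)
    qed
  qed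
  have V_eq: "thick (W t x) = thick (W t y)" if "x \<in> X t" "y \<in> X t" "w \<in> W t x" "w' \<in> W t y" "dist w w' < \<delta>" for t x y w w'
  proof -
    have "s t w = s t w'" using sep[of w t w'] that by (auto simp: W_def)
    then have "s t x = s t y" using that by (auto simp: W_def)
    then show ?thesis by (simp add: W_def)
  qed
  \<comment> \<open>Two thickenings by \<open>r\<close>, the diameter bound of a common nearby
    piece, and two distances to that piece. The extra 1 is there because the infimum defining
    \<open>infdist\<close> need not be attained.\<close>
  define D where "D = 2 * r + (2 * (real N * \<delta> + 1) + D0)"
  have c1: "g ` U \<in> V t" if ass: "U \<in> V t" "g \<in> \<Gamma>" for t U g
  proof -
    obtain x where x: "U = thick (W t x)" "x \<in> X t" using ass(1) unfolding V_def by blast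
    have "g ` U = thick (W t (g x))" unfolding x(1) thick_inv[OF ass(2)] W_inv[OF ass(2)] ..
    then show ?thesis using X_inv[OF ass(2) x(2)] unfolding V_def by blast
  qed
  have c2: "U = U'" if U: "U \<in> V t" "U' \<in> V t" "U \<inter> U' \<noteq> {}" for t U U'
  proof -
    obtain x y where xy: "U = thick (W t x)" "x \<in> X t" "U' = thick (W t y)" "y \<in> X t"
      using U(1,2) unfolding V_def by blast
    obtain z where z: "z \<in> U" "z \<in> U'" using U(3) by auto
    obtain w w' where w: "w \<in> W t x" "dist z w \<le> r" "w' \<in> W t y" "dist z w' \<le> r"
      using z xy by (auto simp: thick_def)
    have "dist w w' \<le> dist z w + dist z w'" by (metis dist_triangle dist_commute)
    then have "dist w w' < \<delta>" using w \<delta> by linarith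
    then show ?thesis using V_eq[OF xy(2,4) w(1,3)] xy by simp
  qed
  have c3: "U \<noteq> {} \<and> (\<forall>x\<in>U. \<forall>y\<in>U. dist x y \<le> D)" if ass: "t < N" "U \<in> V t" for t U
  proof -
    obtain x where x: "U = thick (W t x)" "x \<in> X t" using ass(2) unfolding V_def by blast
    then have "x \<in> U" using r by (auto simp: thick_def W_def)
    obtain P where P: "P \<in> Ps" "x \<in> P" using Ps_cover by blast
    then have Ps: "P \<in> s t x" using \<delta> by (auto simp: s_def)
    have near: "\<exists>p\<in>P. dist w p < real N * \<delta> + 1" if "w \<in> W t x" for w
    proof -
      have "infdist w P \<le> real t * \<delta>" using that Ps by (auto simp: W_def s_def)
      also have "\<dots> \<le> real N * \<delta>" using \<open>t < N\<close> \<delta> by (intro mult_right_mono) auto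
      finally have "infdist w P < real N * \<delta> + 1" by simp
      then show ?thesis using infdist_less_obtain[OF Ps_ne[OF P(1)], of w "real N * \<delta> + 1"] by blast
    qed
    have "dist y z \<le> D" if "y \<in> U" "z \<in> U" for y z
    proof -
      obtain v w where v: "v \<in> W t x" "dist y v \<le> r" and w: "w \<in> W t x" "dist z w \<le> r"
        using \<open>y \<in> U\<close> \<open>z \<in> U\<close> x by (auto simp: thick_def)
      obtain p q where p: "p \<in> P" "dist v p < real N * \<delta> + 1" and q: "q \<in> P" "dist w q < real N * \<delta> + 1"
        using near v(1) w(1) by blast
      have "dist y z \<le> dist y v + (dist v p + (dist p q + (dist w q + dist z w)))"
        by (smt (verit) dist_triangle dist_commute)
      then show ?thesis using v w p q Ps_diam[OF P(1) p(1) q(1)] by (simp add: D_def)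
    qed
    then show ?thesis using \<open>x \<in> U\<close> by auto
  qed
  have c4: "finite {U \<in> V t. U \<inter> B \<noteq> {}}" if B: "bounded B" for t B
  proof -
    define S where "S = {U \<in> V t. U \<inter> B \<noteq> {}}"
    have "\<exists>x w z. U = thick (W t x) \<and> x \<in> X t \<and> w \<in> W t x \<and> z \<in> B \<and> dist z w \<le> r" if U: "U \<in> S" for U
    proof -
      obtain x where "U = thick (W t x)" "x \<in> X t" using U unfolding S_def V_def by blast
      moreover obtain z where "z \<in> U" "z \<in> B" using U by (auto simp: S_def)
      ultimately show ?thesis by (auto simp: thick_def)
    qed
    then obtain x w z where xw: "\<And>U. U \<in> S \<Longrightarrow> U = thick (W t (x U)) \<and> x U \<in> X t \<and> w U \<in> W t (x U) \<and> z U \<in> B \<and> dist (z U) (w U) \<le> r"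
      by metis
    have ap: "\<delta> \<le> dist (w U) (w U')" if "U \<in> S" "U' \<in> S" "U \<noteq> U'" for U U'
      using V_eq[of "x U" t "x U'" "w U" "w U'"] xw[OF that(1)] xw[OF that(2)] that(3) by (metis not_le)
    \<comment> \<open>One core point from each member gives a \<open>\<delta>\<close>-separated set
      near \<open>B\<close>, which properness makes finite.\<close>
    have "finite (w ` S)"
    proof (rule finite_uniformly_discrete[OF proper _ \<delta>(1)])
      obtain a e where "\<And>y. y \<in> B \<Longrightarrow> dist a y \<le> e" using B by (auto simp: bounded_def)
      then have "dist a (w U) \<le> e + r" if "U \<in> S" for U
        using xw[OF that] dist_triangle[of a "w U" "z U"] by fastforce
      then show "bounded (w ` S)" by (auto simp: bounded_def)
    qed (use ap in auto)
    moreover have "inj_on w S" using ap \<delta>(1) by (intro inj_onI) (metis dist_self not_le)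
    ultimately show ?thesis unfolding S_def by (rule finite_imageD)
  qed
  have c5: "\<exists>t<N. \<exists>U\<in>V t. cball x r \<subseteq> U" for x
  proof -
    obtain t where t: "t < N" "x \<in> X t" using cover by blast
    then have "cball x r \<subseteq> thick (W t x)" by (auto simp: thick_def W_def dist_commute)
    then show ?thesis using t by (auto simp: V_def)
  qed
  show ?thesis
  proof (rule exI[of _ V], rule exI[of _ D], intro conjI allI impI ballI)
    show "\<exists>t<N. \<exists>U\<in>V t. cball x r \<subseteq> U" for x by (rule c5)
    show "finite {U \<in> V t. U \<inter> B \<noteq> {}}" if "bounded B" for t B using that by (rule c4)
    show "g ` U \<in> V t" if "U \<in> V t" "g \<in> \<Gamma>" for t U g using that by (rule c1)
    show "U = U'" if "U \<in> V t" "U' \<in> V t" "U \<inter> U' \<noteq> {}" for t U U' using that by (rule c2)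
    show "U \<noteq> {}" if "t < N" "U \<in> V t" for t U using c3[OF that] by (rule conjunct1)
    show "dist x y \<le> D" if "t < N" "U \<in> V t" "x \<in> U" "y \<in> U" for t U x y
      by (rule bspec[OF bspec[OF c3[OF that(1,2), THEN conjunct2] that(3)] that(4)])
  qed
qed

end

section \<open>Comparison with coarse homology\<close>

text \<open>
  The rationals modulo the integers: their \<open>p\<close>-torsion serves as coefficient group, because no type
  of residues can depend on the variable \<open>p\<close>.
\<close>

quotient_type qz = rat / "\<lambda>x y::rat. x - y \<in> \<int>"
proof (rule equivpI)
  show "reflp (\<lambda>x y::rat. x - y \<in> \<int>)" by (simp add: reflp_def)
  show "symp (\<lambda>x y::rat. x - y \<in> \<int>)" by (metis (mono_tags, lifting) sympI Ints_minus minus_diff_eq)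
  show "transp (\<lambda>x y::rat. x - y \<in> \<int>)"
  proof (rule transpI)
    fix x y z :: rat assume "x - y \<in> \<int>" "y - z \<in> \<int>"
    then have "(x - y) + (y - z) \<in> \<int>" by (rule Ints_add)
    then show "x - z \<in> \<int>" by simp
  qed
qed

instantiation qz :: ab_group_add
begin
lift_definition zero_qz :: qz is 0 .
lift_definition plus_qz :: "qz \<Rightarrow> qz \<Rightarrow> qz" is "(+)"
  by (metis Ints_add add_diff_add)
lift_definition minus_qz :: "qz \<Rightarrow> qz \<Rightarrow> qz" is "(-)"
  by (metis (no_types, lifting) Ints_diff diff_diff_eq2 diff_diff_add add_diff_eq diff_add_eq add.commute)
lift_definition uminus_qz :: "qz \<Rightarrow> qz" is uminus
  by (metis Ints_minus minus_diff_commute minus_diff_eq uminus_add_conv_diff diff_minus_eq_add)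
instance by standard (transfer; simp)+
end

lift_definition res :: "nat \<Rightarrow> int \<Rightarrow> qz" is "\<lambda>p k. of_int k / of_nat p" .

lemma res_add: "res p (a + b) = res p a + res p b"
  by transfer (simp add: add_divide_distrib)
lemma res_0 [simp]: "res p 0 = 0" by transfer simp
lemma res_minus: "res p (- a) = - res p a"
  using res_add[of p a "- a"] by (simp add: eq_neg_iff_add_eq_0 add.commute)
lemma res_diff: "res p (a - b) = res p a - res p b"
  using res_add[of p a "- b"] by (simp add: res_minus)
lemma res_sum: "res p (sum f I) = (\<Sum>i\<in>I. res p (f i))"
  by (induction I rule: infinite_finite_induct) (simp_all add: res_add)

lemma res_eq_0: assumes "p > 0" shows "res p a = 0 \<longleftrightarrow> int p dvd a"
proof -
  have "(of_int a / of_nat p :: rat) \<in> \<int> \<longleftrightarrow> int p dvd a"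
  proof
    assume "(of_int a / of_nat p :: rat) \<in> \<int>"
    then obtain k where "(of_int a / of_nat p :: rat) = of_int k" by (auto elim: Ints_cases)
    then have "(of_int a :: rat) = of_int (k * int p)" using assms by (simp add: field_simps)
    then show "int p dvd a" by (metis of_int_eq_iff dvd_triv_right)
  next
    assume "int p dvd a"
    then show "(of_int a / of_nat p :: rat) \<in> \<int>" using assms by (auto simp: dvd_def)
  qed
  then show ?thesis by transfer simp
qed

lemma res_eq: "p > 0 \<Longrightarrow> res p a = res p b \<longleftrightarrow> a mod int p = b mod int p"
  using res_eq_0[of p "a - b"] by (simp add: res_diff mod_eq_dvd_iff)

lemma res_mod [simp]: "p > 0 \<Longrightarrow> res p (a mod int p) = res p a" by (simp add: res_eq)

lemma nmult_res: "nmult k (res p a) = res p (int k * a)"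
  by (simp add: nmult_def res_sum[symmetric])

lemma nmult_res_p [simp]: "p > 0 \<Longrightarrow> nmult p (res p a) = 0"
  by (simp add: nmult_res res_eq_0)

lemma nmult_qz: "nmult k (abs_qz r) = abs_qz (of_nat k * r)"
proof (induction k)
  case (Suc k)
  then show ?case by (simp add: nmult_Suc plus_qz.abs_eq algebra_simps)
qed (simp add: zero_qz_def)

lemma res_surj: assumes p: "p > 0" and x: "nmult p x = 0" shows "\<exists>a\<in>{0..<int p}. x = res p a"
proof -
  have "\<exists>r. x = abs_qz r" by (induction x rule: qz.abs_induct) blast
  then obtain r where r: "x = abs_qz r" by blast
  have "of_nat p * r \<in> \<int>"
    using x unfolding r nmult_qz zero_qz_def by (simp add: qz.abs_eq_iff)
  then obtain k where "of_nat p * r = of_int k" by (auto elim: Ints_cases)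
  then have "r = of_int k / of_nat p" using p by (simp add: field_simps)
  then have "x = res p k" by (simp add: r res.abs_eq)
  then show ?thesis using p by (intro bexI[of _ "k mod int p"]) auto
qed

lemma res_inj: "p > 0 \<Longrightarrow> a \<in> {0..<int p} \<Longrightarrow> b \<in> {0..<int p} \<Longrightarrow> res p a = res p b \<Longrightarrow> a = b"
  by (simp add: res_eq)

lemma permute_list_transpose:
  "permute_list (Transposition.transpose (length xs) (Suc (length xs + length ms))) (xs @ u # ms @ v # ys)
     = xs @ v # ms @ u # ys" (is "permute_list ?t ?l = _")
proof (rule nth_equalityI)
  fix i assume "i < length (permute_list ?t ?l)"
  then have i: "i < length ?l" by simp
  have t: "?t permutes {..<length ?l}" by (rule permutes_swap_id) auto
  have "permute_list ?t ?l ! i = ?l ! ?t i" using i t by (simp add: permute_list_nth)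
  also have "\<dots> = (xs @ v # ms @ u # ys) ! i"
    by (auto simp: Transposition.transpose_def nth_append nth_Cons')
  finally show "permute_list ?t ?l ! i = (xs @ v # ms @ u # ys) ! i" .
qed simp

lemma alternating_transpose:
  assumes "alternating c" "a < length vs" "b < length vs" "a < b"
  shows "c (permute_list (Transposition.transpose a b) vs) = - c vs"
proof -
  define xs ms ys where "xs = take a vs" and "ms = take (b - Suc a) (drop (Suc a) vs)" and "ys = drop (Suc b) vs"
  have "drop (Suc a) vs = ms @ drop (b - Suc a) (drop (Suc a) vs)"
    by (simp only: ms_def append_take_drop_id)
  also have "drop (b - Suc a) (drop (Suc a) vs) = drop b vs" using assms by simp
  also have "drop b vs = vs ! b # ys" unfolding ys_def using assms(3) by (rule Cons_nth_drop_Suc[symmetric])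
  finally have vs: "vs = xs @ vs ! a # ms @ vs ! b # ys"
    using id_take_nth_drop[OF assms(2)] by (simp add: xs_def)
  have ab: "a = length xs" "b = Suc (length xs + length ms)" using assms by (auto simp: xs_def ms_def)
  have "permute_list (Transposition.transpose a b) vs = xs @ vs ! b # ms @ vs ! a # ys"
    by (subst vs, subst ab(1), subst ab(2)) (rule permute_list_transpose)
  then show ?thesis using alternating_far_swap[OF assms(1), of xs "vs ! b" ms "vs ! a" ys] vs by simp
qed

text \<open>By induction over transpositions. The sign acts through a case distinction, since the
  coefficients form only an additive group.\<close>

lemma alternating_permute:
  assumes c: "alternating c" and p: "\<pi> permutes {..<n}" and n: "length vs = n"
  shows "c (permute_list \<pi> vs) = (if sign \<pi> = 1 then c vs else - c vs)"
proof -
  have "\<forall>vs. length vs = n \<longrightarrow> c (permute_list \<pi> vs) = (if sign \<pi> = 1 then c vs else - c vs)"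
    using p finite_lessThan
  proof (induction rule: permutes_induct)
    case id then show ?case by simp
  next
    case (swap a b p)
    show ?case
    proof (intro allI impI)
      fix vs :: "'a list" assume l: "length vs = n"
      let ?t = "Transposition.transpose a b"
      have "c (permute_list ?t vs) = - c vs"
      proof (cases "a < b")
        case True then show ?thesis using alternating_transpose[OF c, of a vs b] swap l by simp
      next
        case False
        then have "b < a" using swap by simp
        then show ?thesis using alternating_transpose[OF c, of b vs a] swap l by (simp add: transpose_commute)
      qed
      moreover have "permute_list (?t \<circ> p) vs = permute_list p (permute_list ?t vs)"
        using swap l by (simp add: permute_list_compose)
      moreover have "sign (?t \<circ> p) = - sign p"
      proof -
        have "permutation p" using swap unfolding permutation_permutes by blast
        then show ?thesis using sign_compose[OF permutation_swap_id, of p a b] swap(3) by (simp add: sign_swap_id)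
      qed
      ultimately show "c (permute_list (?t \<circ> p) vs) = (if sign (?t \<circ> p) = 1 then c vs else - c vs)"
        using swap.IH l by (cases p rule: sign_cases) auto
    qed
  qed
  then show ?thesis using n by blast
qed

text \<open>Turns the vertexwise recursion of \<open>push\<close> into a single sum over lists, the
  form of the chain map in \<open>lf_chain_map\<close>.\<close>

lemma push_eq_sum:
  assumes fin: "\<And>w. finite {v \<in> V. f v = w}"
  shows "finite {vs. map f vs = ws \<and> set vs \<subseteq> V} \<and>
    push V f c ws = (\<Sum>vs\<in>{vs. map f vs = ws \<and> set vs \<subseteq> V}. c vs)"
proof (induction ws arbitrary: c)
  case Nil
  have "{vs. map f vs = [] \<and> set vs \<subseteq> V} = {[]}" by auto
  then show ?case by simp
next
  case (Cons w ws)
  let ?L = "{vs. map f vs = ws \<and> set vs \<subseteq> V}" and ?S = "{v \<in> V. f v = w}"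
  have e: "{vs. map f vs = w # ws \<and> set vs \<subseteq> V} = (\<lambda>(v, vs). v # vs) ` (?S \<times> ?L)"
    by (auto simp: map_eq_Cons_conv)
  have "push V f c (w # ws) = (\<Sum>v\<in>?S. \<Sum>vs\<in>?L. c (v # vs))" using Cons by simp
  also have "\<dots> = (\<Sum>x\<in>?S \<times> ?L. c (case x of (v, vs) \<Rightarrow> v # vs))"
    by (simp add: sum.cartesian_product case_prod_beta)
  also have "\<dots> = (\<Sum>vs\<in>(\<lambda>(v, vs). v # vs) ` (?S \<times> ?L). c vs)"
    by (subst sum.reindex) (auto simp: inj_on_def)
  finally show ?case using e fin[of w] Cons by simp
qed

text \<open>A uniform covering may contain the empty set, which is not a vertex of its nerve; it is
  removed before comparing with \<open>chains\<close>. The map \<open>J\<close> identifies residues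
  with the \<open>p\<close>-torsion of \<open>qz\<close>.\<close>

locale bridge =
  fixes p :: nat and \<U> :: "'a set set"
  assumes p: "p > 1" and lfn: "locfin (\<U> - {{}})"
begin

abbreviation V where "V \<equiv> \<U> - {{}}"
abbreviation J where "J c \<equiv> (\<lambda>vs. res p (c vs))"

lemma p0: "p > 0" using p by simp

lemma simplex_iff: "vs \<in> ordered_simplices (nerve \<U>) q \<longleftrightarrow>
    length vs = Suc q \<and> distinct vs \<and> set vs \<subseteq> V \<and> \<Inter>(set vs) \<noteq> {}"
  by (cases vs) (auto simp: ordered_simplices_def nerve_def)

lemma J_inj:
  assumes "\<And>vs. c vs \<in> {0..<int p}" "\<And>vs. d vs \<in> {0..<int p}" "J c = J d"
  shows "c = d"
  using res_inj[OF p0 assms(1,2)] assms(3) by (auto simp: fun_eq_iff)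

lemma J_chains:
  assumes c: "c \<in> lf_chains p (nerve \<U>) q" shows "J c \<in> chains p V q"
proof -
  have c0: "c vs = 0" if "vs \<notin> ordered_simplices (nerve \<U>) q" for vs using c that by (simp add: lf_chains_def)
  have a1: "J c (xs @ u # v # ys) = - J c (xs @ v # u # ys)" for xs u v ys
  proof (cases "xs @ v # u # ys \<in> ordered_simplices (nerve \<U>) q")
    case True
    let ?vs = "xs @ v # u # ys" and ?t = "Transposition.transpose (length xs) (Suc (length xs))"
    have t: "?t permutes {..<Suc q}" using True by (intro permutes_swap_id) (auto simp: simplex_iff)
    have "c (permute_list ?t ?vs) = (sign ?t * c ?vs) mod int p"
      using c True t by (simp add: lf_chains_def)
    moreover have "permute_list ?t ?vs = xs @ u # v # ys"
      using permute_list_transpose[of xs "[]" v u ys] by simp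
    ultimately have "c (xs @ u # v # ys) = (- c ?vs) mod int p" by (simp add: sign_swap_id)
    then show ?thesis using p0 by (simp add: res_minus)
  next
    case False
    then have "xs @ u # v # ys \<notin> ordered_simplices (nerve \<U>) q" by (auto simp: simplex_iff)
    with False show ?thesis using c0 by simp
  qed
  have a2: "J c (xs @ u # u # ys) = 0" for xs u ys
    using c0[of "xs @ u # u # ys"] by (simp add: simplex_iff)
  have "alternating (J c)" unfolding alternating_def by (intro conjI allI a1 a2)
  moreover have "length vs = Suc q \<and> set vs \<subseteq> V \<and> \<Inter>(set vs) \<noteq> {}" if "J c vs \<noteq> 0" for vs
  proof -
    have "c vs \<noteq> 0" using that by auto
    then have "vs \<in> ordered_simplices (nerve \<U>) q" using c0 by blast
    then show ?thesis by (simp add: simplex_iff)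
  qed
  ultimately show ?thesis using p0 by (simp add: chains_def)
qed

text \<open>Distinctness of the vertices comes from alternation. Local finiteness of the chain comes
  from the covering: simplices through \<open>w\<close> are lists of fixed length over the finitely
  many neighbours of \<open>w\<close>.\<close>

lemma lf_chainsI:
  assumes v: "\<And>vs. c vs \<in> {0..<int p}" and J: "J c \<in> chains p V q"
  shows "c \<in> lf_chains p (nerve \<U>) q"
proof -
  have c0: "c vs = 0" if "J c vs = 0" for vs
    using res_inj[OF p0 v[of vs], of 0] that p0 by simp
  have nz: "vs \<in> ordered_simplices (nerve \<U>) q" if "c vs \<noteq> 0" for vs
  proof -
    have n: "J c vs \<noteq> 0" using c0 that by blast
    then have "distinct vs" using alternating_not_distinct[OF chains_alternating[OF J]] by blast
    then show ?thesis using chains_supp[OF J n] by (simp add: simplex_iff)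
  qed
  have "c (permute_list \<pi> vs) = (sign \<pi> * c vs) mod int p"
    if "vs \<in> ordered_simplices (nerve \<U>) q" "\<pi> permutes {..<Suc q}" for vs \<pi>
  proof -
    have "J c (permute_list \<pi> vs) = res p (sign \<pi> * c vs)"
      using alternating_permute[OF chains_alternating[OF J] that(2), of vs] that(1)
      by (cases \<pi> rule: sign_cases) (auto simp: simplex_iff res_minus)
    then show ?thesis using v p0 by (intro res_inj[OF p0]) auto
  qed
  moreover have "finite {vs. w \<in> set vs \<and> c vs \<noteq> 0}" for w
  proof (cases "w \<in> V")
    case True
    then have fin: "finite (nbr V w)" using lfn by (simp add: locfin_def)
    have "{vs. w \<in> set vs \<and> c vs \<noteq> 0} \<subseteq> {vs. set vs \<subseteq> nbr V w \<and> length vs = Suc q}"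
    proof safe
      fix vs x assume "w \<in> set vs" "c vs \<noteq> 0" "x \<in> set vs"
      then show "x \<in> nbr V w" using nz[of vs] by (fastforce simp: simplex_iff nbr_def)
    next
      fix vs assume "c vs \<noteq> 0" then show "length vs = Suc q" using nz by (simp add: simplex_iff)
    qed
    then show ?thesis by (rule finite_subset[OF _ finite_lists_length_eq[OF fin]])
  next
    case False
    then have e: "{vs. w \<in> set vs \<and> c vs \<noteq> 0} = {}" using nz by (auto simp: simplex_iff)
    show ?thesis unfolding e by simp
  qed
  ultimately show ?thesis using v nz unfolding lf_chains_def by blast
qed

lemma J_surj:
  assumes d: "d \<in> chains p V q" shows "\<exists>c\<in>lf_chains p (nerve \<U>) q. J c = d"
proof -
  have "\<forall>vs. \<exists>a\<in>{0..<int p}. d vs = res p a" using res_surj[OF p0 chains_tors[OF d]] by blast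
  then obtain c where c: "\<And>vs. c vs \<in> {0..<int p}" "\<And>vs. d vs = res p (c vs)" by metis
  then have "J c = d" by auto
  then show ?thesis using lf_chainsI[OF c(1)] d by (intro bexI[of _ c]) auto
qed

lemma lf_chains_range: "c \<in> lf_chains p K q \<Longrightarrow> c vs \<in> {0..<int p}"
  by (simp add: lf_chains_def)

lemma J_boundary:
  assumes c: "c \<in> lf_chains p (nerve \<U>) q" shows "J (lf_boundary p c) = boundary (nbr V) (J c)"
proof
  fix vs show "J (lf_boundary p c) vs = boundary (nbr V) (J c) vs"
  proof (cases vs)
    case (Cons v ys)
    let ?N = "{u. c (u # v # ys) \<noteq> 0}"
    have "(\<lambda>u. u # v # ys) ` ?N \<subseteq> {vs. v \<in> set vs \<and> c vs \<noteq> 0}" by auto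
    moreover have "finite {vs. v \<in> set vs \<and> c vs \<noteq> 0}" using c by (simp add: lf_chains_def)
    ultimately have "finite ((\<lambda>u. u # v # ys) ` ?N)" by (rule finite_subset)
    then have fin: "finite ?N" by (rule finite_imageD) (auto simp: inj_on_def)
    have "boundary (nbr V) (J c) (v # ys) = (\<Sum>u\<in>?N. res p (c (u # v # ys)))"
      by (rule boundary_eq[OF J_chains[OF c] lfn fin]) auto
    then show ?thesis using Cons p0 by (simp add: lf_boundary_def res_sum del: boundary.simps)
  qed (simp add: lf_boundary_def)
qed

lemma lf_boundary_range: "lf_boundary p c vs \<in> {0..<int p}"
  using p0 by (simp add: lf_boundary_def)

lemma lf_cycles_iff: "c \<in> lf_cycles p (nerve \<U>) q \<longleftrightarrow> c \<in> lf_chains p (nerve \<U>) q \<and> J c \<in> cycles p V q"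
proof -
  have "lf_boundary p c = (\<lambda>_. 0) \<longleftrightarrow> boundary (nbr V) (J c) = 0" if c: "c \<in> lf_chains p (nerve \<U>) q"
  proof
    assume "lf_boundary p c = (\<lambda>_. 0)"
    then show "boundary (nbr V) (J c) = 0" unfolding J_boundary[OF c, symmetric] by (simp add: fun_eq_iff)
  next
    assume "boundary (nbr V) (J c) = 0"
    then show "lf_boundary p c = (\<lambda>_. 0)" unfolding J_boundary[OF c, symmetric]
      using lf_boundary_range p0 by (intro J_inj) (auto simp: fun_eq_iff)
  qed
  then show ?thesis using J_chains by (auto simp: lf_cycles_def cycles_def)
qed

definition coset :: "nat \<Rightarrow> ('a set list \<Rightarrow> int) \<Rightarrow> ('a set list \<Rightarrow> int) set" where
  "coset q c = lf_boundaries p (nerve \<U>) q #>\<^bsub>lf_chain_group p (nerve \<U>) q\<^esub> c"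

text \<open>Under \<open>J\<close>, addition reduced modulo \<open>p\<close> becomes addition in
  \<open>qz\<close>, so differing by a boundary modulo \<open>p\<close> is the relation
  \<open>homologous\<close>.\<close>

lemma coset_eq:
  assumes c: "c \<in> lf_chains p (nerve \<U>) q"
  shows "coset q c = {x \<in> lf_chains p (nerve \<U>) q. homologous p V q (J x) (J c)}"
proof safe
  fix x assume "x \<in> coset q c"
  then obtain e where e: "e \<in> lf_chains p (nerve \<U>) (Suc q)"
    and x: "x = (\<lambda>vs. (lf_boundary p e vs + c vs) mod int p)"
    by (auto simp: coset_def r_coset_def lf_boundaries_def lf_chain_group_def)
  have Jx: "J x = boundary (nbr V) (J e) + J c"
    using J_boundary[OF e] p0 by (auto simp: x res_add fun_eq_iff)
  have "J x \<in> chains p V q" unfolding Jx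
    by (rule chains_plus[OF boundary_chains[OF J_chains[OF e] lfn] J_chains[OF c]])
  then show "x \<in> lf_chains p (nerve \<U>) q" by (rule lf_chainsI[rotated]) (use p0 in \<open>simp add: x\<close>)
  show "homologous p V q (J x) (J c)" unfolding homologous_def
    by (rule bexI[OF _ J_chains[OF e]]) (simp add: Jx)
next
  fix x assume x: "x \<in> lf_chains p (nerve \<U>) q" "homologous p V q (J x) (J c)"
  then obtain E where E: "E \<in> chains p V (Suc q)" "boundary (nbr V) E = J x - J c" by (auto simp: homologous_def)
  obtain e where e: "e \<in> lf_chains p (nerve \<U>) (Suc q)" "J e = E" using J_surj[OF E(1)] by blast
  have "x = (\<lambda>vs. (lf_boundary p e vs + c vs) mod int p)"
  proof (rule J_inj)
    have "J (lf_boundary p e) = J x - J c" using J_boundary[OF e(1)] e(2) E(2) by simp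
    then have "res p (lf_boundary p e vs) = res p (x vs) - res p (c vs)" for vs
      by (simp add: fun_eq_iff)
    then show "J x = J (\<lambda>vs. (lf_boundary p e vs + c vs) mod int p)" using p0 by (simp add: res_add)
  qed (use p0 lf_chains_range[OF x(1)] in auto)
  then show "x \<in> coset q c" using e(1)
    by (auto simp: coset_def r_coset_def lf_boundaries_def lf_chain_group_def)
qed

lemma coset_eq_iff:
  assumes c: "c \<in> lf_chains p (nerve \<U>) q" and d: "d \<in> lf_chains p (nerve \<U>) q"
  shows "coset q c = coset q d \<longleftrightarrow> homologous p V q (J c) (J d)"
  unfolding coset_eq[OF c] coset_eq[OF d]
  using c homologous_refl homologous_sym homologous_trans by blast

lemma homology_carrier: "carrier (lf_homology p (nerve \<U>) q) = coset q ` lf_cycles p (nerve \<U>) q"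
  by (auto simp: lf_homology_def FactGroup_def RCOSETS_def coset_def r_coset_def)

end

abbreviation scale :: "nat \<Rightarrow> ('a \<Rightarrow> int) \<Rightarrow> 'a \<Rightarrow> qz" where
  "scale p c \<equiv> (\<lambda>vs. res p (c vs))"

context
  fixes p :: nat and \<U> \<W> :: "'a set set" and f
  assumes U: "bridge p \<U>" and W: "bridge p \<W>" and f: "simp_map (\<U> - {{}}) (\<W> - {{}}) f"
begin

interpretation U: bridge p \<U> by (rule U)
interpretation W: bridge p \<W> by (rule W)

lemma scale_chain_map:
  assumes c: "c \<in> lf_chains p (nerve \<U>) q"
  shows "scale p (lf_chain_map p f c) = push (\<U> - {{}}) f (scale p c)"
proof
  fix ws
  show "scale p (lf_chain_map p f c) ws = push (\<U> - {{}}) f (scale p c) ws"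
  proof (cases "distinct ws")
    case True
    let ?L = "{vs. map f vs = ws \<and> set vs \<subseteq> \<U> - {{}}}"
    have L: "finite ?L \<and> push (\<U> - {{}}) f (scale p c) ws = (\<Sum>vs\<in>?L. res p (c vs))"
      by (rule push_eq_sum[OF simp_map_fin[OF f]])
    have "set vs \<subseteq> \<U> - {{}}" if "c vs \<noteq> 0" for vs
    proof -
      have "vs \<in> ordered_simplices (nerve \<U>) q" using c that unfolding lf_chains_def by blast
      then show ?thesis by (simp add: U.simplex_iff)
    qed
    then have "(\<Sum>vs\<in>{vs. map f vs = ws \<and> c vs \<noteq> 0}. c vs) = (\<Sum>vs\<in>?L. c vs)"
      by (intro sum.mono_neutral_left[OF conjunct1[OF L]]) auto
    then show ?thesis using True conjunct2[OF L] U.p0 by (simp add: lf_chain_map_def res_sum)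
  next
    case False
    then show ?thesis
      using alternating_not_distinct[OF chains_alternating[OF push_chains[OF f U.J_chains[OF c]]], of ws]
      by (simp add: lf_chain_map_def)
  qed
qed

lemma chain_map_chains:
  assumes c: "c \<in> lf_chains p (nerve \<U>) q" shows "lf_chain_map p f c \<in> lf_chains p (nerve \<W>) q"
proof (rule W.lf_chainsI)
  show "scale p (lf_chain_map p f c) \<in> chains p (\<W> - {{}}) q"
    unfolding scale_chain_map[OF c] by (rule push_chains[OF f U.J_chains[OF c]])
qed (use U.p0 in \<open>simp add: lf_chain_map_def\<close>)

lemma chain_map_cycles:
  assumes c: "c \<in> lf_cycles p (nerve \<U>) q" shows "lf_chain_map p f c \<in> lf_cycles p (nerve \<W>) q"
proof -
  have c': "c \<in> lf_chains p (nerve \<U>) q" "scale p c \<in> cycles p (\<U> - {{}}) q"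
    using c by (simp_all add: U.lf_cycles_iff)
  show ?thesis unfolding W.lf_cycles_iff scale_chain_map[OF c'(1)]
    using chain_map_chains[OF c'(1)] push_cycles[OF f U.lfn W.lfn c'(2)] by blast
qed

lemma homology_map_coset:
  assumes c: "c \<in> lf_chains p (nerve \<U>) q"
  shows "lf_homology_map p (nerve \<W>) q f (bridge.coset p \<U> q c) = bridge.coset p \<W> q (lf_chain_map p f c)"
proof -
  have "bridge.coset p \<W> q (lf_chain_map p f x) = bridge.coset p \<W> q (lf_chain_map p f c)"
    if x: "x \<in> bridge.coset p \<U> q c" for x
  proof -
    have x': "x \<in> lf_chains p (nerve \<U>) q" "homologous p (\<U> - {{}}) q (scale p x) (scale p c)"
      using x unfolding U.coset_eq[OF c] by auto
    show ?thesis
      unfolding W.coset_eq_iff[OF chain_map_chains[OF x'(1)] chain_map_chains[OF c]]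
        scale_chain_map[OF x'(1)] scale_chain_map[OF c]
      by (rule push_homologous[OF f U.lfn W.lfn x'(2)])
  qed
  moreover have "c \<in> bridge.coset p \<U> q c" unfolding U.coset_eq[OF c] using c homologous_refl by blast
  ultimately show ?thesis unfolding lf_homology_map_def W.coset_def[symmetric] by blast
qed

end

lemma coarsening_refining:
  assumes "coarsening_system S \<U> \<rho>" shows "refining_system (\<lambda>n. \<U> n - {{}}) \<rho>"
proof
  fix n
  have uc: "uniform_covering S (\<U> n)" and r: "\<forall>U\<in>\<U> n. \<rho> n U \<in> \<U> (Suc n) \<and> U \<subseteq> \<rho> n U"
    using assms[unfolded coarsening_system_def, THEN conjunct1]
      assms[unfolded coarsening_system_def, THEN conjunct2, THEN conjunct2] by simp_all
  have cov: "\<Union>(\<U> n) = S" and cpt: "\<forall>U\<in>\<U> n. compact (S \<inter> closure U)"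
    and fin: "\<forall>B\<subseteq>S. bounded B \<longrightarrow> finite {U \<in> \<U> n. U \<inter> B \<noteq> {}}"
    using uc unfolding uniform_covering_def by simp_all
  show "refinement (\<U> n - {{}}) (\<U> (Suc n) - {{}}) (\<rho> n)" using r by (auto simp: refinement_def)
  show "lf_family (\<U> n - {{}})" unfolding lf_family_def
  proof (intro conjI ballI allI impI)
    fix U assume U: "U \<in> \<U> n - {{}}"
    then have "compact (S \<inter> closure U)" "U \<subseteq> S" using cov cpt by auto
    then have "bounded (S \<inter> closure U)" "U \<subseteq> S \<inter> closure U"
      using closure_subset[of U] by (auto intro: compact_imp_bounded)
    then show "bounded U" by (rule bounded_subset)
    show "U \<noteq> {}" using U by simp
  next
    fix B :: "'a set" assume "bounded B"
    then have "bounded (B \<inter> S)" by (rule bounded_subset) simp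
    then have "finite {U \<in> \<U> n. U \<inter> (B \<inter> S) \<noteq> {}}"
      using fin[rule_format, of "B \<inter> S"] by simp
    moreover have "{U \<in> \<U> n - {{}}. U \<inter> B \<noteq> {}} \<subseteq> {U \<in> \<U> n. U \<inter> (B \<inter> S) \<noteq> {}}"
      using cov by auto
    ultimately show "finite {U \<in> \<U> n - {{}}. U \<inter> B \<noteq> {}}" by (rule finite_subset[rotated])
  qed
qed

section \<open>Classes in the direct limit of homology groups\<close>

locale coarse_system =
  fixes p :: nat and S :: "'a::metric_space set" and \<U>0 :: "nat \<Rightarrow> 'a set set" and \<rho>
  assumes cs: "coarsening_system S \<U>0 \<rho>" and p: "p > 1"
begin

sublocale refining_system "\<lambda>n. \<U>0 n - {{}}" \<rho> by (rule coarsening_refining[OF cs])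

lemma br: "bridge p (\<U>0 n)" by standard (use p lfin in auto)

definition lim_rel where
  "lim_rel q = direct_limit_rel (\<lambda>n. lf_homology p (nerve (\<U>0 n)) q)
     (\<lambda>n. lf_homology_map p (nerve (\<U>0 (Suc n))) q (\<rho> n))"

abbreviation pts where "pts q \<equiv> (SIGMA n:UNIV. carrier (lf_homology p (nerve (\<U>0 n)) q))"

lemma carrier_coarse_homology: "carrier (coarse_homology p \<U>0 \<rho> q) = pts q // lim_rel q"
  by (simp add: coarse_homology_def direct_limit_def lim_rel_def)

lemma pts_iff: "(n, x) \<in> pts q \<longleftrightarrow> (\<exists>c\<in>lf_cycles p (nerve (\<U>0 n)) q. x = bridge.coset p (\<U>0 n) q c)"
  using bridge.homology_carrier[OF br[of n], of q] by auto

lemma fold_homology_map: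
  assumes "n \<le> k" and c: "c \<in> lf_cycles p (nerve (\<U>0 n)) q"
  shows "\<exists>c'\<in>lf_cycles p (nerve (\<U>0 k)) q. scale p c' = trp n k (scale p c) \<and>
    fold (\<lambda>n. lf_homology_map p (nerve (\<U>0 (Suc n))) q (\<rho> n)) [n..<k] (bridge.coset p (\<U>0 n) q c)
      = bridge.coset p (\<U>0 k) q c'"
  using assms(1)
proof (induction k rule: dec_induct)
  case base
  have "scale p c \<in> chains p (\<U>0 n - {{}}) q"
    using c bridge.J_chains[OF br[of n]] bridge.lf_cycles_iff[OF br[of n]] by blast
  then show ?case using c trp_self[of "scale p c" p n q] by (intro bexI[of _ c]) auto
next
  case (step k)
  then obtain c' where c': "c' \<in> lf_cycles p (nerve (\<U>0 k)) q" "scale p c' = trp n k (scale p c)"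
    "fold (\<lambda>n. lf_homology_map p (nerve (\<U>0 (Suc n))) q (\<rho> n)) [n..<k] (bridge.coset p (\<U>0 n) q c)
      = bridge.coset p (\<U>0 k) q c'" by blast
  have f: "simp_map (\<U>0 k - {{}}) (\<U>0 (Suc k) - {{}}) (\<rho> k)" using tr_simp_map[of k "Suc k"] by simp
  have c'2: "c' \<in> lf_chains p (nerve (\<U>0 k)) q" using c'(1) bridge.lf_cycles_iff[OF br] by blast
  have "push (\<U>0 k - {{}}) (\<rho> k) (scale p c') = trp n (Suc k) (scale p c)"
    using trp_trp[of n k "Suc k" "scale p c"] step(1) c'(2) by (simp add: trp_def)
  then have "scale p (lf_chain_map p (\<rho> k) c') = trp n (Suc k) (scale p c)"
    using scale_chain_map[OF br br f c'2] by simp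
  moreover have "lf_chain_map p (\<rho> k) c' \<in> lf_cycles p (nerve (\<U>0 (Suc k))) q"
    by (rule chain_map_cycles[OF br br f c'(1)])
  ultimately show ?case using c'(3) step(1) homology_map_coset[OF br br f c'2]
    by (intro bexI[of _ "lf_chain_map p (\<rho> k) c'"]) auto
qed

lemma lim_rel_iff:
  assumes c: "c \<in> lf_cycles p (nerve (\<U>0 n)) q" and c': "c' \<in> lf_cycles p (nerve (\<U>0 n')) q"
  shows "((n, bridge.coset p (\<U>0 n) q c), (n', bridge.coset p (\<U>0 n') q c')) \<in> lim_rel q \<longleftrightarrow>
    (\<exists>k\<ge>max n n'. homologous p (\<U>0 k - {{}}) q (trp n k (scale p c)) (trp n' k (scale p c')))"
proof -
  let ?F = "\<lambda>n. lf_homology_map p (nerve (\<U>0 (Suc n))) q (\<rho> n)"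
  have "(n, bridge.coset p (\<U>0 n) q c) \<in> pts q" "(n', bridge.coset p (\<U>0 n') q c') \<in> pts q"
    using c c' pts_iff by blast+
  then have "((n, bridge.coset p (\<U>0 n) q c), (n', bridge.coset p (\<U>0 n') q c')) \<in> lim_rel q \<longleftrightarrow>
    (\<exists>k\<ge>max n n'. fold ?F [n..<k] (bridge.coset p (\<U>0 n) q c) = fold ?F [n'..<k] (bridge.coset p (\<U>0 n') q c'))"
    by (simp add: lim_rel_def direct_limit_rel_def)
  moreover have "fold ?F [n..<k] (bridge.coset p (\<U>0 n) q c) = fold ?F [n'..<k] (bridge.coset p (\<U>0 n') q c')
      \<longleftrightarrow> homologous p (\<U>0 k - {{}}) q (trp n k (scale p c)) (trp n' k (scale p c'))" if k: "k \<ge> max n n'" for k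
  proof -
    obtain d where d: "d \<in> lf_cycles p (nerve (\<U>0 k)) q" "scale p d = trp n k (scale p c)"
      "fold ?F [n..<k] (bridge.coset p (\<U>0 n) q c) = bridge.coset p (\<U>0 k) q d"
      using fold_homology_map[OF _ c, of k] k by auto
    obtain d' where d': "d' \<in> lf_cycles p (nerve (\<U>0 k)) q" "scale p d' = trp n' k (scale p c')"
      "fold ?F [n'..<k] (bridge.coset p (\<U>0 n') q c') = bridge.coset p (\<U>0 k) q d'"
      using fold_homology_map[OF _ c', of k] k by auto
    show ?thesis unfolding d(3) d'(3) d(2)[symmetric] d'(2)[symmetric]
      by (rule bridge.coset_eq_iff[OF br]) (use d(1) d'(1) bridge.lf_cycles_iff[OF br] in blast)+
  qed
  ultimately show ?thesis by (metis (no_types, lifting))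
qed

lemma cycle_lift:
  assumes "d \<in> cycles p (\<U>0 n - {{}}) q"
  shows "\<exists>c\<in>lf_cycles p (nerve (\<U>0 n)) q. scale p c = d"
proof -
  obtain c where "c \<in> lf_chains p (nerve (\<U>0 n)) q" "scale p c = d"
    using bridge.J_surj[OF br] assms unfolding cycles_def by blast
  then show ?thesis using assms bridge.lf_cycles_iff[OF br, of c n q] by (intro bexI[of _ c]) auto
qed

lemma class_boundI:
  fixes h :: "_ \<Rightarrow> nat"
  assumes inj: "inj_on h (carrier (coarse_homology p \<U>0 \<rho> q))"
    and bd: "\<And>x. x \<in> carrier (coarse_homology p \<U>0 \<rho> q) \<Longrightarrow> h x < M"
  shows "class_bound TYPE(qz) p q M"
proof -
  define lift where "lift = (\<lambda>n d. SOME c. c \<in> lf_cycles p (nerve (\<U>0 n)) q \<and> scale p c = d)"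
  have lift: "lift n d \<in> lf_cycles p (nerve (\<U>0 n)) q \<and> scale p (lift n d) = d"
    if d: "d \<in> cycles p (\<U>0 n - {{}}) q" for n d
  proof -
    have "\<exists>c. c \<in> lf_cycles p (nerve (\<U>0 n)) q \<and> scale p c = d" using cycle_lift[OF d] by blast
    then show ?thesis unfolding lift_def by (rule someI_ex)
  qed
  define cls where "cls = (\<lambda>n d. lim_rel q `` {(n, bridge.coset p (\<U>0 n) q (lift n d))})"
  have cls: "cls n d \<in> carrier (coarse_homology p \<U>0 \<rho> q)" if d: "d \<in> cycles p (\<U>0 n - {{}}) q" for n d
    unfolding carrier_coarse_homology cls_def
    by (rule quotientI) (use lift[OF d] pts_iff in blast)
  show ?thesis unfolding class_bound_def
  proof (intro exI[of _ "\<lambda>n d. h (cls n d)"] allI ballI conjI impI)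
    fix n n' and c c' :: "'a set list \<Rightarrow> qz"
    assume c: "c \<in> cycles p (\<U>0 n - {{}}) q" and c': "c' \<in> cycles p (\<U>0 n' - {{}}) q"
    show "h (cls n c) < M" by (rule bd[OF cls[OF c]])
    assume "h (cls n c) = h (cls n' c')"
    then have e: "cls n c = cls n' c'" using inj_onD[OF inj _ cls[OF c] cls[OF c']] by blast
    have l: "lift n c \<in> lf_cycles p (nerve (\<U>0 n)) q" "scale p (lift n c) = c"
      "lift n' c' \<in> lf_cycles p (nerve (\<U>0 n')) q" "scale p (lift n' c') = c'"
      using lift[OF c] lift[OF c'] by auto
    have "((n', bridge.coset p (\<U>0 n') q (lift n' c')), (n', bridge.coset p (\<U>0 n') q (lift n' c'))) \<in> lim_rel q"
      unfolding lim_rel_iff[OF l(3) l(3)] using homologous_refl by blast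
    then have "(n', bridge.coset p (\<U>0 n') q (lift n' c')) \<in> cls n' c'" unfolding cls_def by blast
    then have "((n, bridge.coset p (\<U>0 n) q (lift n c)), (n', bridge.coset p (\<U>0 n') q (lift n' c'))) \<in> lim_rel q"
      unfolding e[symmetric] by (simp add: cls_def)
    then show "\<exists>k\<ge>max n n'. homologous p (\<U>0 k - {{}}) q (trp n k c) (trp n' k c')"
      unfolding lim_rel_iff[OF l(1) l(3)] l(2,4) .
  qed
qed

text \<open>If every cycle became a boundary at some later stage, any two representatives would be
  identified and the limit would have a single element.\<close>

lemma nonzero_class:
  assumes two: "x \<in> carrier (coarse_homology p \<U>0 \<rho> q)" "y \<in> carrier (coarse_homology p \<U>0 \<rho> q)" "x \<noteq> y"
  shows "\<exists>n. \<exists>w::'a set list \<Rightarrow> qz. w \<in> cycles p (\<U>0 n - {{}}) q \<and>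
    (\<forall>k\<ge>n. \<not> homologous p (\<U>0 k - {{}}) q (trp n k w) 0)"
proof (rule ccontr)
  assume "\<not> ?thesis"
  then have z: "\<exists>k\<ge>n. homologous p (\<U>0 k - {{}}) q (trp n k w) 0"
    if "w \<in> cycles p (\<U>0 n - {{}}) q" for n and w :: "'a set list \<Rightarrow> qz" using that by blast
  have tot: "(a, b) \<in> lim_rel q" if ab: "a \<in> pts q" "b \<in> pts q" for a b
  proof -
    obtain n x n' y where xy: "a = (n, x)" "b = (n', y)" by (cases a, cases b)
    obtain c where c: "c \<in> lf_cycles p (nerve (\<U>0 n)) q" "x = bridge.coset p (\<U>0 n) q c"
      using ab(1) unfolding xy pts_iff by (elim bexE)
    obtain c' where c': "c' \<in> lf_cycles p (nerve (\<U>0 n')) q" "y = bridge.coset p (\<U>0 n') q c'"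
      using ab(2) unfolding xy pts_iff by (elim bexE)
    have a: "a = (n, bridge.coset p (\<U>0 n) q c)" "c \<in> lf_cycles p (nerve (\<U>0 n)) q"
      and b: "b = (n', bridge.coset p (\<U>0 n') q c')" "c' \<in> lf_cycles p (nerve (\<U>0 n')) q"
      using xy c c' by simp_all
    have cy: "scale p c \<in> cycles p (\<U>0 n - {{}}) q" "scale p c' \<in> cycles p (\<U>0 n' - {{}}) q"
      using c(1) c'(1) bridge.lf_cycles_iff[OF br, of c n q] bridge.lf_cycles_iff[OF br, of c' n' q] by auto
    obtain k where k: "k \<ge> n" "homologous p (\<U>0 k - {{}}) q (trp n k (scale p c)) 0" using z[OF cy(1)] by blast
    obtain k' where k': "k' \<ge> n'" "homologous p (\<U>0 k' - {{}}) q (trp n' k' (scale p c')) 0" using z[OF cy(2)] by blast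
    let ?l = "max k k'"
    have t0: "trp i j 0 = (0 :: 'a set list \<Rightarrow> qz)" for i j by (rule additive.zero[OF additive_trp])
    have h1: "homologous p (\<U>0 ?l - {{}}) q (trp n ?l (scale p c)) 0"
      using trp_homologous[OF max.cobounded1 k(2), of k'] trp_trp[OF k(1) max.cobounded1, of k' "scale p c"] t0 by simp
    have h2: "homologous p (\<U>0 ?l - {{}}) q (trp n' ?l (scale p c')) 0"
      using trp_homologous[OF max.cobounded2 k'(2), of k] trp_trp[OF k'(1) max.cobounded2, of k "scale p c'"] t0 by simp
    have "homologous p (\<U>0 ?l - {{}}) q (trp n ?l (scale p c)) (trp n' ?l (scale p c'))"
      by (rule homologous_trans[OF h1 homologous_sym[OF h2]])
    moreover have "?l \<ge> max n n'" using k(1) k'(1) by auto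
    ultimately show ?thesis unfolding a(1) b(1) lim_rel_iff[OF a(2) b(2)] by blast
  qed
  define P where "P = pts q"
  have sub: "lim_rel q \<subseteq> P \<times> P" by (auto simp: lim_rel_def direct_limit_rel_def P_def)
  have im: "lim_rel q `` {a} = P" if a: "a \<in> P" for a
  proof
    show "lim_rel q `` {a} \<subseteq> P" using sub by auto
    show "P \<subseteq> lim_rel q `` {a}"
    proof
      fix b assume "b \<in> P"
      from tot[folded P_def, OF a this] show "b \<in> lim_rel q `` {a}" by (rule ImageI) simp
    qed
  qed
  have eq: "z = P" if z: "z \<in> P // lim_rel q" for z
  proof -
    from z obtain a where "z = lim_rel q `` {a}" "a \<in> P" by (rule quotientE)
    then show ?thesis using im by simp
  qed
  have "carrier (coarse_homology p \<U>0 \<rho> q) = P // lim_rel q"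
    unfolding P_def by (rule carrier_coarse_homology)
  note two' = two(1,2)[unfolded this]
  show False by (rule notE[OF two(3)]) (rule trans[OF eq[OF two'(1)] eq[OF two'(2), symmetric]])
qed

end

text \<open>Collects the two aspects of a coarse homology sphere on which the argument rests: few
  classes in every degree, read off from a bijection with residues, and one class in degree
  \<open>m\<close> that survives to every stage.\<close>

lemma sphere_system:
  assumes "p > 1" "coarse_homology_sphere p m S"
  shows "\<exists>\<U> \<rho>. coarsening_system S \<U> \<rho> \<and> refining_system (\<lambda>n. \<U> n - {{}}) \<rho> \<and>
    (\<forall>q. refining_system.class_bound (\<lambda>n. \<U> n - {{}}) \<rho> TYPE(qz) p q (if q = m then p else 1)) \<and>
    (\<exists>n. \<exists>w::'a::metric_space set list \<Rightarrow> qz. w \<in> cycles p (\<U> n - {{}}) m \<and>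
      (\<forall>k\<ge>n. \<not> homologous p (\<U> k - {{}}) m (refining_system.trp (\<lambda>n. \<U> n - {{}}) \<rho> n k w) 0))"
proof -
  obtain \<U> \<rho> where cs: "coarsening_system S \<U> \<rho>"
    and hm: "coarse_homology p \<U> \<rho> m \<cong> integer_mod_group p"
    and ho: "\<And>q. q \<noteq> m \<Longrightarrow> trivial_group (coarse_homology p \<U> \<rho> q)"
    using assms(2)[unfolded coarse_homology_sphere_def, THEN conjunct2]
    by (elim exE conjE) (rule that, assumption+, elim allE impE, assumption+)
  interpret coarse_system p S \<U> \<rho> by standard (use cs assms in auto)
  obtain h where h: "bij_betw h (carrier (coarse_homology p \<U> \<rho> m)) (carrier (integer_mod_group p))"
    using hm by (auto simp: is_iso_def iso_def)
  have cp: "carrier (integer_mod_group p) = {0..<int p}" using assms(1) by (simp add: carrier_integer_mod_group)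
  have "class_bound TYPE(qz) p q (if q = m then p else 1)" for q
  proof (cases "q = m")
    case True
    have "inj_on (nat \<circ> h) (carrier (coarse_homology p \<U> \<rho> m))"
      using h unfolding cp bij_betw_def by (intro comp_inj_on) (auto simp: inj_on_def)
    moreover have "(nat \<circ> h) x < p" if "x \<in> carrier (coarse_homology p \<U> \<rho> m)" for x
      using bij_betwE[OF h] that assms(1) unfolding cp by fastforce
    ultimately show ?thesis using class_boundI[where q = m and h = "nat \<circ> h" and M = p] True by simp
  next
    case False
    have "carrier (coarse_homology p \<U> \<rho> q) = {\<one>\<^bsub>coarse_homology p \<U> \<rho> q\<^esub>}"
      using ho[OF False] by (simp add: trivial_group_def)
    then show ?thesis using class_boundI[where q = q and h = "\<lambda>_. 0" and M = 1] False by simp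
  qed
  moreover obtain x y where "x \<in> carrier (coarse_homology p \<U> \<rho> m)" "y \<in> carrier (coarse_homology p \<U> \<rho> m)" "x \<noteq> y"
  proof -
    have 01: "0 \<in> h ` carrier (coarse_homology p \<U> \<rho> m)" "1 \<in> h ` carrier (coarse_homology p \<U> \<rho> m)"
      using h assms(1) unfolding bij_betw_def cp by simp_all
    obtain x where x: "h x = 0" "x \<in> carrier (coarse_homology p \<U> \<rho> m)" using 01(1) by (rule imageE) simp
    obtain y where y: "h y = 1" "y \<in> carrier (coarse_homology p \<U> \<rho> m)" using 01(2) by (rule imageE) simp
    have "x \<noteq> y" using x(1) y(1) by auto
    then show thesis using that x(2) y(2) by simp
  qed
  note w = nonzero_class[OF this]
  ultimately show ?thesis
    by (intro exI[of _ \<U>] exI[of _ \<rho>] conjI cs coarsening_refining[OF cs] w allI)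
qed

section \<open>Equivariant coarsening systems\<close>

definition thick :: "nat \<Rightarrow> 'a::metric_space set \<Rightarrow> 'a set" where
  "thick k U = {z. \<exists>w\<in>U. dist z w \<le> real k}"

lemma thick_self: "U \<subseteq> thick k U"
proof
  fix x assume "x \<in> U"
  then show "x \<in> thick k U" unfolding thick_def by (intro CollectI bexI[of _ x]) simp_all
qed

text \<open>Here \<open>V n t\<close> is colour \<open>t\<close> at stage \<open>n\<close>. The
  margin in \<open>V_step\<close> grows with \<open>n\<close>, which is what makes vertices of
  bounded displacement fixed eventually, and \<open>V_leb\<close> makes the system comparable with
  every coarsening system.\<close>

locale eq_system = isometry_group \<Gamma> for \<Gamma> :: "('a::metric_space \<Rightarrow> 'a) set" +
  fixes V :: "nat \<Rightarrow> nat \<Rightarrow> 'a set set" and D :: "nat \<Rightarrow> real" and N :: nat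
  assumes V_inv: "t < N \<Longrightarrow> U \<in> V n t \<Longrightarrow> g \<in> \<Gamma> \<Longrightarrow> g ` U \<in> V n t"
    and V_disj: "t < N \<Longrightarrow> U \<in> V n t \<Longrightarrow> U' \<in> V n t \<Longrightarrow> U \<inter> U' \<noteq> {} \<Longrightarrow> U = U'"
    and V_ne: "t < N \<Longrightarrow> U \<in> V n t \<Longrightarrow> U \<noteq> {}"
    and V_diam: "t < N \<Longrightarrow> U \<in> V n t \<Longrightarrow> x \<in> U \<Longrightarrow> y \<in> U \<Longrightarrow> dist x y \<le> D n"
    and V_fin: "t < N \<Longrightarrow> bounded B \<Longrightarrow> finite {U \<in> V n t. U \<inter> B \<noteq> {}}"
    and V_step: "t < N \<Longrightarrow> U \<in> V n t \<Longrightarrow> \<exists>t'<N. \<exists>U'\<in>V (Suc n) t'. thick n U \<subseteq> U'"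
    and V_leb: "\<exists>n0. \<forall>n\<ge>n0. \<forall>x. \<exists>t<N. \<exists>U\<in>V n t. cball x R \<subseteq> U"
begin

definition Vs where "Vs n = (\<Union>t<N. V n t)"

text \<open>
  Choosing the least colour makes the refinement equivariant: the target is unique once its
  colour is fixed, because members of one colour are disjoint.
\<close>

definition col where "col n U = (LEAST t. t < N \<and> (\<exists>U'\<in>V (Suc n) t. thick n U \<subseteq> U'))"

definition ref_map where "ref_map n U = (THE U'. U' \<in> V (Suc n) (col n U) \<and> thick n U \<subseteq> U')"

lemma Vs_iff: "U \<in> Vs n \<longleftrightarrow> (\<exists>t<N. U \<in> V n t)" by (auto simp: Vs_def)

lemma col_props:
  assumes "U \<in> Vs n" shows "col n U < N" "\<exists>U'\<in>V (Suc n) (col n U). thick n U \<subseteq> U'"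
proof -
  have "\<exists>t. t < N \<and> (\<exists>U'\<in>V (Suc n) t. thick n U \<subseteq> U')" using assms V_step Vs_iff by meson
  from LeastI_ex[OF this] show "col n U < N" "\<exists>U'\<in>V (Suc n) (col n U). thick n U \<subseteq> U'"
    unfolding col_def[symmetric] by auto
qed

lemma ref_map_unique:
  assumes U: "U \<in> Vs n" and W: "W \<in> V (Suc n) (col n U)" "thick n U \<subseteq> W"
  shows "ref_map n U = W"
  unfolding ref_map_def
proof (rule the_equality)
  fix W' assume W': "W' \<in> V (Suc n) (col n U) \<and> thick n U \<subseteq> W'"
  obtain t where "t < N" "U \<in> V n t" using U by (auto simp: Vs_iff)
  then have "U \<noteq> {}" by (rule V_ne)
  then have "W' \<inter> W \<noteq> {}" using W W' thick_self[of U n] by auto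
  then show "W' = W" using V_disj[OF col_props(1)[OF U]] W W' by blast
qed (use W in simp)

lemma ref_map_props:
  assumes "U \<in> Vs n"
  shows "ref_map n U \<in> V (Suc n) (col n U)" "thick n U \<subseteq> ref_map n U" "ref_map n U \<in> Vs (Suc n)"
proof -
  obtain W where W: "W \<in> V (Suc n) (col n U)" "thick n U \<subseteq> W" using col_props(2)[OF assms] by blast
  have e: "ref_map n U = W" by (rule ref_map_unique[OF assms W])
  show "ref_map n U \<in> V (Suc n) (col n U)" "thick n U \<subseteq> ref_map n U" using W e by simp_all
  then show "ref_map n U \<in> Vs (Suc n)" using col_props(1)[OF assms] Vs_iff by blast
qed

lemma thick_image: assumes "g \<in> \<Gamma>" shows "thick k (g ` U) = g ` thick k U"
proof
  obtain h where h: "h \<in> \<Gamma>" "g \<circ> h = id" using inv_G[OF assms] by blast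
  show "g ` thick k U \<subseteq> thick k (g ` U)" using isom_G[OF assms] by (auto simp: thick_def)
  show "thick k (g ` U) \<subseteq> g ` thick k U"
  proof
    fix z assume "z \<in> thick k (g ` U)"
    then obtain w where w: "w \<in> U" "dist z (g w) \<le> real k" by (auto simp: thick_def)
    have z: "g (h z) = z" using h(2) by (simp add: fun_eq_iff)
    have "dist (h z) w \<le> real k" using w(2) isom_G[OF assms, of "h z" w] unfolding z by simp
    then have "h z \<in> thick k U" using w(1) by (auto simp: thick_def)
    then show "z \<in> g ` thick k U" using z by (metis imageI)
  qed
qed

lemma Vs_inv: "U \<in> Vs n \<Longrightarrow> g \<in> \<Gamma> \<Longrightarrow> g ` U \<in> Vs n"
  using V_inv by (auto simp: Vs_iff)

lemma cover_image:
  assumes g: "g \<in> \<Gamma>" and t: "t < N" and ex: "\<exists>U'\<in>V (Suc n) t. thick n U \<subseteq> U'"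
  shows "\<exists>U'\<in>V (Suc n) t. thick n (g ` U) \<subseteq> U'"
proof -
  obtain U' where U': "U' \<in> V (Suc n) t" "thick n U \<subseteq> U'" using ex by blast
  have "thick n (g ` U) \<subseteq> g ` U'" unfolding thick_image[OF g] using U'(2) by (rule image_mono)
  then show ?thesis using V_inv[OF t U'(1) g] by blast
qed

lemma col_image: assumes g: "g \<in> \<Gamma>" shows "col n (g ` U) = col n U"
proof -
  obtain h where h: "h \<in> \<Gamma>" "h \<circ> g = id" using inv_G[OF g] by blast
  then have "h ` g ` U = U" by (simp add: image_comp)
  then have "(t < N \<and> (\<exists>U'\<in>V (Suc n) t. thick n (g ` U) \<subseteq> U')) = (t < N \<and> (\<exists>U'\<in>V (Suc n) t. thick n U \<subseteq> U'))" for t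
    using cover_image[OF g, of t n U] cover_image[OF h(1), of t n "g ` U"] by auto
  then show ?thesis unfolding col_def by simp
qed

lemma ref_map_image:
  assumes U: "U \<in> Vs n" and g: "g \<in> \<Gamma>" shows "ref_map n (g ` U) = g ` ref_map n U"
proof (rule ref_map_unique[OF Vs_inv[OF U g]])
  show "g ` ref_map n U \<in> V (Suc n) (col n (g ` U))"
    unfolding col_image[OF g] by (rule V_inv[OF col_props(1)[OF U] ref_map_props(1)[OF U] g])
  show "thick n (g ` U) \<subseteq> g ` ref_map n U"
    unfolding thick_image[OF g] by (rule image_mono[OF ref_map_props(2)[OF U]])
qed

lemma lf_family_Vs: "lf_family (Vs n)"
  unfolding lf_family_def
proof (intro conjI ballI allI impI)
  fix U assume "U \<in> Vs n"
  then obtain t where t: "t < N" "U \<in> V n t" by (auto simp: Vs_iff)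
  show "U \<noteq> {}" by (rule V_ne[OF t])
  then obtain x where "x \<in> U" by auto
  then show "bounded U" using V_diam[OF t] unfolding bounded_def by blast
next
  fix B :: "'a set" assume B: "bounded B"
  have "finite (\<Union>t<N. {U \<in> V n t. U \<inter> B \<noteq> {}})" using V_fin[OF _ B] by auto
  then show "finite {U \<in> Vs n. U \<inter> B \<noteq> {}}" by (rule finite_subset[rotated]) (auto simp: Vs_iff)
qed

lemma refinement_Vs: "refinement (Vs n) (Vs (Suc n)) (ref_map n)"
  unfolding refinement_def using ref_map_props thick_self by blast

sublocale refining_system Vs ref_map
  by standard (rule lf_family_Vs, rule refinement_Vs)

lemma tr_image: "n \<le> k \<Longrightarrow> U \<in> Vs n \<Longrightarrow> g \<in> \<Gamma> \<Longrightarrow> tr n k (g ` U) = g ` tr n k U"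
proof (induction k rule: dec_induct)
  case (step k)
  have "tr n k U \<in> Vs k" using tr_refinement[OF step(1)] step.prems(1) by (auto simp: refinement_def)
  then show ?case using step ref_map_image by simp
qed simp

text \<open>The group preserves colours, and members of one colour that meet are equal.\<close>

lemma same_colour:
  assumes "U \<in> Vs n" "g \<in> \<Gamma>" "g ` U \<inter> U \<noteq> {}" shows "g ` U = U"
proof -
  obtain t where "t < N" "U \<in> V n t" using assms by (auto simp: Vs_iff)
  then show ?thesis using V_disj[of t "g ` U" n U] V_inv[of t U n g] assms by blast
qed

text \<open>Vertices of a simplex have a common point, so a vertex and its translate in the same
  simplex meet and must coincide. Setwise stabilisers of simplices are therefore pointwise, without
  subdividing the nerve.\<close>

lemma simplex_fixed:
  assumes s: "\<sigma> \<subseteq> Vs n" "\<Inter>\<sigma> \<noteq> {}" and g: "g \<in> \<Gamma>" "(`) g ` \<sigma> = \<sigma>" and U: "U \<in> \<sigma>"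
  shows "g ` U = U"
proof (rule same_colour[OF _ g(1)])
  show "U \<in> Vs n" using s U by blast
  have "g ` U \<in> \<sigma>" using g(2) U by blast
  then show "g ` U \<inter> U \<noteq> {}" using s(2) U by blast
qed

text \<open>Vertices of a simplex pairwise meet and hence have different colours, so there are at
  most \<open>N\<close> of them, while degree \<open>q\<close> requires
  \<open>Suc q\<close>.\<close>

lemma chains_top_0:
  assumes c: "c \<in> chains p (Vs n) q" and q: "N \<le> q" shows "c = 0"
proof (rule ccontr)
  assume "c \<noteq> 0"
  then obtain vs where vs: "c vs \<noteq> 0" by (auto simp: fun_eq_iff)
  have "distinct vs" using alternating_not_distinct[OF chains_alternating[OF c]] vs by blast
  moreover have s: "length vs = Suc q" "set vs \<subseteq> Vs n" "\<Inter>(set vs) \<noteq> {}" using chains_supp[OF c vs] by auto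
  ultimately have card: "card (set vs) = Suc q" by (simp add: distinct_card)
  define colour where "colour = (\<lambda>U. SOME t. t < N \<and> U \<in> V n t)"
  have colour: "colour U < N \<and> U \<in> V n (colour U)" if "U \<in> set vs" for U
  proof -
    have "\<exists>t. t < N \<and> U \<in> V n t" using s(2) that Vs_iff by blast
    then show ?thesis unfolding colour_def by (rule someI_ex)
  qed
  have "inj_on colour (set vs)"
  proof (rule inj_onI)
    fix U U' assume U: "U \<in> set vs" "U' \<in> set vs" "colour U = colour U'"
    have "U \<inter> U' \<noteq> {}" using s(3) U by blast
    show "U = U'"
      by (rule V_disj[of "colour U" U n U']) (use colour[OF U(1)] colour[OF U(2)] U(3) \<open>U \<inter> U' \<noteq> {}\<close> in simp_all)
  qed
  moreover have "colour ` set vs \<subseteq> {..<N}" using colour by blast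
  ultimately have "card (set vs) \<le> N" using card_inj_on_le[of colour "set vs" "{..<N}"] by simp
  then show False using card q by simp
qed

definition Fx where "Fx n = {U \<in> Vs n. \<forall>g\<in>\<Gamma>. g ` U = U}"

lemma Fx_sub: "Fx n \<subseteq> Vs n" by (auto simp: Fx_def)

lemma ref_map_Fx: assumes U: "U \<in> Fx n" shows "ref_map n U \<in> Fx (Suc n)"
proof -
  have V: "U \<in> Vs n" using U by (simp add: Fx_def)
  have "g ` ref_map n U = ref_map n U" if g: "g \<in> \<Gamma>" for g
    using ref_map_image[OF V g] U g by (simp add: Fx_def)
  then show ?thesis using ref_map_props(3)[OF V] by (simp add: Fx_def)
qed

sublocale F: refining_system Fx ref_map
proof
  show "lf_family (Fx n)" for n by (rule lf_family_subset[OF lf_family_Vs Fx_sub])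
  show "refinement (Fx n) (Fx (Suc n)) (ref_map n)" for n
    using ref_map_Fx refinement_Vs Fx_sub unfolding refinement_def by blast
qed

lemma Fx_chains: "c \<in> chains p (Fx n) q \<Longrightarrow> c \<in> chains p (Vs n) q"
  using Fx_sub unfolding chains_def by blast

lemma Fx_trp:
  assumes nk: "n \<le> k" and c: "c \<in> chains p (Fx n) q" shows "F.trp n k c = trp n k c"
  unfolding F.trp_def trp_def
  by (rule ext, rule push_restrict[symmetric, OF Fx_sub])
     (use simp_map_fin[OF tr_simp_map[OF nk]] chains_supp[OF c] in auto)

lemma Fx_boundary:
  assumes c: "c \<in> chains p (Fx n) q" shows "boundary (nbr (Fx n)) c = boundary (nbr (Vs n)) c"
proof
  fix vs show "boundary (nbr (Fx n)) c vs = boundary (nbr (Vs n)) c vs"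
  proof (cases vs)
    case (Cons v ys)
    show ?thesis
    proof (cases "v \<in> Fx n")
      case True
      then have "finite (nbr (Fx n) v)" using F.lfin by (simp add: locfin_def)
      from boundary_eq[OF Fx_chains[OF c] lfin this, of v ys] chains_nbr[OF c]
      show ?thesis using Cons by simp
    next
      case False
      then have "c (u # v # ys) = 0" for u using chains_nbr[OF c] by blast
      then show ?thesis using Cons by simp
    qed
  qed simp
qed

text \<open>The refinement out of stage \<open>k\<close> swallows a neighbourhood of radius
  \<open>k\<close>. Once \<open>k\<close> exceeds the displacement of \<open>x\<close>, the image
  contains both \<open>x\<close> and \<open>g x\<close>, so it meets its translate and is
  invariant.\<close>

lemma fixed_later:
  assumes U: "U \<in> Vs n" "x \<in> U" and K: "\<And>g. g \<in> \<Gamma> \<Longrightarrow> dist x (g x) \<le> K" and k: "K \<le> real k" "n \<le> k"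
  shows "tr n (Suc k) U \<in> Fx (Suc k)"
proof -
  define W where "W = tr n k U"
  have W: "W \<in> Vs k" "x \<in> W" using tr_refinement[OF k(2)] U by (auto simp: refinement_def W_def)
  have W': "ref_map k W \<in> Vs (Suc k)" "thick k W \<subseteq> ref_map k W" using ref_map_props[OF W(1)] by auto
  have "g ` ref_map k W = ref_map k W" if g: "g \<in> \<Gamma>" for g
  proof (rule same_colour[OF W'(1) g])
    have "dist (g x) x \<le> real k" using K[OF g] k(1) by (simp add: dist_commute)
    then have "g x \<in> ref_map k W" using W(2) W'(2) by (auto simp: thick_def)
    moreover have "x \<in> ref_map k W" using W(2) W'(2) thick_self[of W k] by blast
    ultimately show "g ` ref_map k W \<inter> ref_map k W \<noteq> {}" by blast
  qed
  then show ?thesis using W'(1) k(2) by (simp add: Fx_def W_def)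
qed

end

lemma (in isometry_group) eq_system_exists:
  assumes proper: "proper_space (UNIV :: 'a set)" and asd: "finite_asdim (UNIV :: 'a set)"
  shows "\<exists>V D N. eq_system \<Gamma> V D N"
proof -
  obtain l where l: "asdim_le (UNIV :: 'a set) l" using asd unfolding finite_asdim_def by blast
  define N where "N = Suc (Suc l * card \<Gamma>)"
  define good where "good = (\<lambda>r (V :: nat \<Rightarrow> 'a set set) D.
      (\<forall>t<N. \<forall>U\<in>V t. \<forall>g\<in>\<Gamma>. g ` U \<in> V t) \<and>
      (\<forall>t<N. \<forall>U\<in>V t. \<forall>U'\<in>V t. U \<inter> U' \<noteq> {} \<longrightarrow> U = U') \<and>
      (\<forall>t<N. \<forall>U\<in>V t. U \<noteq> {} \<and> (\<forall>x\<in>U. \<forall>y\<in>U. dist x y \<le> D)) \<and>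
      (\<forall>t<N. \<forall>B. bounded B \<longrightarrow> finite {U \<in> V t. U \<inter> B \<noteq> {}}) \<and>
      (\<forall>x. \<exists>t<N. \<exists>U\<in>V t. cball x r \<subseteq> U))"
  have ex: "\<exists>V D. good r V D" if "r > 0" for r
    unfolding good_def N_def by (rule equivariant_cover[OF proper l that])
  define V0 where "V0 = (\<lambda>r. SOME V. \<exists>D. good r V D)"
  define D0 where "D0 = (\<lambda>r. SOME D. good r (V0 r) D)"
  have good: "good r (V0 r) (D0 r)" if "r > 0" for r
  proof -
    have "\<exists>D. good r (V0 r) D" unfolding V0_def by (rule someI_ex[OF ex[OF that]])
    then show ?thesis unfolding D0_def by (rule someI_ex)
  qed
  \<comment> \<open>Chosen so that a ball of the next radius about any point of a member
    \<open>U\<close> contains \<open>thick n U\<close>: the diameter bound covers \<open>U\<close>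
    and the summand \<open>real n\<close> covers the margin. The radii also tend to infinity, which
    yields \<open>V_leb\<close>.\<close>
  define rad where "rad = rec_nat (1::real) (\<lambda>n r. r + \<bar>D0 r\<bar> + real n + 1)"
  have rad: "rad 0 = 1" "rad (Suc n) = rad n + \<bar>D0 (rad n)\<bar> + real n + 1" for n by (simp_all add: rad_def)
  have rad_ge: "rad n \<ge> real n + 1" for n by (induction n) (simp_all add: rad)
  then have pos: "rad n > 0" for n using rad_ge[of n] by linarith
  note g = good[OF pos, unfolded good_def]
  have g1: "\<forall>t<N. \<forall>U\<in>V0 (rad n) t. \<forall>g\<in>\<Gamma>. g ` U \<in> V0 (rad n) t" for n using g[of n] by (rule conjunct1)
  have g2: "\<forall>t<N. \<forall>U\<in>V0 (rad n) t. \<forall>U'\<in>V0 (rad n) t. U \<inter> U' \<noteq> {} \<longrightarrow> U = U'" for n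
    using g[of n, THEN conjunct2] by (rule conjunct1)
  have g3: "\<forall>t<N. \<forall>U\<in>V0 (rad n) t. U \<noteq> {} \<and> (\<forall>x\<in>U. \<forall>y\<in>U. dist x y \<le> D0 (rad n))" for n
    using g[of n, THEN conjunct2, THEN conjunct2] by (rule conjunct1)
  have g4: "\<forall>t<N. \<forall>B. bounded B \<longrightarrow> finite {U \<in> V0 (rad n) t. U \<inter> B \<noteq> {}}" for n
    using g[of n, THEN conjunct2, THEN conjunct2, THEN conjunct2] by (rule conjunct1)
  have g5: "\<forall>x. \<exists>t<N. \<exists>U\<in>V0 (rad n) t. cball x (rad n) \<subseteq> U" for n
    using g[of n, THEN conjunct2, THEN conjunct2, THEN conjunct2] by (rule conjunct2)
  have "eq_system \<Gamma> (\<lambda>n. V0 (rad n)) (\<lambda>n. D0 (rad n)) N"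
  proof
    fix t n U assume t: "t < N" and U: "U \<in> V0 (rad n) t"
    show "g ` U \<in> V0 (rad n) t" if "g \<in> \<Gamma>" for g using g1 t U that by blast
    show "U = U'" if "U' \<in> V0 (rad n) t" "U \<inter> U' \<noteq> {}" for U' using g2[of n] t U that by blast
    show ne: "U \<noteq> {}" using g3[of n] t U by blast
    show d: "dist x y \<le> D0 (rad n)" if "x \<in> U" "y \<in> U" for x y using g3[of n] t U that by blast
    obtain x where x: "x \<in> U" using ne by auto
    have "thick n U \<subseteq> cball x (rad (Suc n))"
    proof
      fix z assume "z \<in> thick n U"
      then obtain w where w: "w \<in> U" "dist z w \<le> real n" by (auto simp: thick_def)
      have "dist x z \<le> dist x w + dist z w" by (metis dist_triangle dist_commute)
      then show "z \<in> cball x (rad (Suc n))" using d[OF x w(1)] w(2) pos[of n] unfolding rad mem_cball by linarith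
    qed
    then show "\<exists>t'<N. \<exists>U'\<in>V0 (rad (Suc n)) t'. thick n U \<subseteq> U'" using g5[of "Suc n"] by (meson subset_trans)
  next
    fix t n and B :: "'a set" assume "t < N" "bounded B"
    then show "finite {U \<in> V0 (rad n) t. U \<inter> B \<noteq> {}}" using g4[of n] by blast
  next
    fix R :: real
    obtain n0 :: nat where n0: "R \<le> real n0" using real_arch_simple by blast
    have "\<exists>t<N. \<exists>U\<in>V0 (rad n) t. cball x R \<subseteq> U" if "n0 \<le> n" for n and x :: 'a
    proof -
      have "R \<le> rad n" using n0 rad_ge[of n] that by linarith
      then have "cball x R \<subseteq> cball x (rad n)" by auto
      then show ?thesis using g5[of n] by (meson subset_trans)
    qed
    then show "\<exists>n0. \<forall>n\<ge>n0. \<forall>x. \<exists>t<N. \<exists>U\<in>V0 (rad n) t. cball x R \<subseteq> U" by blast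
  qed
  then show ?thesis by blast
qed

text \<open>Translation by the inverse of \<open>g\<close>, written as precomposition so that no sum
  over fibres appears. For the commuting maps considered below the reversed order of composition is
  harmless.\<close>

definition pull :: "('v \<Rightarrow> 'v) \<Rightarrow> ('v list \<Rightarrow> 'k) \<Rightarrow> 'v list \<Rightarrow> 'k" where
  "pull g c vs = c (map g vs)"

lemma additive_pull: "additive_map (pull g)"
  by (rule additive.intro) (simp add: fun_eq_iff pull_def)

lemma funpow_pull: "(pull g ^^ k) c = pull (g ^^ k) c"
proof (induction k)
  case (Suc k)
  have "(pull g ^^ Suc k) c = pull g (pull (g ^^ k) c)" by (simp add: Suc)
  also have "\<dots> = pull (g ^^ Suc k) c" by (simp add: pull_def fun_eq_iff funpow_swap1 o_def)
  finally show ?case .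
qed (simp add: pull_def fun_eq_iff)

lemma alternating_pull: assumes "alternating c" shows "alternating (pull g c)"
  unfolding alternating_def[of "pull g c"] pull_def map_append list.map
proof (intro conjI allI)
  show "c (map g xs @ g u # g v # map g ys) = - c (map g xs @ g v # g u # map g ys)" for xs u v ys
    by (rule alternating_swap[OF assms])
  show "c (map g xs @ g u # g u # map g ys) = 0" for xs u ys by (rule alternating_repeat[OF assms])
qed

lemma push_pull:
  assumes bij: "bij_betw g V V" and inj: "inj g'" and fg: "\<And>v. v \<in> V \<Longrightarrow> f (g v) = g' (f v)"
  shows "push V f (pull g c) ws = push V f c (map g' ws)"
proof (induction ws arbitrary: c)
  case (Cons w ws)
  have "{v \<in> V. f v = g' w} = g ` {v \<in> V. f v = w}"
  proof
    show "g ` {v \<in> V. f v = w} \<subseteq> {v \<in> V. f v = g' w}" using fg bij_betwE[OF bij] by auto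
    show "{v \<in> V. f v = g' w} \<subseteq> g ` {v \<in> V. f v = w}"
    proof
      fix v assume v: "v \<in> {v \<in> V. f v = g' w}"
      then obtain u where u: "u \<in> V" "v = g u" using bij by (auto simp: bij_betw_def)
      then have "g' (f u) = g' w" using v fg by simp
      then have "f u = w" using inj by (simp add: inj_eq)
      then show "v \<in> g ` {v \<in> V. f v = w}" using u by blast
    qed
  qed
  moreover have "inj_on g {v \<in> V. f v = w}" using bij by (auto simp: bij_betw_def inj_on_def)
  ultimately have "(\<Sum>v\<in>{v \<in> V. f v = g' w}. push V f (\<lambda>vs. c (v # vs)) (map g' ws))
     = (\<Sum>v\<in>{v \<in> V. f v = w}. push V f (\<lambda>vs. c (g v # vs)) (map g' ws))"
    by (simp add: sum.reindex)
  moreover have "push V f (pull g c) (w # ws) = (\<Sum>v\<in>{v \<in> V. f v = w}. push V f (\<lambda>vs. c (g v # vs)) (map g' ws))"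
    unfolding push.simps
  proof (rule sum.cong[OF refl])
    fix v
    have "(\<lambda>vs. pull g c (v # vs)) = pull g (\<lambda>vs. c (g v # vs))" by (simp add: pull_def fun_eq_iff)
    then show "push V f (\<lambda>vs. pull g c (v # vs)) ws = push V f (\<lambda>vs. c (g v # vs)) (map g' ws)"
      using Cons.IH by simp
  qed
  ultimately show ?case by simp
qed (simp add: pull_def)

lemma boundary_pull:
  assumes V: "(`) g ` V = V" and inj: "inj g"
  shows "boundary (nbr V) (pull ((`) g) c) = pull ((`) g) (boundary (nbr V) c)"
proof
  fix vs show "boundary (nbr V) (pull ((`) g) c) vs = pull ((`) g) (boundary (nbr V) c) vs"
  proof (cases vs)
    case (Cons v ys)
    have "nbr V (g ` v) = (`) g ` nbr V v"
    proof
      show "(`) g ` nbr V v \<subseteq> nbr V (g ` v)" using V by (auto simp: nbr_def)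
      show "nbr V (g ` v) \<subseteq> (`) g ` nbr V v"
      proof
        fix W assume W: "W \<in> nbr V (g ` v)"
        then have "W \<in> (`) g ` V" using V by (simp add: nbr_def)
        then obtain U where U: "W = g ` U" "U \<in> V" by (rule imageE)
        have "g ` v \<inter> g ` U \<noteq> {}" using W U by (simp add: nbr_def)
        then have "v \<inter> U \<noteq> {}" using image_Int[OF inj, of v U] by auto
        then show "W \<in> (`) g ` nbr V v" using U by (auto simp: nbr_def)
      qed
    qed
    moreover have "inj_on ((`) g) (nbr V v)" using inj by (auto simp: inj_on_def inj_image_eq_iff)
    ultimately show ?thesis using Cons by (simp add: pull_def sum.reindex)
  qed (simp add: pull_def)
qed

text \<open>
  The assumption \<open>stab\<close> is where semifreeness at the large scale enters.
\<close>

locale pair_system = eq_system \<Gamma> V D N for \<Gamma> :: "('a::metric_space \<Rightarrow> 'a) set" and V D N +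
  fixes a b :: "'a \<Rightarrow> 'a" and p :: nat
  assumes p1: "p > 1" and G: "\<Gamma> = {a ^^ i \<circ> b ^^ j | i j. i < p \<and> j < p}"
    and ap: "a ^^ p = id" and bp: "b ^^ p = id" and ab_commute: "a \<circ> b = b \<circ> a"
    and stab: "\<exists>k\<ge>n. \<forall>U\<in>Vs n. (\<exists>i<p. \<exists>j<p. (i, j) \<noteq> (0, 0) \<and> (a ^^ i \<circ> b ^^ j) ` U = U) \<longrightarrow> tr n k U \<in> Fx k"
begin

text \<open>Indexed by pairs of exponents rather than by isometries, because the action need not be
  faithful and different pairs may give the same map.\<close>

definition el :: "nat \<times> nat \<Rightarrow> 'a set \<Rightarrow> 'a set" where
  "el k = (`) (a ^^ fst k \<circ> b ^^ snd k)"

text \<open>Subtraction in the index group \<open>\<int>/p \<times> \<int>/p\<close>.\<close>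

definition df :: "nat \<times> nat \<Rightarrow> nat \<times> nat \<Rightarrow> nat \<times> nat" where
  "df k l = ((fst k + (p - fst l)) mod p, (snd k + (p - snd l)) mod p)"

abbreviation Ix where "Ix \<equiv> {..<p} \<times> {..<p}"

lemma a_mod: "a ^^ (i mod p) = a ^^ i" and b_mod: "b ^^ (i mod p) = b ^^ i"
  using funpow_mod_eq[where f = a and n = p] funpow_mod_eq[where f = b and n = p] ap bp
  by (auto simp: fun_eq_iff)

lemma ab_pow: "a ^^ i \<circ> b ^^ j = b ^^ j \<circ> a ^^ i"
proof -
  have 1: "a \<circ> b ^^ j = b ^^ j \<circ> a" for j
  proof (induction j)
    case (Suc j)
    have "a \<circ> b ^^ Suc j = (a \<circ> b) \<circ> b ^^ j" by (simp add: comp_assoc)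
    also have "\<dots> = b \<circ> (a \<circ> b ^^ j)" by (simp add: ab_commute comp_assoc)
    also have "\<dots> = b ^^ Suc j \<circ> a" unfolding Suc by (simp add: comp_assoc)
    finally show ?case .
  qed simp
  show ?thesis
  proof (induction i)
    case (Suc i)
    have "a ^^ Suc i \<circ> b ^^ j = a \<circ> (a ^^ i \<circ> b ^^ j)" by (simp add: comp_assoc)
    also have "\<dots> = (a \<circ> b ^^ j) \<circ> a ^^ i" unfolding Suc by (simp add: comp_assoc)
    also have "\<dots> = b ^^ j \<circ> a ^^ Suc i" unfolding 1 by (simp add: comp_assoc)
    finally show ?case .
  qed simp
qed

lemma el_0 [simp]: "el (0, 0) U = U" by (simp add: el_def)

lemma el_in_G: "k \<in> Ix \<Longrightarrow> \<exists>g\<in>\<Gamma>. el k = (`) g"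
proof (rule bexI)
  assume k: "k \<in> Ix"
  show "el k = (`) (a ^^ fst k \<circ> b ^^ snd k)" by (rule el_def)
  show "a ^^ fst k \<circ> b ^^ snd k \<in> \<Gamma>" unfolding G
    using k by (intro CollectI exI[of _ "fst k"] exI[of _ "snd k"] conjI refl) auto
qed

lemma el_el: "el (i, j) (el (i', j') U) = el (i + i', j + j') U"
proof -
  have "(a ^^ i \<circ> b ^^ j) \<circ> (a ^^ i' \<circ> b ^^ j') = a ^^ i \<circ> (b ^^ j \<circ> a ^^ i') \<circ> b ^^ j'" by (simp add: comp_assoc)
  also have "\<dots> = (a ^^ i \<circ> a ^^ i') \<circ> (b ^^ j \<circ> b ^^ j')" unfolding ab_pow[of i' j, symmetric] by (simp add: comp_assoc)
  also have "\<dots> = a ^^ (i + i') \<circ> b ^^ (j + j')" by (simp add: funpow_add)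
  finally have e: "(a ^^ i \<circ> b ^^ j) \<circ> (a ^^ i' \<circ> b ^^ j') = a ^^ (i + i') \<circ> b ^^ (j + j')" .
  show ?thesis by (simp only: el_def fst_conv snd_conv image_comp e)
qed

lemma el_mod: "el (i mod p, j mod p) = el (i, j)" by (simp add: el_def a_mod b_mod)

lemma el_df: assumes "l \<in> Ix" shows "el (df k l) (el l U) = el k U"
proof -
  obtain i j i' j' where kl: "k = (i, j)" "l = (i', j')" by (cases k, cases l)
  have "el (df k l) (el l U) = el (i + (p - i') + i', j + (p - j') + j') U"
    by (simp add: kl df_def el_mod el_el)
  also have "\<dots> = el (i + p, j + p) U" using assms kl by simp
  also have "\<dots> = el k U" using el_mod[of "i + p" "j + p"] el_mod[of i j] by (simp add: kl)
  finally show ?thesis .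
qed

lemma df_Ix: "df k l \<in> Ix" using p1 by (simp add: df_def)

lemma el_commute: "el k (el l U) = el l (el k U)"
  by (cases k, cases l) (simp add: el_el add.commute)

lemma inj_el: assumes k: "k \<in> Ix" shows "inj (el k)"
proof (rule injI)
  fix U W assume "el k U = el k W"
  then have "el (df (0, 0) k) (el k U) = el (df (0, 0) k) (el k W)" by simp
  then show "U = W" by (simp only: el_df[OF k] el_0)
qed

lemma el_Vs: "k \<in> Ix \<Longrightarrow> U \<in> Vs n \<Longrightarrow> el k U \<in> Vs n"
  using el_in_G[of k] Vs_inv by auto

lemma df_eq_0: assumes "k \<in> Ix" "l \<in> Ix" "df k l = (0, 0)" shows "k = l"
proof -
  have *: "i = i'" if "i < p" "i' < p" "(i + (p - i')) mod p = 0" for i i' :: nat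
  proof (cases "i' \<le> i")
    case True
    then have e: "i + (p - i') = p + (i - i')" using that by simp
    have "(i - i') mod p = 0" using that(3) unfolding e mod_add_self1 .
    moreover have "(i - i') mod p = i - i'" using that by simp
    ultimately show ?thesis using True by simp
  next
    case False
    then have "i + (p - i') < p" using that by simp
    then show ?thesis using that by simp
  qed
  obtain i j i' j' where kl: "k = (i, j)" "l = (i', j')" by (cases k, cases l)
  have f: "i < p" "j < p" "i' < p" "j' < p" "(i + (p - i')) mod p = 0" "(j + (p - j')) mod p = 0"
    using assms unfolding kl df_def by simp_all
  have "i = i'" "j = j'" by (rule *[OF f(1,3,5)], rule *[OF f(2,4,6)])
  then show ?thesis by (simp add: kl)
qed

definition Fr where "Fr n = {\<sigma>. \<sigma> \<subseteq> Vs n \<and> (\<forall>k\<in>Ix. el k ` \<sigma> = \<sigma> \<longrightarrow> k = (0, 0))}"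

lemma FrD: "\<sigma> \<in> Fr n \<Longrightarrow> k \<in> Ix \<Longrightarrow> el k ` \<sigma> = \<sigma> \<Longrightarrow> k = (0, 0)"
  unfolding Fr_def by blast

lemma FrI: "\<sigma> \<subseteq> Vs n \<Longrightarrow> (\<And>k. k \<in> Ix \<Longrightarrow> el k ` \<sigma> = \<sigma> \<Longrightarrow> k = (0, 0)) \<Longrightarrow> \<sigma> \<in> Fr n"
  unfolding Fr_def by blast

lemma Fr_el: assumes "\<sigma> \<in> Fr n" "k \<in> Ix" shows "el k ` \<sigma> \<in> Fr n"
proof -
  have "l = (0, 0)" if l: "l \<in> Ix" "el l ` el k ` \<sigma> = el k ` \<sigma>" for l
  proof -
    have "el k ` (el l ` \<sigma>) = el l ` el k ` \<sigma>"
      unfolding image_image by (rule image_cong[OF refl el_commute])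
    also have "\<dots> = el k ` \<sigma>" by (rule l(2))
    finally have "el l ` \<sigma> = \<sigma>" unfolding inj_image_eq_iff[OF inj_el[OF assms(2)]] .
    then show ?thesis by (rule FrD[OF assms(1) l(1)])
  qed
  moreover have "el k ` \<sigma> \<subseteq> Vs n"
    using assms(1) el_Vs[OF assms(2)] unfolding Fr_def by blast
  ultimately show ?thesis by (intro FrI)
qed

lemma Fr_unique:
  assumes "\<sigma> \<in> Fr n" "k \<in> Ix" "l \<in> Ix" "el k ` \<sigma> = el l ` \<sigma>" shows "k = l"
proof (rule df_eq_0[OF assms(2,3)])
  have "el (df k l) ` el l ` \<sigma> = el k ` \<sigma>"
    unfolding image_image by (rule image_cong[OF refl el_df[OF assms(3)]])
  then have "el (df k l) ` el l ` \<sigma> = el l ` \<sigma>" using assms(4) by simp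
  then show "df k l = (0, 0)" by (rule FrD[OF Fr_el[OF assms(1,3)] df_Ix])
qed

definition subgrp where "subgrp I \<longleftrightarrow> I \<subseteq> Ix \<and> (0, 0) \<in> I \<and> (\<forall>k\<in>I. \<forall>l\<in>I. df k l \<in> I)"

text \<open>The representative depends only on the orbit as a set, so each orbit receives exactly
  one; freeness makes the translation to it unique.\<close>

lemma transversal:
  assumes I: "subgrp I"
  shows "\<exists>T\<subseteq>Fr n. \<forall>\<sigma>\<in>Fr n. \<exists>k\<in>I. el k ` \<sigma> \<in> T \<and> (\<forall>l\<in>I. el l ` \<sigma> \<in> T \<longrightarrow> l = k)"
proof -
  define orb where "orb = (\<lambda>\<sigma>. {el k ` \<sigma> | k. k \<in> I})"
  define rep where "rep = (\<lambda>\<sigma>. SOME \<tau>. \<tau> \<in> orb \<sigma>)"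
  have Isub: "k \<in> Ix" if "k \<in> I" for k using I that by (auto simp: subgrp_def)
  have sub: "orb (el k ` \<sigma>) \<subseteq> orb \<sigma>" if k: "k \<in> I" for k \<sigma>
  proof
    fix \<tau> assume "\<tau> \<in> orb (el k ` \<sigma>)"
    then obtain m where m: "m \<in> I" "\<tau> = el m ` el k ` \<sigma>" by (auto simp: orb_def)
    define k' where "k' = df (0, 0) k"
    have k': "k' \<in> I" using I k by (auto simp: subgrp_def k'_def)
    have "el m (el k U) = el (df m k') U" for U
    proof -
      have "el m (el k U) = el (df m k') (el k' (el k U))" by (rule el_df[OF Isub[OF k'], symmetric])
      also have "el k' (el k U) = U" unfolding k'_def by (simp add: el_df[OF Isub[OF k]])
      finally show ?thesis .
    qed
    then have "\<tau> = el (df m k') ` \<sigma>" by (simp add: m(2) image_image)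
    moreover have "df m k' \<in> I" using I m(1) k' by (simp add: subgrp_def)
    ultimately show "\<tau> \<in> orb \<sigma>" unfolding orb_def by blast
  qed
  have eq: "orb (el k ` \<sigma>) = orb \<sigma>" if k: "k \<in> I" for k \<sigma>
  proof
    have "df (0, 0) k \<in> I" using I k by (simp add: subgrp_def)
    from sub[OF this, of "el k ` \<sigma>"] show "orb \<sigma> \<subseteq> orb (el k ` \<sigma>)"
      by (simp add: image_image el_df[OF Isub[OF k]])
  qed (rule sub[OF k])
  define T where "T = {\<tau> \<in> Fr n. rep \<tau> = \<tau>}"
  have "\<exists>k\<in>I. el k ` \<sigma> \<in> T \<and> (\<forall>l\<in>I. el l ` \<sigma> \<in> T \<longrightarrow> l = k)" if s: "\<sigma> \<in> Fr n" for \<sigma>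
  proof -
    have "\<sigma> = el (0, 0) ` \<sigma>" using image_cong[OF refl, of \<sigma> "el (0, 0)" "\<lambda>U. U"] by simp
    moreover have "(0, 0) \<in> I" using I by (simp add: subgrp_def)
    ultimately have "\<sigma> \<in> orb \<sigma>" unfolding orb_def by blast
    then have "rep \<sigma> \<in> orb \<sigma>" unfolding rep_def by (rule someI)
    then obtain k where k: "k \<in> I" "rep \<sigma> = el k ` \<sigma>" by (auto simp: orb_def)
    have r: "rep (el l ` \<sigma>) = el k ` \<sigma>" if "l \<in> I" for l
      using eq[OF that] k(2) by (simp add: rep_def)
    have "el k ` \<sigma> \<in> T" using Fr_el[OF s Isub[OF k(1)]] r[OF k(1)] by (simp add: T_def)
    moreover have "l = k" if "l \<in> I" "el l ` \<sigma> \<in> T" for l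
      using Fr_unique[OF s Isub[OF that(1)] Isub[OF k(1)]] that r[OF that(1)] by (simp add: T_def)
    ultimately show ?thesis using k(1) by blast
  qed
  then show ?thesis by (intro exI[of _ T]) (auto simp: T_def)
qed

definition restr :: "'a set set set \<Rightarrow> ('a set list \<Rightarrow> 'k::ab_group_add) \<Rightarrow> 'a set list \<Rightarrow> 'k" where
  "restr T c vs = (if set vs \<in> T then c vs else 0)"

lemma alternating_restr: assumes "alternating c" shows "alternating (restr T c)"
  unfolding alternating_def
proof (intro conjI allI)
  fix xs ys and u v :: "'a set"
  have e: "set (xs @ u # v # ys) = set (xs @ v # u # ys)" by auto
  show "restr T c (xs @ u # v # ys) = - restr T c (xs @ v # u # ys)"
    unfolding restr_def e alternating_swap[OF assms, of xs u v ys]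
    by (cases "set (xs @ v # u # ys) \<in> T") simp_all
  show "restr T c (xs @ u # u # ys) = 0"
    unfolding restr_def alternating_repeat[OF assms] by simp
qed

lemma restr_chains:
  assumes "c \<in> chains p \<U> q" shows "restr T c \<in> chains p \<U> q"
  unfolding chains_def
proof (intro CollectI conjI allI impI)
  show "alternating (restr T c)" by (rule alternating_restr[OF chains_alternating[OF assms]])
  show "nmult p (restr T c vs) = 0" for vs
    using chains_tors[OF assms, of vs] by (simp add: restr_def additive.zero[OF additive_nmult])
  fix vs assume "restr T c vs \<noteq> 0"
  then have "c vs \<noteq> 0" by (auto simp: restr_def split: if_splits)
  from chains_supp[OF assms this]
  show "length vs = Suc q" "set vs \<subseteq> \<U>" "\<Inter>(set vs) \<noteq> {}" by auto
qed

lemma additive_restr: "additive_map (restr T)"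
  by (rule additive.intro) (simp add: fun_eq_iff restr_def)

lemma pull_chains:
  assumes k: "k \<in> Ix" and c: "c \<in> chains p (Vs n) q" shows "pull (el k) c \<in> chains p (Vs n) q"
proof -
  have "length vs = Suc q \<and> set vs \<subseteq> Vs n \<and> \<Inter>(set vs) \<noteq> {}" if ne: "pull (el k) c vs \<noteq> 0" for vs
  proof -
    have s: "length (map (el k) vs) = Suc q" "set (map (el k) vs) \<subseteq> Vs n" "\<Inter>(set (map (el k) vs)) \<noteq> {}"
      using chains_supp[OF c, of "map (el k) vs"] ne unfolding pull_def by simp_all
    let ?h = "el (df (0, 0) k)"
    have h: "?h (el k U) = U" for U by (simp add: el_df[OF k])
    have sub: "set vs \<subseteq> Vs n"
    proof
      fix U assume "U \<in> set vs"
      then have "el k U \<in> Vs n" using s(2) by auto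
      from el_Vs[OF df_Ix[of "(0, 0)" k] this] show "U \<in> Vs n" unfolding h .
    qed
    obtain x where x: "x \<in> \<Inter>(set (map (el k) vs))" using s(3) by blast
    obtain g where g: "?h = (`) g" using el_in_G[OF df_Ix] by blast
    have "g x \<in> U" if "U \<in> set vs" for U
    proof -
      have "x \<in> el k U" using x that by auto
      then have "g x \<in> g ` el k U" by (rule imageI)
      then show ?thesis using h[of U] unfolding g by simp
    qed
    then have "\<Inter>(set vs) \<noteq> {}" by blast
    then show ?thesis using s(1) sub by simp
  qed
  then show ?thesis using alternating_pull[OF chains_alternating[OF c]] chains_tors[OF c]
    by (simp add: chains_def pull_def)
qed

text \<open>An invariant chain is the norm of its restriction to a transversal: each free simplex
  has exactly one translate in \<open>T\<close>, so exactly one summand is nonzero there.\<close>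

lemma free_invariant:
  assumes I: "subgrp I" and c: "c \<in> chains p (Vs n) q" and supp: "\<And>vs. c vs \<noteq> 0 \<Longrightarrow> set vs \<in> Fr n"
    and inv: "\<And>k. k \<in> I \<Longrightarrow> pull (el k) c = c"
  shows "\<exists>y\<in>chains p (Vs n) q. c = (\<Sum>k\<in>I. pull (el k) y)"
proof -
  from transversal[OF I, of n] obtain T where T: "T \<subseteq> Fr n"
    "\<forall>\<sigma>\<in>Fr n. \<exists>k\<in>I. el k ` \<sigma> \<in> T \<and> (\<forall>l\<in>I. el l ` \<sigma> \<in> T \<longrightarrow> l = k)"
    by (elim exE conjE)
  have fin: "finite I" using I by (auto simp: subgrp_def intro: finite_subset[of _ Ix])
  have e: "pull (el k) (restr T c) vs = (if el k ` set vs \<in> T then c vs else 0)" if "k \<in> I" for k vs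
    using fun_cong[OF inv[OF that], of vs] by (simp add: pull_def restr_def)
  have "c vs = (\<Sum>k\<in>I. pull (el k) (restr T c)) vs" for vs
  proof (cases "set vs \<in> Fr n")
    case True
    from bspec[OF T(2) True] obtain k where k: "k \<in> I" "el k ` set vs \<in> T"
        "\<forall>l\<in>I. el l ` set vs \<in> T \<longrightarrow> l = k"
      by (elim bexE conjE)
    have "(\<Sum>l\<in>I. pull (el l) (restr T c) vs) = (\<Sum>l\<in>I. if l = k then c vs else 0)"
    proof (rule sum.cong[OF refl])
      fix l assume l: "l \<in> I"
      show "pull (el l) (restr T c) vs = (if l = k then c vs else 0)"
        unfolding e[OF l]
       proof (cases "l = k")
         case True
         show "(if el l ` set vs \<in> T then c vs else 0) = (if l = k then c vs else 0)"
           unfolding True if_P[OF k(2)] if_P[OF refl] ..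
       next
         case False
         then have "el l ` set vs \<notin> T" using bspec[OF k(3) l] by blast
         then show "(if el l ` set vs \<in> T then c vs else 0) = (if l = k then c vs else 0)"
           unfolding if_not_P[OF False] by (rule if_not_P)
       qed
    qed
    then show ?thesis using fin k(1) by (simp add: sum_fun_apply)
  next
    case False
    then have c0: "c vs = 0" using supp by blast
    have "(\<Sum>k\<in>I. pull (el k) (restr T c) vs) = 0"
      by (rule sum.neutral) (simp add: e c0)
    then show ?thesis by (simp add: c0 sum_fun_apply)
  qed
  then have "c = (\<Sum>k\<in>I. pull (el k) (restr T c))" by (rule ext)
  then show ?thesis by (rule bexI[of _ "restr T c"]) (rule restr_chains[OF c])
qed

text \<open>Cut \<open>c\<close> into the parts supported on the translates of a transversal
  \<open>T\<close>, and let \<open>x k\<close> be the part of index \<open>k\<close> moved onto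
  \<open>T\<close>. Moving all parts back gives \<open>c\<close>, while unmoved they add up to the
  restriction to \<open>T\<close> of the norm of \<open>c\<close>, which is zero. Hence
  \<open>c\<close> is the sum of the differences.\<close>

lemma free_norm_zero:
  assumes I: "subgrp I" and c: "c \<in> chains p (Vs n) q" and supp: "\<And>vs. c vs \<noteq> 0 \<Longrightarrow> set vs \<in> Fr n"
    and z: "(\<Sum>k\<in>I. pull (el k) c) = 0"
  shows "\<exists>x. (\<forall>k\<in>I. x k \<in> chains p (Vs n) q) \<and> c = (\<Sum>k\<in>I. pull (el k) (x k) - x k)"
proof -
  from transversal[OF I, of n] obtain T where T: "T \<subseteq> Fr n"
    "\<forall>\<sigma>\<in>Fr n. \<exists>k\<in>I. el k ` \<sigma> \<in> T \<and> (\<forall>l\<in>I. el l ` \<sigma> \<in> T \<longrightarrow> l = k)"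
    by (elim exE conjE)
  have fin: "finite I" using I by (auto simp: subgrp_def intro: finite_subset[of _ Ix])
  have Isub: "k \<in> Ix" if "k \<in> I" for k using I that by (auto simp: subgrp_def)
  define neg where "neg = df (0, 0)"
  have neg: "neg k \<in> I" if "k \<in> I" for k using I that by (simp add: subgrp_def neg_def)
  have nn: "neg (neg k) = k" if k: "k \<in> I" for k
  proof (rule df_eq_0[symmetric, OF Isub[OF k] df_Ix[of "(0,0)" "neg k", folded neg_def]])
    obtain i j where ij: "k = (i, j)" "i < p" "j < p" using Isub[OF k] by (cases k) auto
    have *: "(i + (p - (p - (p - i) mod p) mod p)) mod p = 0" if "i < p" for i
    proof (cases "i = 0")
      case False
      then have "(p - i) mod p = p - i" using that by simp
      then have "(p - (p - i) mod p) mod p = i" using that by simp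
      then show ?thesis using that by simp
    qed (use p1 in simp)
    show "df k (neg (neg k)) = (0, 0)" using *[OF ij(2)] *[OF ij(3)] by (simp add: df_def neg_def ij(1))
  qed
  define x where "x = (\<lambda>k. restr T (pull (el (neg k)) c))"
  have x: "x k \<in> chains p (Vs n) q" if "k \<in> I" for k
    unfolding x_def by (rule restr_chains[OF pull_chains[OF Isub[OF neg[OF that]] c]])
  have e: "pull (el k) (x k) vs = (if el k ` set vs \<in> T then c vs else 0)" if "k \<in> I" for k vs
  proof -
    have "map (el (neg k)) (map (el k) vs) = vs" by (simp add: neg_def el_df[OF Isub[OF that]] map_idI)
    then show ?thesis by (simp add: pull_def restr_def x_def)
  qed
  have "c vs = (\<Sum>k\<in>I. pull (el k) (x k) - x k) vs" for vs
  proof -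
    have "(\<Sum>k\<in>I. x k vs) = (if set vs \<in> T then (\<Sum>k\<in>I. pull (el (neg k)) c vs) else 0)"
      by (simp add: x_def restr_def)
    also have "(\<Sum>k\<in>I. pull (el (neg k)) c vs) = (\<Sum>k\<in>I. pull (el k) c vs)"
      by (rule sum.reindex_bij_witness[of _ neg neg]) (use neg nn in auto)
    also have "\<dots> = 0" using z by (simp add: fun_eq_iff sum_fun_apply)
    finally have 1: "(\<Sum>k\<in>I. x k vs) = 0" by simp
    have 2: "(\<Sum>k\<in>I. pull (el k) (x k) vs) = c vs"
    proof (cases "set vs \<in> Fr n")
      case True
      from bspec[OF T(2) True] obtain k where k: "k \<in> I" "el k ` set vs \<in> T"
          "\<forall>l\<in>I. el l ` set vs \<in> T \<longrightarrow> l = k"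
        by (elim bexE conjE)
      have "(\<Sum>l\<in>I. pull (el l) (x l) vs) = (\<Sum>l\<in>I. if l = k then c vs else 0)"
      proof (rule sum.cong[OF refl])
        fix l assume l: "l \<in> I"
        show "pull (el l) (x l) vs = (if l = k then c vs else 0)"
          unfolding e[OF l]
         proof (cases "l = k")
           case True
           show "(if el l ` set vs \<in> T then c vs else 0) = (if l = k then c vs else 0)"
             unfolding True if_P[OF k(2)] if_P[OF refl] ..
         next
           case False
           then have "el l ` set vs \<notin> T" using bspec[OF k(3) l] by blast
           then show "(if el l ` set vs \<in> T then c vs else 0) = (if l = k then c vs else 0)"
             unfolding if_not_P[OF False] by (rule if_not_P)
         qed
      qed
      then show ?thesis using fin k(1) by simp
    next
      case False
      then have c0: "c vs = 0" using supp by blast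
      show ?thesis unfolding c0 by (rule sum.neutral) (simp add: e c0)
    qed
    show ?thesis using 1 2 by (simp add: sum_fun_apply sum_subtractf)
  qed
  then have "c = (\<Sum>k\<in>I. pull (el k) (x k) - x k)" by (rule ext)
  then show ?thesis using x by blast
qed

section \<open>Kernels of differences and norms on free simplices\<close>

abbreviation A where "A \<equiv> pull ((`) a)"
abbreviation B where "B \<equiv> pull ((`) b)"

lemma image_funpow: "((`) f) ^^ k = (`) (f ^^ k)" for f :: "'x \<Rightarrow> 'x"
  by (induction k) (auto simp: fun_eq_iff)

lemma el_eq: "el (i, j) = ((`) b ^^ j) \<circ> ((`) a ^^ i)"
  unfolding el_def image_funpow by (auto simp: fun_eq_iff ab_pow image_comp)

lemma pull_el: "pull (el (i, j)) c = (A ^^ i) ((B ^^ j) c)"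
  unfolding funpow_pull el_eq by (simp add: pull_def fun_eq_iff)

lemma sum_cyclic: "(\<Sum>k\<in>{..<p} \<times> {0}. f k) = (\<Sum>i<p. f (i, 0))"
  by (rule sum.reindex_bij_witness[of _ "\<lambda>i. (i, 0)" fst]) auto

lemma subgrp_cyclic: "subgrp ({..<p} \<times> {0})" using p1 by (auto simp: subgrp_def df_def)
lemma subgrp_full: "subgrp Ix" using p1 by (auto simp: subgrp_def df_def)

lemma norm_cyclic: "norm_op p A c = (\<Sum>k\<in>{..<p} \<times> {0}. pull (el k) c)"
  unfolding sum_cyclic norm_op_def pull_el by simp

lemma norm_full: "norm_op p A (norm_op p B c) = (\<Sum>k\<in>Ix. pull (el k) c)"
proof -
  have "norm_op p A (norm_op p B c) = (\<Sum>i<p. \<Sum>j<p. pull (el (i, j)) c)"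
    unfolding norm_op_def pull_el by (simp add: additive.sum[OF additive_funpow[OF additive_pull]])
  then show ?thesis by (simp add: sum.cartesian_product)
qed

lemma tau_zero_pow: "tau T c = 0 \<Longrightarrow> (T ^^ k) c = c"
  by (induction k) (simp_all add: tau_def)

lemma A_chains: "c \<in> chains p (Vs n) q \<Longrightarrow> A c \<in> chains p (Vs n) q"
  using pull_chains[of "(1, 0)" c n q] p1 by (simp add: el_def)
lemma B_chains: "c \<in> chains p (Vs n) q \<Longrightarrow> B c \<in> chains p (Vs n) q"
  using pull_chains[of "(0, 1)" c n q] p1 by (simp add: el_def)

lemma funpow_in: "(\<And>x. x \<in> X \<Longrightarrow> f x \<in> X) \<Longrightarrow> x \<in> X \<Longrightarrow> (f ^^ k) x \<in> X"
  by (induction k) auto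

lemma norm_op_chains:
  assumes "\<And>c. c \<in> chains p (Vs n) q \<Longrightarrow> T c \<in> chains p (Vs n) q" "c \<in> chains p (Vs n) q"
  shows "norm_op k T c \<in> chains p (Vs n) q"
  unfolding norm_op_def by (intro chains_sum funpow_in assms)

context
  fixes c :: "'a set list \<Rightarrow> 'k::ab_group_add" and n q
  assumes c: "c \<in> chains p (Vs n) q" and supp: "\<And>vs. c vs \<noteq> 0 \<Longrightarrow> set vs \<in> Fr n"
begin

lemma free_ker_tau: "tau A c = 0 \<Longrightarrow> \<exists>y\<in>chains p (Vs n) q. c = norm_op p A y"
  unfolding norm_cyclic
  by (rule free_invariant[OF subgrp_cyclic c supp]) (auto simp: pull_el tau_zero_pow)

lemma free_ker_tau_tau: "tau A c = 0 \<Longrightarrow> tau B c = 0 \<Longrightarrow> \<exists>y\<in>chains p (Vs n) q. c = norm_op p A (norm_op p B y)"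
  unfolding norm_full
  by (rule free_invariant[OF subgrp_full c supp]) (auto simp: pull_el tau_zero_pow)

lemma free_ker_norm: assumes "norm_op p A c = 0" shows "\<exists>y\<in>chains p (Vs n) q. c = tau A y"
proof -
  obtain x where x: "\<forall>k\<in>{..<p} \<times> {0}. x k \<in> chains p (Vs n) q"
    "c = (\<Sum>k\<in>{..<p} \<times> {0}. pull (el k) (x k) - x k)"
    using free_norm_zero[OF subgrp_cyclic c supp] assms unfolding norm_cyclic by blast
  \<comment> \<open>Uses \<open>A^i - 1 = (A - 1)(1 + A + ... + A^(i-1))\<close> to extract a common
    factor \<open>tau A\<close>.\<close>
  have "c = (\<Sum>i<p. tau A (norm_op i A (x (i, 0))))"
    unfolding x(2) sum_cyclic pull_el by (simp add: tau_norm_op[OF additive_pull])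
  also have "\<dots> = tau A (\<Sum>i<p. norm_op i A (x (i, 0)))"
    by (simp add: additive.sum[OF additive_tau[OF additive_pull]])
  finally show ?thesis using x(1) by (intro bexI[of _ "\<Sum>i<p. norm_op i A (x (i, 0))"] chains_sum norm_op_chains A_chains) auto
qed

lemma free_ker_norm_norm:
  assumes "norm_op p A (norm_op p B c) = 0"
  shows "\<exists>y\<in>chains p (Vs n) q. \<exists>z\<in>chains p (Vs n) q. c = tau A y + tau B z"
proof -
  obtain x where x: "\<forall>k\<in>Ix. x k \<in> chains p (Vs n) q" "c = (\<Sum>k\<in>Ix. pull (el k) (x k) - x k)"
    using free_norm_zero[OF subgrp_full c supp] assms unfolding norm_full by blast
  \<comment> \<open>From the identity \<open>A^i B^j - 1 = (A^i - 1) B^j + (B^j - 1)\<close>, each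
    bracket being a difference times a partial norm.\<close>
  define y where "y = (\<Sum>k\<in>Ix. norm_op (fst k) A ((B ^^ snd k) (x k)))"
  define z where "z = (\<Sum>k\<in>Ix. norm_op (snd k) B (x k))"
  have "pull (el k) (x k) - x k = tau A (norm_op (fst k) A ((B ^^ snd k) (x k))) + tau B (norm_op (snd k) B (x k))" for k
    unfolding tau_norm_op[OF additive_pull] using pull_el[of "fst k" "snd k"] by simp
  then have "c = tau A y + tau B z" unfolding x(2) y_def z_def
    by (simp only: sum.distrib additive.sum[OF additive_tau[OF additive_pull]])
  moreover have "y \<in> chains p (Vs n) q" "z \<in> chains p (Vs n) q" unfolding y_def z_def
    using x(1) by (auto intro!: chains_sum norm_op_chains A_chains B_chains funpow_in)
  ultimately show ?thesis by blast
qed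

end

end

section \<open>Chains in the direct limit\<close>

text \<open>
  The direct limit of the chain groups is embedded in the group of sequences modulo eventual
  equality, which avoids equivalence classes of pairs.
\<close>

quotient_type 'b germ = "nat \<Rightarrow> 'b" / "\<lambda>s t. \<forall>\<^sub>F n in sequentially. s n = t n"
proof (rule equivpI)
  show "reflp (\<lambda>s t :: nat \<Rightarrow> 'b. \<forall>\<^sub>F n in sequentially. s n = t n)" by (simp add: reflp_def)
  show "symp (\<lambda>s t :: nat \<Rightarrow> 'b. \<forall>\<^sub>F n in sequentially. s n = t n)"
    by (rule sympI) (auto elim: eventually_mono)
  show "transp (\<lambda>s t :: nat \<Rightarrow> 'b. \<forall>\<^sub>F n in sequentially. s n = t n)"
    by (rule transpI) (auto elim: eventually_elim2)
qed

instantiation germ :: (ab_group_add) ab_group_add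
begin
lift_definition zero_germ :: "'a germ" is "\<lambda>_. 0" .
lift_definition plus_germ :: "'a germ \<Rightarrow> 'a germ \<Rightarrow> 'a germ" is "\<lambda>s t n. s n + t n"
  by (auto elim: eventually_elim2)
lift_definition minus_germ :: "'a germ \<Rightarrow> 'a germ \<Rightarrow> 'a germ" is "\<lambda>s t n. s n - t n"
  by (auto elim: eventually_elim2)
lift_definition uminus_germ :: "'a germ \<Rightarrow> 'a germ" is "\<lambda>s n. - s n"
  by (auto elim: eventually_mono)
instance
proof
  fix x y z :: "'a germ"
  show "x + y + z = x + (y + z)" by transfer (simp add: add.assoc)
  show "x + y = y + x" by transfer (simp add: add.commute)
  show "0 + x = x" by transfer simp
  show "- x + x = 0" by transfer simp
  show "x - y = x + - y" by transfer simp
qed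
end

lift_definition germ_map :: "(nat \<Rightarrow> 'b \<Rightarrow> 'c) \<Rightarrow> 'b germ \<Rightarrow> 'c germ" is "\<lambda>F s n. F n (s n)"
  by (auto elim: eventually_mono)

lemma additive_germ_map:
  assumes "\<And>n. additive_map (F n)" shows "additive_map (germ_map F)"
proof (rule additive.intro)
  fix x y show "germ_map F (x + y) = germ_map F x + germ_map F y"
    by (induction x rule: germ.abs_induct, induction y rule: germ.abs_induct)
      (simp add: plus_germ.abs_eq germ_map.abs_eq additive.add[OF assms])
qed

context pair_system
begin

text \<open>The class of a stage-\<open>n\<close> chain in the direct limit. The zeros before stage
  \<open>n\<close> are dummies, since a germ ignores finitely many stages.\<close>

definition thread :: "nat \<Rightarrow> ('a set list \<Rightarrow> 'k::ab_group_add) \<Rightarrow> ('a set list \<Rightarrow> 'k) germ" where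
  "thread n c = abs_germ (\<lambda>k. if n \<le> k then trp n k c else 0)"

lemma thread_eqI: "n \<le> l \<Longrightarrow> m \<le> l \<Longrightarrow> trp n l c = trp m l d \<Longrightarrow> thread n c = thread m d"
  unfolding thread_def germ.abs_eq_iff eventually_sequentially
proof (intro exI[of _ l] allI impI)
  fix k assume l: "n \<le> l" "m \<le> l" "trp n l c = trp m l d" "l \<le> k"
  have "trp n k c = trp l k (trp n l c)" "trp m k d = trp l k (trp m l d)"
    by (rule trp_trp[symmetric]; fact)+
  then show "(if n \<le> k then trp n k c else 0) = (if m \<le> k then trp m k d else 0)" using l by simp
qed

lemma thread_eqD:
  assumes "thread n c = thread m d" shows "\<exists>l0. \<forall>l\<ge>l0. n \<le> l \<and> m \<le> l \<and> trp n l c = trp m l d"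
proof -
  obtain l0 where l0: "\<forall>k\<ge>l0. (if n \<le> k then trp n k c else 0) = (if m \<le> k then trp m k d else 0)"
    using assms unfolding thread_def germ.abs_eq_iff eventually_sequentially by blast
  have "n \<le> l \<and> m \<le> l \<and> trp n l c = trp m l d" if l: "l \<ge> max l0 (max n m)" for l
    using l0[rule_format, of l] l by simp
  then show ?thesis by blast
qed

lemma thread_trp: "n \<le> k \<Longrightarrow> thread k (trp n k c) = thread n c"
proof (rule thread_eqI[of k k])
  assume "n \<le> k"
  then show "trp k k (trp n k c) = trp n k c" by (rule trp_trp) simp
qed simp_all

lemma additive_thread: "additive_map (thread n :: ('a set list \<Rightarrow> 'k::ab_group_add) \<Rightarrow> _)"
proof (rule additive.intro)
  fix c d :: "'a set list \<Rightarrow> 'k"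
  have "(\<lambda>k. if n \<le> k then trp n k (c + d) else 0) =
      (\<lambda>k. (if n \<le> k then trp n k c else 0) + (if n \<le> k then trp n k d else 0))"
    by (simp add: fun_eq_iff additive.add[OF additive_trp])
  then show "thread n (c + d) = thread n c + thread n d"
    unfolding thread_def plus_germ.abs_eq by simp
qed

lemmas thread_diff = additive.diff[OF additive_thread] and thread_0 = additive.zero[OF additive_thread]

definition Cg :: "nat \<Rightarrow> ('a set list \<Rightarrow> 'k::ab_group_add) germ set" where
  "Cg q = (\<Union>n. thread n ` chains p (Vs n) q)"
definition Fg :: "nat \<Rightarrow> ('a set list \<Rightarrow> 'k::ab_group_add) germ set" where
  "Fg q = (\<Union>n. thread n ` chains p (Fx n) q)"

lemma CgI: "c \<in> chains p (Vs n) q \<Longrightarrow> thread n c \<in> Cg q" by (auto simp: Cg_def)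
lemma FgI: "c \<in> chains p (Fx n) q \<Longrightarrow> thread n c \<in> Fg q" by (auto simp: Fg_def)
lemma CgE: assumes "x \<in> Cg q" obtains n c where "c \<in> chains p (Vs n) q" "x = thread n c"
  using assms by (auto simp: Cg_def)
lemma FgE: assumes "x \<in> Fg q" obtains n c where "c \<in> chains p (Fx n) q" "x = thread n c"
  using assms by (auto simp: Fg_def)

lemma trp_Fx: "n \<le> k \<Longrightarrow> c \<in> chains p (Fx n) q \<Longrightarrow> trp n k c \<in> chains p (Fx k) q"
  using F.trp_chains[of n k c p q] Fx_trp[of n k c p q] by simp

lemma Cg_diff: assumes "x \<in> Cg q" "y \<in> Cg q" shows "x - y \<in> Cg q"
proof -
  obtain n c where c: "c \<in> chains p (Vs n) q" "x = thread n c" using assms(1) by (rule CgE)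
  obtain m d where d: "d \<in> chains p (Vs m) q" "y = thread m d" using assms(2) by (rule CgE)
  let ?l = "max n m"
  have "x - y = thread ?l (trp n ?l c - trp m ?l d)"
    by (simp add: c(2) d(2) thread_diff thread_trp)
  then show ?thesis using trp_chains[OF _ c(1), of ?l] trp_chains[OF _ d(1), of ?l]
    by (simp add: CgI chains_minus)
qed

lemma Fg_diff: assumes "x \<in> Fg q" "y \<in> Fg q" shows "x - y \<in> Fg q"
proof -
  obtain n c where c: "c \<in> chains p (Fx n) q" "x = thread n c" using assms(1) by (rule FgE)
  obtain m d where d: "d \<in> chains p (Fx m) q" "y = thread m d" using assms(2) by (rule FgE)
  let ?l = "max n m"
  have "x - y = thread ?l (trp n ?l c - trp m ?l d)"
    by (simp add: c(2) d(2) thread_diff thread_trp)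
  then show ?thesis using trp_Fx[OF _ c(1), of ?l] trp_Fx[OF _ d(1), of ?l]
    by (simp add: FgI chains_minus)
qed

definition bdg :: "('a set list \<Rightarrow> 'k::ab_group_add) germ \<Rightarrow> ('a set list \<Rightarrow> 'k) germ" where
  "bdg = germ_map (\<lambda>k. boundary (nbr (Vs k)))"

lemma additive_bdg: "additive_map bdg"
  unfolding bdg_def by (rule additive_germ_map) (rule additive_boundary)

lemma bdg_thread:
  assumes c: "c \<in> chains p (Vs n) q" shows "bdg (thread n c) = thread n (boundary (nbr (Vs n)) c)"
proof -
  have "(\<lambda>k. boundary (nbr (Vs k)) (if n \<le> k then trp n k c else 0)) =
     (\<lambda>k. if n \<le> k then trp n k (boundary (nbr (Vs n)) c) else 0)"
    using boundary_trp[OF _ c] by (auto simp: fun_eq_iff additive.zero[OF additive_boundary])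
  then show ?thesis unfolding bdg_def thread_def germ_map.abs_eq by simp
qed

abbreviation Ag where "Ag \<equiv> germ_map (\<lambda>_. A)"
abbreviation Bg where "Bg \<equiv> germ_map (\<lambda>_. B)"

lemma el_10: "el (1, 0) = (`) a" and el_01: "el (0, 1) = (`) b"
  by (simp_all add: el_def)

lemma Ix_10: "(1, 0) \<in> Ix" and Ix_01: "(0, 1) \<in> Ix" using p1 by auto

lemma trp_pull:
  assumes k: "k \<in> Ix" and nl: "n \<le> l"
  shows "trp n l (pull (el k) c) = pull (el k) (trp n l c)"
proof
  fix ws
  obtain g where g: "g \<in> \<Gamma>" "el k = (`) g" using el_in_G[OF k] by blast
  have "bij_betw (el k) (Vs n) (Vs n)"
  proof (rule bij_betwI[where g = "el (df (0, 0) k)"])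
    show "el k \<in> Vs n \<rightarrow> Vs n" using el_Vs[OF k] by blast
    show "el (df (0, 0) k) \<in> Vs n \<rightarrow> Vs n" using el_Vs[OF df_Ix] by blast
    show "el (df (0, 0) k) (el k x) = x" for x by (simp add: el_df[OF k])
    then show "el k (el (df (0, 0) k) y) = y" for y using el_commute[of k "df (0,0) k" y] by simp
  qed
  then show "trp n l (pull (el k) c) ws = pull (el k) (trp n l c) ws"
    unfolding trp_def pull_def[of _ "push _ _ _"]
    by (rule push_pull[OF _ inj_el[OF k]]) (use tr_image[OF nl _ g(1)] g(2) in simp)
qed

text \<open>Operators on germs that are given stage by stage and respect chains, transition maps and
  restriction to free simplices. This is closed under sums and compositions, so \<open>tau\<close>
  and \<open>norm_op\<close> inherit it from \<open>pull\<close>.\<close>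

definition lifts :: "(('a set list \<Rightarrow> 'k::ab_group_add) germ \<Rightarrow> ('a set list \<Rightarrow> 'k) germ) \<Rightarrow>
    (('a set list \<Rightarrow> 'k) \<Rightarrow> 'a set list \<Rightarrow> 'k) \<Rightarrow> bool" where
  "lifts Tg T \<longleftrightarrow> additive_map Tg \<and> additive_map T \<and>
    (\<forall>n q. \<forall>c\<in>chains p (Vs n) q. T c \<in> chains p (Vs n) q \<and> Tg (thread n c) = thread n (T c) \<and>
       (\<forall>l\<ge>n. trp n l (T c) = T (trp n l c)) \<and> T (restr (Fr n) c) = restr (Fr n) (T c))"

lemma lifts_additive: "lifts Tg T \<Longrightarrow> additive_map Tg" "lifts Tg T \<Longrightarrow> additive_map T"
  and lifts_chains: "lifts Tg T \<Longrightarrow> c \<in> chains p (Vs n) q \<Longrightarrow> T c \<in> chains p (Vs n) q"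
  and lifts_thread: "lifts Tg T \<Longrightarrow> c \<in> chains p (Vs n) q \<Longrightarrow> Tg (thread n c) = thread n (T c)"
  and lifts_trp: "lifts Tg T \<Longrightarrow> c \<in> chains p (Vs n) q \<Longrightarrow> n \<le> l \<Longrightarrow> trp n l (T c) = T (trp n l c)"
  and lifts_restr: "lifts Tg T \<Longrightarrow> c \<in> chains p (Vs n) q \<Longrightarrow> T (restr (Fr n) c) = restr (Fr n) (T c)"
  unfolding lifts_def by blast+

lemma lifts_pull:
  assumes k: "k \<in> Ix"
  shows "lifts (germ_map (\<lambda>_. pull (el k)) :: ('a set list \<Rightarrow> 'k::ab_group_add) germ \<Rightarrow> _) (pull (el k))"
  unfolding lifts_def
proof (intro conjI allI ballI impI)
  show "additive_map (germ_map (\<lambda>_. pull (el k)))" by (intro additive_germ_map additive_pull)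
  show "additive_map (pull (el k))" by (rule additive_pull)
  fix n q and c :: "'a set list \<Rightarrow> 'k" assume c: "c \<in> chains p (Vs n) q"
  show "pull (el k) c \<in> chains p (Vs n) q" by (rule pull_chains[OF k c])
  have "(\<lambda>l. pull (el k) (if n \<le> l then trp n l c else 0)) = (\<lambda>l. if n \<le> l then trp n l (pull (el k) c) else 0)"
    by (rule ext) (simp add: trp_pull[OF k] additive.zero[OF additive_pull])
  then show "germ_map (\<lambda>_. pull (el k)) (thread n c) = thread n (pull (el k) c)"
    unfolding thread_def germ_map.abs_eq by simp
  show "trp n l (pull (el k) c) = pull (el k) (trp n l c)" if "n \<le> l" for l by (rule trp_pull[OF k that])
  have "el k ` \<sigma> \<in> Fr n \<longleftrightarrow> \<sigma> \<in> Fr n" for \<sigma>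
  proof
    assume s: "el k ` \<sigma> \<in> Fr n"
    have "el (df (0, 0) k) ` el k ` \<sigma> = \<sigma>" by (simp add: image_image el_df[OF k])
    then show "\<sigma> \<in> Fr n" using Fr_el[OF s df_Ix[of "(0, 0)" k]] by simp
  qed (rule Fr_el[OF _ k])
  then show "pull (el k) (restr (Fr n) c) = restr (Fr n) (pull (el k) c)"
    by (simp add: fun_eq_iff pull_def restr_def)
qed

lemma lifts_comp:
  assumes S: "lifts (Sg :: ('a set list \<Rightarrow> 'k::ab_group_add) germ \<Rightarrow> _) S" and T: "lifts Tg T" shows "lifts (\<lambda>x. Sg (Tg x)) (\<lambda>x. S (T x))"
  unfolding lifts_def
proof (intro conjI allI ballI impI)
  show "additive_map (\<lambda>x. Sg (Tg x))" by (rule additive_comp[OF lifts_additive(1)[OF S] lifts_additive(1)[OF T]])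
  show "additive_map (\<lambda>x. S (T x))" by (rule additive_comp[OF lifts_additive(2)[OF S] lifts_additive(2)[OF T]])
  fix n q and c :: "'a set list \<Rightarrow> 'k" assume c: "c \<in> chains p (Vs n) q"
  note Tc = lifts_chains[OF T c]
  show "S (T c) \<in> chains p (Vs n) q" by (rule lifts_chains[OF S Tc])
  show "Sg (Tg (thread n c)) = thread n (S (T c))" unfolding lifts_thread[OF T c] by (rule lifts_thread[OF S Tc])
  show "trp n l (S (T c)) = S (T (trp n l c))" if "n \<le> l" for l
    unfolding lifts_trp[OF S Tc that] lifts_trp[OF T c that] ..
  show "S (T (restr (Fr n) c)) = restr (Fr n) (S (T c))"
    unfolding lifts_restr[OF T c] lifts_restr[OF S Tc] ..
qed

lemma lifts_id: "lifts (\<lambda>x. x) (\<lambda>x. x)"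
  by (auto simp: lifts_def Modules.additive_def)

lemma lifts_funpow: assumes "lifts Tg T" shows "lifts (Tg ^^ k) (T ^^ k)"
proof (induction k)
  case 0 show ?case using lifts_id by (simp add: id_def)
next
  case (Suc k) show ?case using lifts_comp[OF assms Suc] by (simp add: o_def)
qed

lemma lifts_add:
  assumes S: "lifts (Sg :: ('a set list \<Rightarrow> 'k::ab_group_add) germ \<Rightarrow> _) S" and T: "lifts Tg T" shows "lifts (\<lambda>x. Sg x + Tg x) (\<lambda>x. S x + T x)"
  unfolding lifts_def
proof (intro conjI allI ballI impI)
  show "additive_map (\<lambda>x. Sg x + Tg x)" "additive_map (\<lambda>x. S x + T x)"
    using lifts_additive[OF S] lifts_additive[OF T] by (simp_all add: Modules.additive_def)
  fix n q and c :: "'a set list \<Rightarrow> 'k" assume c: "c \<in> chains p (Vs n) q"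
  show "S c + T c \<in> chains p (Vs n) q" by (rule chains_plus[OF lifts_chains[OF S c] lifts_chains[OF T c]])
  show "Sg (thread n c) + Tg (thread n c) = thread n (S c + T c)"
    by (simp add: additive.add[OF additive_thread] lifts_thread[OF S c] lifts_thread[OF T c])
  show "trp n l (S c + T c) = S (trp n l c) + T (trp n l c)" if "n \<le> l" for l
    by (simp add: additive.add[OF additive_trp] lifts_trp[OF S c that] lifts_trp[OF T c that])
  show "S (restr (Fr n) c) + T (restr (Fr n) c) = restr (Fr n) (S c + T c)"
    by (simp add: additive.add[OF additive_restr] lifts_restr[OF S c] lifts_restr[OF T c])
qed

lemma lifts_zero: "lifts (\<lambda>x. 0) (\<lambda>x. 0)"
  by (simp add: lifts_def Modules.additive_def chains_zero thread_0 additive.zero[OF additive_trp]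
    additive.zero[OF additive_restr])

lemma lifts_uminus: "lifts uminus uminus"
  by (simp add: lifts_def Modules.additive_def chains_uminus additive.minus[OF additive_thread]
    additive.minus[OF additive_trp] additive.minus[OF additive_restr])

lemma lifts_tau: "lifts Tg T \<Longrightarrow> lifts (tau Tg) (tau T)"
  using lifts_add[OF _ lifts_uminus, of Tg T] by (simp add: tau_def[abs_def])

lemma lifts_norm_op: assumes "lifts Tg T" shows "lifts (norm_op k Tg) (norm_op k T)"
proof (induction k)
  case 0
  have "norm_op 0 Tg = (\<lambda>x. 0)" "norm_op 0 T = (\<lambda>x. 0)" by (rule ext, simp add: norm_op_def)+
  then show ?case using lifts_zero by (simp only:)
next
  case (Suc k)
  have "norm_op (Suc k) Tg = (\<lambda>x. norm_op k Tg x + (Tg ^^ k) x)"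
    "norm_op (Suc k) T = (\<lambda>x. norm_op k T x + (T ^^ k) x)" by (rule ext, simp add: norm_op_def)+
  then show ?case using lifts_add[OF Suc lifts_funpow[OF assms, of k]] by (simp only:)
qed

text \<open>A nontrivial element stabilising a simplex fixes each of its vertices by
  \<open>simplex_fixed\<close>, and \<open>stab\<close> sends all such vertices to fixed ones at one
  common stage. The infinitely many simplices of a chain thus become fixed simultaneously.\<close>

lemma nonfree_thread:
  assumes c: "c \<in> chains p (Vs n) q" and nf: "\<And>vs. c vs \<noteq> 0 \<Longrightarrow> set vs \<notin> Fr n"
  shows "thread n c \<in> Fg q"
proof -
  obtain k where k: "n \<le> k"
    "\<forall>U\<in>Vs n. (\<exists>i<p. \<exists>j<p. (i, j) \<noteq> (0, 0) \<and> (a ^^ i \<circ> b ^^ j) ` U = U) \<longrightarrow> tr n k U \<in> Fx k"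
    using stab[of n] by (elim exE conjE)
  have "set ws \<subseteq> Fx k" if ne: "trp n k c ws \<noteq> 0" for ws
  proof -
    obtain vs where vs: "c vs \<noteq> 0" "map (tr n k) vs = ws"
      using push_supp[OF ne[unfolded trp_def]] by (elim exE conjE)
    have s: "set vs \<subseteq> Vs n" "\<Inter>(set vs) \<noteq> {}" using chains_supp[OF c vs(1)] by simp_all
    have "\<not> (\<forall>k. k \<in> Ix \<longrightarrow> el k ` set vs = set vs \<longrightarrow> k = (0, 0))"
      using nf[OF vs(1)] s(1) unfolding Fr_def Ball_def mem_Collect_eq by (simp only: simp_thms)
    then obtain l where l: "l \<in> Ix" "el l ` set vs = set vs" "l \<noteq> (0, 0)"
      unfolding not_all not_imp by (elim exE conjE)
    obtain g where g: "g \<in> \<Gamma>" "el l = (`) g" using el_in_G[OF l(1)] by blast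
    obtain i j where ij: "l = (i, j)" "i < p" "j < p" using l(1) by (cases l) auto
    have "tr n k U \<in> Fx k" if U: "U \<in> set vs" for U
    proof -
      have "g ` U = U" by (rule simplex_fixed[OF s g(1) l(2)[unfolded g(2)] U])
      then have "el l U = U" by (simp only: g(2))
      then have "(a ^^ i \<circ> b ^^ j) ` U = U" unfolding ij(1) el_def fst_conv snd_conv .
      moreover have "U \<in> Vs n" using s(1) U by blast
      ultimately show ?thesis using k(2) ij l(3) by blast
    qed
    then show ?thesis using vs(2) by auto
  qed
  then have "trp n k c \<in> chains p (Fx k) q"
    using trp_chains[OF k(1) c] unfolding chains_def by simp
  then have "thread k (trp n k c) \<in> Fg q" by (rule FgI)
  then show ?thesis unfolding thread_trp[OF k(1)] .
qed

lemma fixed_el: assumes U: "U \<in> Fx n" and k: "k \<in> Ix" shows "el k U = U"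
proof -
  obtain g where g: "g \<in> \<Gamma>" "el k = (`) g" using el_in_G[OF k] by (rule bexE)
  show ?thesis unfolding g(2) using U g(1) unfolding Fx_def by blast
qed

text \<open>A simplex with fixed vertices is stabilised by \<open>(1, 0)\<close>, a nonzero index
  because \<open>p > 1\<close>.\<close>

lemma restr_fixed:
  assumes c: "c \<in> chains p (Fx n) q" shows "restr (Fr n) c = 0"
proof
  fix vs
  have "set vs \<notin> Fr n" if "c vs \<noteq> 0"
  proof
    assume s: "set vs \<in> Fr n"
    have "set vs \<subseteq> Fx n" using chains_supp[OF c that] by (elim conjE)
    then have "el (1, 0) U = U" if "U \<in> set vs" for U using fixed_el[OF _ Ix_10] that by blast
    then have "el (1, 0) ` set vs = set vs" using image_cong[OF refl, of "set vs" "el (1, 0)" "\<lambda>U. U"] by simp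
    then show False using FrD[OF s Ix_10] by simp
  qed
  then show "restr (Fr n) c vs = 0 vs" by (auto simp: restr_def)
qed

text \<open>Moves representatives late enough and keeps the part on free simplices. There the
  relations hold exactly and not only modulo \<open>Fg\<close>: the error terms are chains on fixed
  vertices, which the restriction kills. The discarded part lies in \<open>Fg\<close> by
  \<open>nonfree_thread\<close>. Two operators are treated together so that they share one
  representative.\<close>

lemma free_split:
  assumes x: "x \<in> Cg q" and S: "lifts Sg S" "Sg x \<in> Fg q" and T: "lifts Tg T" "Tg x \<in> Fg q"
  shows "\<exists>n c. c \<in> chains p (Vs n) q \<and> (\<forall>vs. c vs \<noteq> 0 \<longrightarrow> set vs \<in> Fr n) \<and> S c = 0 \<and> T c = 0 \<and>
    x - thread n c \<in> Fg q"
proof -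
  obtain n c where c: "c \<in> chains p (Vs n) q" "x = thread n c" using x by (rule CgE)
  have late: "\<exists>l0. \<forall>l\<ge>l0. n \<le> l \<and> R (restr (Fr l) (trp n l c)) = 0" if R: "lifts Rg R" "Rg x \<in> Fg q" for Rg R
  proof -
    obtain m f where f: "f \<in> chains p (Fx m) q" "Rg x = thread m f" using R(2) by (rule FgE)
    have "thread n (R c) = thread m f" using f(2) lifts_thread[OF R(1) c(1)] c(2) by simp
    then obtain l0 where l0: "\<forall>l\<ge>l0. n \<le> l \<and> m \<le> l \<and> trp n l (R c) = trp m l f"
      using thread_eqD by blast
    have "n \<le> l \<and> R (restr (Fr l) (trp n l c)) = 0" if "l \<ge> l0" for l
    proof -
      have l: "n \<le> l" "m \<le> l" "trp n l (R c) = trp m l f" using l0 that by simp_all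
      have "R (restr (Fr l) (trp n l c)) = restr (Fr l) (R (trp n l c))"
        by (rule lifts_restr[OF R(1) trp_chains[OF l(1) c(1)]])
      also have "R (trp n l c) = trp m l f" using lifts_trp[OF R(1) c(1) l(1)] l(3) by simp
      also have "restr (Fr l) (trp m l f) = 0" by (rule restr_fixed[OF trp_Fx[OF l(2) f(1)]])
      finally show ?thesis using l(1) by simp
    qed
    then show ?thesis by blast
  qed
  obtain l1 where l1: "\<forall>l\<ge>l1. n \<le> l \<and> S (restr (Fr l) (trp n l c)) = 0" using late[OF S] by blast
  obtain l2 where l2: "\<forall>l\<ge>l2. n \<le> l \<and> T (restr (Fr l) (trp n l c)) = 0" using late[OF T] by blast
  define l where "l = max l1 l2"
  have l: "n \<le> l" "S (restr (Fr l) (trp n l c)) = 0" "T (restr (Fr l) (trp n l c)) = 0"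
    using l1[rule_format, of l] l2[rule_format, of l] by (simp_all add: l_def)
  define d where "d = trp n l c"
  have d: "d \<in> chains p (Vs l) q" unfolding d_def by (rule trp_chains[OF l(1) c(1)])
  have "x - thread l (restr (Fr l) d) = thread l (d - restr (Fr l) d)"
    using thread_trp[OF l(1), of c] c(2) by (simp add: thread_diff d_def)
  moreover have "thread l (d - restr (Fr l) d) \<in> Fg q"
    by (rule nonfree_thread[OF chains_minus[OF d restr_chains[OF d]]]) (auto simp: restr_def split: if_splits)
  ultimately show ?thesis using l(2,3) restr_chains[OF d]
    by (intro exI[of _ l] exI[of _ "restr (Fr l) d"]) (auto simp: restr_def d_def)
qed

end

section \<open>The germs form a relatively free pair\<close>

context pair_system
begin

lemma lifts_A: "lifts Ag A" using lifts_pull[OF Ix_10] unfolding el_10 .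
lemma lifts_B: "lifts Bg B" using lifts_pull[OF Ix_01] unfolding el_01 .

lemma lifts_Cg: assumes T: "lifts Tg T" and x: "x \<in> Cg q" shows "Tg x \<in> Cg q"
proof -
  obtain n c where c: "c \<in> chains p (Vs n) q" "x = thread n c" using x by (rule CgE)
  show ?thesis unfolding c(2) lifts_thread[OF T c(1)] by (rule CgI[OF lifts_chains[OF T c(1)]])
qed

lemma bdg_Cg: assumes "x \<in> Cg (Suc q)" shows "bdg x \<in> Cg q"
proof -
  obtain n c where c: "c \<in> chains p (Vs n) (Suc q)" "x = thread n c" using assms by (rule CgE)
  show ?thesis unfolding c(2) bdg_thread[OF c(1)] by (rule CgI[OF boundary_chains[OF c(1) lfin]])
qed

lemma bdg_Fg: assumes "x \<in> Fg (Suc q)" shows "bdg x \<in> Fg q"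
proof -
  obtain n c where c: "c \<in> chains p (Fx n) (Suc q)" "x = thread n c" using assms by (rule FgE)
  show ?thesis unfolding c(2) bdg_thread[OF Fx_chains[OF c(1)]] Fx_boundary[OF c(1), symmetric]
    by (rule FgI[OF boundary_chains[OF c(1) F.lfin]])
qed

lemma bdg_0: assumes "x \<in> Cg 0" shows "bdg x = 0"
proof -
  obtain n c where c: "c \<in> chains p (Vs n) 0" "x = thread n c" using assms by (rule CgE)
  show ?thesis unfolding c(2) bdg_thread[OF c(1)] boundary_0_chain[OF c(1)] by (rule thread_0)
qed

lemma bdg_bdg: assumes x: "x \<in> Cg q" shows "bdg (bdg x) = 0"
proof (cases q)
  case 0
  have "bdg x = 0" by (rule bdg_0) (use x 0 in simp)
  then show ?thesis by (simp add: additive.zero[OF additive_bdg])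
next
  case (Suc q')
  obtain n c where c: "c \<in> chains p (Vs n) (Suc q')" "x = thread n c" using x unfolding Suc by (rule CgE)
  show ?thesis unfolding c(2) bdg_thread[OF c(1)] bdg_thread[OF boundary_chains[OF c(1) lfin]]
      boundary_boundary[OF c(1) lfin] by (rule thread_0)
qed

lemma lifts_bdg:
  assumes T: "lifts Tg T" and comm: "\<And>n c. T (boundary (nbr (Vs n)) c) = boundary (nbr (Vs n)) (T c)"
    and x: "x \<in> Cg q"
  shows "Tg (bdg x) = bdg (Tg x)"
proof (cases q)
  case 0
  have "Tg x \<in> Cg 0" using lifts_Cg[OF T x] 0 by simp
  then have "bdg (Tg x) = 0" by (rule bdg_0)
  moreover have "bdg x = 0" by (rule bdg_0) (use x 0 in simp)
  ultimately show ?thesis using additive.zero[OF lifts_additive(1)[OF T]] by simp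
next
  case (Suc q')
  obtain n c where c: "c \<in> chains p (Vs n) (Suc q')" "x = thread n c" using x unfolding Suc by (rule CgE)
  show ?thesis unfolding c(2) bdg_thread[OF c(1)] lifts_thread[OF T c(1)] bdg_thread[OF lifts_chains[OF T c(1)]]
      lifts_thread[OF T boundary_chains[OF c(1) lfin]] comm ..
qed

lemma pull_el_boundary:
  assumes k: "k \<in> Ix"
  shows "pull (el k) (boundary (nbr (Vs n)) c) = boundary (nbr (Vs n)) (pull (el k) c)"
proof -
  obtain g where g: "g \<in> \<Gamma>" "el k = (`) g" using el_in_G[OF k] by (rule bexE)
  obtain h where h: "h \<in> \<Gamma>" "g \<circ> h = id" "h \<circ> g = id" using inv_G[OF g(1)] by (elim bexE conjE)
  have "(`) g ` Vs n = Vs n"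
  proof
    show "(`) g ` Vs n \<subseteq> Vs n" using Vs_inv g(1) by blast
    show "Vs n \<subseteq> (`) g ` Vs n"
    proof
      fix U assume "U \<in> Vs n"
      then have "h ` U \<in> Vs n" using Vs_inv h(1) by blast
      moreover have "U = g ` (h ` U)" using h(2) by (simp add: image_comp)
      ultimately show "U \<in> (`) g ` Vs n" by (rule rev_image_eqI)
    qed
  qed
  moreover have "inj g" using h(3) by (metis inj_on_id inj_on_imageI2)
  ultimately show ?thesis unfolding g(2) by (rule boundary_pull[symmetric])
qed

lemma pull_fixed:
  assumes k: "k \<in> Ix" and c: "c \<in> chains p (Fx n) q" shows "pull (el k) c = c"
proof
  fix vs
  show "pull (el k) c vs = c vs"
  proof (cases "set vs \<subseteq> Fx n")
    case True
    then have "map (el k) vs = vs" using fixed_el[OF _ k] by (intro map_idI) blast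
    then show ?thesis by (simp add: pull_def)
  next
    case False
    have "c (map (el k) vs) = 0"
    proof (rule ccontr)
      assume "c (map (el k) vs) \<noteq> 0"
      then have s: "set (map (el k) vs) \<subseteq> Fx n" using chains_supp[OF c] by blast
      have "U \<in> Fx n" if U: "U \<in> set vs" for U
      proof -
        have F: "el k U \<in> Fx n" using s U by auto
        have "el (df (0, 0) k) (el k U) = U" by (simp add: el_df[OF k])
        moreover have "el (df (0, 0) k) (el k U) = el k U" by (rule fixed_el[OF F df_Ix])
        ultimately show ?thesis using F by simp
      qed
      then show False using False by blast
    qed
    moreover have "c vs = 0" using chains_supp[OF c, of vs] False by blast
    ultimately show ?thesis by (simp add: pull_def)
  qed
qed

lemma germ_pull_fixed:
  assumes k: "k \<in> Ix" and x: "x \<in> Fg q" shows "germ_map (\<lambda>_. pull (el k)) x = x"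
proof -
  obtain n c where c: "c \<in> chains p (Fx n) q" "x = thread n c" using x by (rule FgE)
  show ?thesis unfolding c(2) lifts_thread[OF lifts_pull[OF k] Fx_chains[OF c(1)]] pull_fixed[OF k c(1)] ..
qed

lemma germ_pull_order:
  assumes g: "g ^^ p = id" and T: "lifts Tg (pull ((`) g))" and x: "x \<in> Cg q" shows "(Tg ^^ p) x = x"
proof -
  obtain n c where c: "c \<in> chains p (Vs n) q" "x = thread n c" using x by (rule CgE)
  have "(pull ((`) g) ^^ p) c = c"
    unfolding funpow_pull image_funpow g by (simp add: pull_def fun_eq_iff)
  then show ?thesis unfolding c(2) lifts_thread[OF lifts_funpow[OF T] c(1)] by simp
qed

lemma thread_nmult: "thread n (nmult j c) = nmult j (thread n c)"
  by (rule additive_nmult_commute[OF additive_thread])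

lemma nmult_apply: "nmult j c vs = nmult j (c vs)" for c :: "'v \<Rightarrow> 'k::ab_group_add"
  by (simp add: nmult_def sum_fun_apply)

lemma Cg_tors: assumes "x \<in> Cg q" shows "nmult p x = 0"
proof -
  obtain n c where c: "c \<in> chains p (Vs n) q" "x = thread n c" using assms by (rule CgE)
  have "nmult p c = 0" using chains_tors[OF c(1)] by (simp add: fun_eq_iff nmult_apply)
  then show ?thesis unfolding c(2) thread_nmult[symmetric] by (simp add: thread_0)
qed

lemma Cg_top: assumes "x \<in> Cg q" "N \<le> q" shows "x = 0"
proof -
  obtain n c where c: "c \<in> chains p (Vs n) q" "x = thread n c" using assms(1) by (rule CgE)
  show ?thesis unfolding c(2) chains_top_0[OF c(1) assms(2)] by (rule thread_0)
qed

lemma lifts_eq: assumes T: "lifts Tg T" and y: "y \<in> chains p (Vs n) q" shows "thread n (T y) = Tg (thread n y)"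
  by (rule lifts_thread[OF T y, symmetric])

lemmas lA = lifts_norm_op[OF lifts_A, of p] and lB = lifts_norm_op[OF lifts_B, of p]

lemma germ_ker_tau:
  assumes "x \<in> Cg q" "tau Ag x \<in> Fg q" shows "\<exists>y\<in>Cg q. x - norm_op p Ag y \<in> Fg q"
proof -
  obtain n c where c: "c \<in> chains p (Vs n) q" "\<forall>vs. c vs \<noteq> 0 \<longrightarrow> set vs \<in> Fr n" "tau A c = 0" "x - thread n c \<in> Fg q"
    using free_split[OF assms(1) lifts_tau[OF lifts_A] assms(2) lifts_tau[OF lifts_A] assms(2)]
    by (elim exE conjE)
  obtain y where y: "y \<in> chains p (Vs n) q" "c = norm_op p A y"
    using free_ker_tau[OF c(1) c(2)[rule_format] c(3)] by (rule bexE)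
  show ?thesis using c(4) unfolding y(2) lifts_eq[OF lA y(1)] by (rule bexI[OF _ CgI[OF y(1)]])
qed

lemma germ_ker_norm:
  assumes "x \<in> Cg q" "norm_op p Ag x \<in> Fg q" shows "\<exists>y\<in>Cg q. x - tau Ag y \<in> Fg q"
proof -
  obtain n c where c: "c \<in> chains p (Vs n) q" "\<forall>vs. c vs \<noteq> 0 \<longrightarrow> set vs \<in> Fr n" "norm_op p A c = 0" "x - thread n c \<in> Fg q"
    using free_split[OF assms(1) lA assms(2) lA assms(2)] by (elim exE conjE)
  obtain y where y: "y \<in> chains p (Vs n) q" "c = tau A y"
    using free_ker_norm[OF c(1) c(2)[rule_format] c(3)] by (rule bexE)
  show ?thesis using c(4) unfolding y(2) lifts_eq[OF lifts_tau[OF lifts_A] y(1)]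
    by (rule bexI[OF _ CgI[OF y(1)]])
qed

lemma germ_ker_tau_tau:
  assumes "x \<in> Cg q" "tau Ag x \<in> Fg q" "tau Bg x \<in> Fg q"
  shows "\<exists>y\<in>Cg q. x - norm_op p Ag (norm_op p Bg y) \<in> Fg q"
proof -
  obtain n c where c: "c \<in> chains p (Vs n) q" "\<forall>vs. c vs \<noteq> 0 \<longrightarrow> set vs \<in> Fr n" "tau A c = 0" "tau B c = 0"
      "x - thread n c \<in> Fg q"
    using free_split[OF assms(1) lifts_tau[OF lifts_A] assms(2) lifts_tau[OF lifts_B] assms(3)]
    by (elim exE conjE)
  obtain y where y: "y \<in> chains p (Vs n) q" "c = norm_op p A (norm_op p B y)"
    using free_ker_tau_tau[OF c(1) c(2)[rule_format] c(3,4)] by (rule bexE)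
  show ?thesis using c(5) unfolding y(2) lifts_eq[OF lifts_comp[OF lA lB] y(1)]
    by (rule bexI[OF _ CgI[OF y(1)]])
qed

lemma germ_ker_norm_norm:
  assumes "x \<in> Cg q" "norm_op p Ag (norm_op p Bg x) \<in> Fg q"
  shows "\<exists>y\<in>Cg q. \<exists>z\<in>Cg q. x - tau Ag y - tau Bg z \<in> Fg q"
proof -
  obtain n c where c: "c \<in> chains p (Vs n) q" "\<forall>vs. c vs \<noteq> 0 \<longrightarrow> set vs \<in> Fr n"
      "norm_op p A (norm_op p B c) = 0" "x - thread n c \<in> Fg q"
    using free_split[OF assms(1) lifts_comp[OF lA lB] assms(2) lifts_comp[OF lA lB] assms(2)]
    by (elim exE conjE)
  have "\<exists>y\<in>chains p (Vs n) q. \<exists>z\<in>chains p (Vs n) q. c = tau A y + tau B z"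
    by (rule free_ker_norm_norm[OF c(1) _ c(3)]) (use c(2) in blast)
  then obtain y z where yz: "y \<in> chains p (Vs n) q" "z \<in> chains p (Vs n) q" "c = tau A y + tau B z"
    by (elim bexE)
  have "x - tau Ag (thread n y) - tau Bg (thread n z) \<in> Fg q"
    using c(4) unfolding yz(3) additive.add[OF additive_thread]
      lifts_eq[OF lifts_tau[OF lifts_A] yz(1)] lifts_eq[OF lifts_tau[OF lifts_B] yz(2)] diff_diff_add .
  then show ?thesis using CgI[OF yz(1)] CgI[OF yz(2)] by blast
qed

lemma free_pair_germs:
  "free_pair (Cg :: nat \<Rightarrow> ('a set list \<Rightarrow> 'k::ab_group_add) germ set) Fg bdg Ag Bg p N"
proof
  fix q and x y :: "('a set list \<Rightarrow> 'k) germ"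
  show "0 \<in> Cg q" using CgI[OF chains_zero, of 0 q] by (simp add: thread_0)
  show "0 \<in> Fg q" using FgI[OF chains_zero, of 0 q] by (simp add: thread_0)
  show "x \<in> Cg q \<Longrightarrow> y \<in> Cg q \<Longrightarrow> x - y \<in> Cg q" by (rule Cg_diff)
  show "x \<in> Fg q \<Longrightarrow> y \<in> Fg q \<Longrightarrow> x - y \<in> Fg q" by (rule Fg_diff)
  show "x \<in> Fg q \<Longrightarrow> x \<in> Cg q" by (elim FgE) (simp add: CgI Fx_chains)
  show "x \<in> Cg (Suc q) \<Longrightarrow> bdg x \<in> Cg q" by (rule bdg_Cg)
  show "x \<in> Fg (Suc q) \<Longrightarrow> bdg x \<in> Fg q" by (rule bdg_Fg)
  show "x \<in> Cg 0 \<Longrightarrow> bdg x = 0" by (rule bdg_0)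
  show "x \<in> Cg q \<Longrightarrow> bdg (bdg x) = 0" by (rule bdg_bdg)
  show "x \<in> Cg q \<Longrightarrow> Ag x \<in> Cg q" by (rule lifts_Cg[OF lifts_A])
  show "x \<in> Cg q \<Longrightarrow> Bg x \<in> Cg q" by (rule lifts_Cg[OF lifts_B])
  show "x \<in> Cg q \<Longrightarrow> Ag (bdg x) = bdg (Ag x)"
    by (rule lifts_bdg[OF lifts_A]) (rule pull_el_boundary[OF Ix_10, unfolded el_10])
  show "x \<in> Cg q \<Longrightarrow> Bg (bdg x) = bdg (Bg x)"
    by (rule lifts_bdg[OF lifts_B]) (rule pull_el_boundary[OF Ix_01, unfolded el_01])
  show "Ag (Bg x) = Bg (Ag x)"
  proof -
    have e: "(`) b \<circ> (`) a = (`) a \<circ> (`) b"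
      by (rule ext) (simp only: comp_apply image_comp ab_commute)
    have "A (B c) = B (A c)" for c :: "'a set list \<Rightarrow> 'k"
      by (rule ext) (simp only: pull_def map_map e)
    then show ?thesis by (induction x rule: germ.abs_induct) (simp add: germ_map.abs_eq)
  qed
  show "x \<in> Cg q \<Longrightarrow> (Ag ^^ p) x = x" by (rule germ_pull_order[OF ap lifts_A])
  show "x \<in> Cg q \<Longrightarrow> (Bg ^^ p) x = x" by (rule germ_pull_order[OF bp lifts_B])
  show "x \<in> Fg q \<Longrightarrow> Ag x = x" using germ_pull_fixed[OF Ix_10] unfolding el_10 .
  show "x \<in> Fg q \<Longrightarrow> Bg x = x" using germ_pull_fixed[OF Ix_01] unfolding el_01 .
  show "x \<in> Cg q \<Longrightarrow> nmult p x = 0" by (rule Cg_tors)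
  show "x \<in> Cg q \<Longrightarrow> N \<le> q \<Longrightarrow> x = 0" by (rule Cg_top)
  show "bdg (x + y) = bdg x + bdg y" by (rule additive.add[OF additive_bdg])
  show "Ag (x + y) = Ag x + Ag y" by (rule additive.add[OF lifts_additive(1)[OF lifts_A]])
  show "Bg (x + y) = Bg x + Bg y" by (rule additive.add[OF lifts_additive(1)[OF lifts_B]])
  show "x \<in> Cg q \<Longrightarrow> tau Ag x \<in> Fg q \<Longrightarrow> \<exists>y\<in>Cg q. x - norm_op p Ag y \<in> Fg q" by (rule germ_ker_tau)
  show "x \<in> Cg q \<Longrightarrow> norm_op p Ag x \<in> Fg q \<Longrightarrow> \<exists>y\<in>Cg q. x - tau Ag y \<in> Fg q" by (rule germ_ker_norm)
  show "x \<in> Cg q \<Longrightarrow> tau Ag x \<in> Fg q \<Longrightarrow> tau Bg x \<in> Fg q \<Longrightarrow>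
      \<exists>y\<in>Cg q. x - norm_op p Ag (norm_op p Bg y) \<in> Fg q" by (rule germ_ker_tau_tau)
  show "x \<in> Cg q \<Longrightarrow> norm_op p Ag (norm_op p Bg x) \<in> Fg q \<Longrightarrow>
      \<exists>y\<in>Cg q. \<exists>z\<in>Cg q. x - tau Ag y - tau Bg z \<in> Fg q" by (rule germ_ker_norm_norm)
qed

text \<open>The boundary of a given representative vanishes only eventually, so the representative
  is moved to a later stage.\<close>

lemma germ_cycle:
  assumes x: "x \<in> Cg q" and bx: "bdg x = 0" shows "\<exists>n. \<exists>c\<in>cycles p (Vs n) q. x = thread n c"
proof -
  obtain n c where c: "c \<in> chains p (Vs n) q" "x = thread n c" using x by (rule CgE)
  have "thread n (boundary (nbr (Vs n)) c) = thread n 0" using bx c by (simp add: bdg_thread thread_0)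
  from thread_eqD[OF this] obtain l0 where
    l0: "\<forall>l\<ge>l0. n \<le> l \<and> n \<le> l \<and> trp n l (boundary (nbr (Vs n)) c) = trp n l 0" by (rule exE)
  have l: "n \<le> l0" "trp n l0 (boundary (nbr (Vs n)) c) = 0"
    using l0[rule_format, of l0] by (simp_all add: additive.zero[OF additive_trp])
  then have "trp n l0 c \<in> cycles p (Vs l0) q"
    using trp_chains[OF l(1) c(1)] boundary_trp[OF l(1) c(1)] by (simp add: cycles_def)
  moreover have "x = thread l0 (trp n l0 c)" using thread_trp[OF l(1), of c] c(2) by simp
  ultimately show ?thesis by blast
qed

lemma homologous_thread:
  assumes k: "n \<le> k" "m \<le> k" and h: "homologous p (Vs k) q (trp n k c) (trp m k d)"
  shows "\<exists>e\<in>Cg (Suc q). thread n c - thread m d = bdg e"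
proof -
  obtain e where e: "e \<in> chains p (Vs k) (Suc q)" "boundary (nbr (Vs k)) e = trp n k c - trp m k d"
    using h unfolding homologous_def by (rule bexE)
  have "thread n c - thread m d = thread k (trp n k c - trp m k d)"
    by (simp add: thread_diff thread_trp k)
  also have "\<dots> = bdg (thread k e)" unfolding bdg_thread[OF e(1)] e(2) ..
  finally show ?thesis using CgI[OF e(1)] by blast
qed

lemma germ_classes:
  assumes "class_bound TYPE('k::ab_group_add) p q M" and M: "M > 0"
  shows "\<exists>cl :: ('a set list \<Rightarrow> 'k) germ \<Rightarrow> nat. (\<forall>x. cl x < M) \<and>
    (\<forall>x\<in>Cg q. \<forall>y\<in>Cg q. bdg x = 0 \<longrightarrow> bdg y = 0 \<longrightarrow> cl x = cl y \<longrightarrow> (\<exists>e\<in>Cg (Suc q). x - y = bdg e))"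
proof -
  obtain cl :: "nat \<Rightarrow> ('a set list \<Rightarrow> 'k) \<Rightarrow> nat" where
    cl: "\<forall>n n'. \<forall>c\<in>cycles p (Vs n) q. \<forall>c'\<in>cycles p (Vs n') q. cl n c < M \<and>
       (cl n c = cl n' c' \<longrightarrow> (\<exists>k\<ge>max n n'. homologous p (Vs k) q (trp n k c) (trp n' k c')))"
    using assms(1) unfolding class_bound_def by (rule exE)
  define rp where "rp = (\<lambda>x. SOME (nc :: nat \<times> ('a set list \<Rightarrow> 'k)). snd nc \<in> cycles p (Vs (fst nc)) q \<and> x = thread (fst nc) (snd nc))"
  \<comment> \<open>The value off the cycles is arbitrary below \<open>M\<close>; taking 0 is where
    \<open>M > 0\<close> enters.\<close>
  define cl' where "cl' = (\<lambda>x. if x \<in> Cg q \<and> bdg x = 0 then cl (fst (rp x)) (snd (rp x)) else 0)"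
  have rp: "snd (rp x) \<in> cycles p (Vs (fst (rp x))) q \<and> x = thread (fst (rp x)) (snd (rp x))"
    if x: "x \<in> Cg q" "bdg x = 0" for x
  proof -
    obtain n c where "c \<in> cycles p (Vs n) q" "x = thread n c" using germ_cycle[OF x] by (elim exE bexE)
    then have "\<exists>nc. snd nc \<in> cycles p (Vs (fst nc)) q \<and> x = thread (fst nc) (snd nc)"
      by (intro exI[of _ "(n, c)"]) simp
    then show ?thesis unfolding rp_def by (rule someI_ex)
  qed
  have "cl' x < M" for x
    using rp[of x] cl M unfolding cl'_def by auto
  moreover have "\<exists>e\<in>Cg (Suc q). x - y = bdg e"
    if x: "x \<in> Cg q" "bdg x = 0" and y: "y \<in> Cg q" "bdg y = 0" and e: "cl' x = cl' y" for x y
  proof -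
    have "cl (fst (rp x)) (snd (rp x)) = cl (fst (rp y)) (snd (rp y))" using e x y by (simp add: cl'_def)
    then obtain k where k: "k \<ge> max (fst (rp x)) (fst (rp y))"
      "homologous p (Vs k) q (trp (fst (rp x)) k (snd (rp x))) (trp (fst (rp y)) k (snd (rp y)))"
      using cl rp[OF x] rp[OF y] by blast
    have "\<exists>e\<in>Cg (Suc q). thread (fst (rp x)) (snd (rp x)) - thread (fst (rp y)) (snd (rp y)) = bdg e"
      by (rule homologous_thread[OF _ _ k(2)]) (use k(1) in simp_all)
    then show ?thesis using rp[OF x] rp[OF y] by simp
  qed
  ultimately show ?thesis by (intro exI[of _ cl']) blast
qed

text \<open>Passage from stages to germs. A multiple of \<open>w\<close> that bounds in
  \<open>Fg\<close> already bounds in \<open>Fx k\<close> at some stage, and a difference of two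
  multiples with factors below \<open>p\<close> is, up to sign, a single multiple with factor
  strictly between 0 and \<open>p\<close>.\<close>

theorem no_small_fixed_class:
  fixes w :: "'a set list \<Rightarrow> 'k::ab_group_add"
  assumes rm: "r < m" and cb: "\<And>q. class_bound TYPE('k) p q (if q = m then p else 1)"
    and w: "w \<in> cycles p (Fx n0) r"
    and nz: "\<And>j k. 0 < j \<Longrightarrow> j < p \<Longrightarrow> n0 \<le> k \<Longrightarrow> \<not> homologous p (Fx k) r (F.trp n0 k (nmult j w)) 0"
  shows False
proof -
  interpret fp: free_pair "Cg :: nat \<Rightarrow> ('a set list \<Rightarrow> 'k) germ set" Fg bdg Ag Bg p N by (rule free_pair_germs)
  have w': "w \<in> chains p (Fx n0) r" "boundary (nbr (Fx n0)) w = 0" using w by (simp_all add: cycles_def)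
  have never: False if j: "0 < j" "j < p" and e: "e \<in> Fg (Suc r)" "nmult j (thread n0 w) = bdg e" for j e
  proof -
    obtain l f where f: "f \<in> chains p (Fx l) (Suc r)" "e = thread l f" using e(1) by (rule FgE)
    have "thread n0 (nmult j w) = thread l (boundary (nbr (Vs l)) f)"
      using e(2) unfolding f(2) bdg_thread[OF Fx_chains[OF f(1)]] thread_nmult .
    from thread_eqD[OF this] obtain k where
      "\<forall>i\<ge>k. n0 \<le> i \<and> l \<le> i \<and> trp n0 i (nmult j w) = trp l i (boundary (nbr (Vs l)) f)" by (rule exE)
    then have k: "n0 \<le> k" "l \<le> k" "trp n0 k (nmult j w) = trp l k (boundary (nbr (Vs l)) f)" by simp_all
    have jw: "nmult j w \<in> chains p (Fx n0) r" unfolding nmult_def using w'(1) by (intro chains_sum)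
    have "boundary (nbr (Fx k)) (trp l k f) = trp l k (boundary (nbr (Vs l)) f)"
      unfolding Fx_boundary[OF trp_Fx[OF k(2) f(1)]] by (rule boundary_trp[OF k(2) Fx_chains[OF f(1)]])
    then have "boundary (nbr (Fx k)) (trp l k f) = F.trp n0 k (nmult j w) - 0"
      unfolding Fx_trp[OF k(1) jw] k(3) by simp
    then have "homologous p (Fx k) r (F.trp n0 k (nmult j w)) 0"
      unfolding homologous_def using trp_Fx[OF k(2) f(1)] by (rule bexI)
    then show False using nz[OF j k(1)] by contradiction
  qed
  have "\<exists>cl :: ('a set list \<Rightarrow> 'k) germ \<Rightarrow> nat. (\<forall>x. cl x < p) \<and>
    (\<forall>x\<in>Cg m. \<forall>y\<in>Cg m. bdg x = 0 \<longrightarrow> bdg y = 0 \<longrightarrow> cl x = cl y \<longrightarrow> (\<exists>e\<in>Cg (Suc m). x - y = bdg e))"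
    using germ_classes[of m p] cb[of m] p1 by simp
  then obtain cl :: "('a set list \<Rightarrow> 'k) germ \<Rightarrow> nat" where cl: "\<forall>x. cl x < p"
    "\<forall>x\<in>Cg m. \<forall>y\<in>Cg m. bdg x = 0 \<longrightarrow> bdg y = 0 \<longrightarrow> cl x = cl y \<longrightarrow> (\<exists>e\<in>Cg (Suc m). x - y = bdg e)"
    by (elim exE conjE)
  show False
  proof (rule fp.no_small_fixed_homology[OF p1 rm])
    fix q and x :: "('a set list \<Rightarrow> 'k) germ"
    assume q: "q \<noteq> m" and x: "x \<in> Cg q" "bdg x = 0"
    \<comment> \<open>With only one label, every cycle is compared with the zero cycle and is
      therefore a boundary.\<close>
    have "class_bound TYPE('k) p q 1" using cb[of q] q by simp
    from germ_classes[OF this] obtain cl0 :: "('a set list \<Rightarrow> 'k) germ \<Rightarrow> nat" where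
      cl0: "\<forall>x. cl0 x < 1"
      "\<forall>x\<in>Cg q. \<forall>y\<in>Cg q. bdg x = 0 \<longrightarrow> bdg y = 0 \<longrightarrow> cl0 x = cl0 y \<longrightarrow> (\<exists>e\<in>Cg (Suc q). x - y = bdg e)"
      by auto
    have "\<exists>e\<in>Cg (Suc q). x - 0 = bdg e"
      using cl0(2)[rule_format, OF x(1) fp.C0 x(2) additive.zero[OF additive_bdg]] cl0(1) by simp
    then show "\<exists>y\<in>Cg (Suc q). x = bdg y" by simp
  next
    show "cl x < p" for x by (rule cl(1)[rule_format])
    show "\<exists>e\<in>Cg (Suc m). x - y = bdg e"
      if "x \<in> Cg m" "y \<in> Cg m" "bdg x = 0" "bdg y = 0" "cl x = cl y" for x y
      using cl(2) that by blast
    show "thread n0 w \<in> Fg r" by (rule FgI[OF w'(1)])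
    show "bdg (thread n0 w) = 0"
      using w' by (simp add: bdg_thread[OF Fx_chains[OF w'(1)]] Fx_boundary[OF w'(1), symmetric] thread_0)
    fix j k and e :: "('a set list \<Rightarrow> 'k) germ"
    assume j: "j < p" and k: "k < p" and e: "e \<in> Fg (Suc r)"
      and eq: "nmult j (thread n0 w) - nmult k (thread n0 w) = bdg e"
    have sub: "nmult (i - l) x = nmult i x - nmult l x" if "l \<le> i" for i l and x :: "('a set list \<Rightarrow> 'k) germ"
      using nmult_add[of l "i - l" x] that by simp
    show "j = k"
    proof (rule linorder_cases[of j k])
      assume "k < j"
      then have "nmult (j - k) (thread n0 w) = bdg e" using sub[of k j "thread n0 w"] eq by simp
      moreover have "0 < j - k" "j - k < p" using \<open>k < j\<close> j by arith+
      ultimately show ?thesis using never e by blast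
    next
      assume jk: "j < k"
      have "nmult (k - j) (thread n0 w) = bdg (- e)"
        using sub[of j k "thread n0 w"] jk by (simp add: additive.minus[OF additive_bdg] flip: eq)
      moreover have "0 < k - j" "k - j < p" using jk k by arith+
      ultimately show ?thesis using never fp.Fminus[OF e] by blast
    qed
  qed
qed

end

section \<open>From the group action to the covering system\<close>

lemma coarse_equivalence_dense:
  assumes "coarse_equivalence Y Z id" shows "\<exists>C\<ge>0. \<forall>z\<in>Z. \<exists>y\<in>Y. dist z y \<le> C"
proof -
  from assms[unfolded coarse_equivalence_def, THEN conjunct2]
  obtain g where g: "coarse_map Z Y g" "close_on Z (id \<circ> g) id" by (elim exE conjE)
  have gY: "g ` Z \<subseteq> Y" using g(1) unfolding coarse_map_def by (rule conjunct1)
  from g(2) obtain C where C: "\<forall>z\<in>Z. dist ((id \<circ> g) z) (id z) \<le> C" unfolding close_on_def by (rule exE)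
  have "\<exists>y\<in>Y. dist z y \<le> max C 0" if z: "z \<in> Z" for z
  proof (rule bexI[of _ "g z"])
    show "dist z (g z) \<le> max C 0" using bspec[OF C z] by (simp add: dist_commute)
  qed (use gY z in blast)
  then show ?thesis by (intro exI[of _ "max C 0"]) simp
qed

lemma refinementI:
  assumes "\<And>U. U \<in> \<U> \<Longrightarrow> \<exists>W\<in>\<V>. U \<subseteq> W" shows "\<exists>f. refinement \<U> \<V> f"
proof -
  have "\<forall>U\<in>\<U>. \<exists>W. W \<in> \<V> \<and> U \<subseteq> W" using assms by blast
  from bchoice[OF this] show ?thesis unfolding refinement_def .
qed

lemma homologous_nmult:
  assumes "homologous p \<U> q x y" shows "homologous p \<U> q (nmult j x) (nmult j y)"
proof -
  obtain e where e: "e \<in> chains p \<U> (Suc q)" "boundary (nbr \<U>) e = x - y"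
    using assms unfolding homologous_def by (rule bexE)
  have "nmult j e \<in> chains p \<U> (Suc q)" unfolding nmult_def using e(1) by (intro chains_sum)
  moreover have "boundary (nbr \<U>) (nmult j e) = nmult j x - nmult j y"
    unfolding additive_nmult_commute[OF additive_boundary] e(2) by (rule additive.diff[OF additive_nmult])
  ultimately show ?thesis unfolding homologous_def by (intro bexI)
qed

text \<open>Primality of \<open>p\<close> enters here: \<open>j\<close> is invertible modulo
  \<open>p\<close>, so a surviving class survives multiplication by \<open>j\<close>.\<close>

lemma nmult_invertible:
  assumes p: "prime p" and j: "0 < j" "j < p" and x: "nmult p x = 0"
  shows "\<exists>i. nmult i (nmult j x) = x"
proof -
  have "coprime j p" using p j by (metis coprime_commute nat_dvd_not_less prime_imp_coprime)
  then obtain i where "[j * i = 1] (mod p)" using cong_solve_coprime_nat by auto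
  then have "(i * j) mod p = 1" using prime_gt_1_nat[OF p] by (simp add: cong_def mult.commute)
  then have ij: "i * j = 1 + (i * j div p) * p" by (metis add.commute div_mult_mod_eq)
  have "nmult i (nmult j x) = nmult (1 + (i * j div p) * p) x" unfolding nmult_mult[symmetric] ij[symmetric] ..
  also have "\<dots> = nmult 1 x + nmult (i * j div p) (nmult p x)" by (simp only: nmult_add nmult_mult)
  also have "\<dots> = x" unfolding x additive.zero[OF additive_nmult] by (simp add: nmult_Suc)
  finally show ?thesis by blast
qed

lemma coarsening_systemD:
  assumes "coarsening_system S \<U> \<rho>"
  shows "U \<in> \<U> n \<Longrightarrow> U \<subseteq> S" "\<exists>d. \<forall>U\<in>\<U> n. \<forall>x\<in>U. \<forall>y\<in>U. dist x y \<le> d"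
    "\<exists>k\<ge>n. \<forall>A\<subseteq>S. A \<noteq> {} \<longrightarrow> (\<forall>x\<in>A. \<forall>y\<in>A. dist x y \<le> d) \<longrightarrow> (\<exists>U\<in>\<U> k - {{}}. A \<subseteq> U)"
proof -
  note cs = assms[unfolded coarsening_system_def]
  have u: "uniform_covering S (\<U> n)" for n using cs[THEN conjunct1] by (rule spec)
  show "U \<in> \<U> n \<Longrightarrow> U \<subseteq> S" using u[of n, unfolded uniform_covering_def, THEN conjunct1] by blast
  obtain R :: "nat \<Rightarrow> real" where R: "filterlim R at_top sequentially"
    "\<forall>n. \<forall>U\<in>\<U> n. \<forall>x\<in>U. \<forall>y\<in>U. dist x y \<le> R n" "\<forall>n. lebesgue_number_ge S (\<U> (Suc n)) (R n)"
    using cs[THEN conjunct2, THEN conjunct1] by (elim exE conjE)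
  show "\<exists>d. \<forall>U\<in>\<U> n. \<forall>x\<in>U. \<forall>y\<in>U. dist x y \<le> d" using R(2)[THEN spec, of n] by (rule exI)
  have "eventually (\<lambda>k. d \<le> R k) sequentially" using R(1) unfolding filterlim_at_top by (rule spec)
  then obtain k0 where k0: "\<forall>k\<ge>k0. d \<le> R k" unfolding eventually_sequentially by (rule exE)
  define k where "k = max k0 n"
  have k: "d \<le> R k" "k \<ge> n" using k0 by (simp_all add: k_def)
  show "\<exists>k\<ge>n. \<forall>A\<subseteq>S. A \<noteq> {} \<longrightarrow> (\<forall>x\<in>A. \<forall>y\<in>A. dist x y \<le> d) \<longrightarrow> (\<exists>U\<in>\<U> k - {{}}. A \<subseteq> U)"
  proof (intro exI[of _ "Suc k"] conjI allI impI)
    fix A assume A: "A \<subseteq> S" "A \<noteq> {}" "\<forall>x\<in>A. \<forall>y\<in>A. dist x y \<le> d"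
    have "\<forall>x\<in>A. \<forall>y\<in>A. dist x y \<le> R k" using A(3) k(1) order_trans by blast
    then have "\<exists>U\<in>\<U> (Suc k). A \<subseteq> U"
      using R(3)[THEN spec, of k, unfolded lebesgue_number_ge_def, THEN spec, THEN mp, THEN mp, OF A(1)] A(2) by blast
    then show "\<exists>U\<in>\<U> (Suc k) - {{}}. A \<subseteq> U" using A(2) by blast
  qed (use k in simp)
qed

section \<open>Comparison of the equivariant system with coarsening systems\<close>

context eq_system
begin

lemma Vs_diam: "U \<in> Vs n \<Longrightarrow> x \<in> U \<Longrightarrow> y \<in> U \<Longrightarrow> dist x y \<le> D n"
  using V_diam by (auto simp: Vs_iff)

text \<open>In both systems every stage has bounded diameters and the Lebesgue numbers tend to
  infinity, so each stage of one refines some stage of the other.\<close>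

lemma class_bound_Vs:
  fixes \<U> :: "nat \<Rightarrow> 'a set set"
  assumes cs: "coarsening_system UNIV \<U> \<rho>"
    and cb: "refining_system.class_bound (\<lambda>n. \<U> n - {{}}) \<rho> TYPE('k::ab_group_add) p q M"
  shows "class_bound TYPE('k) p q M"
proof (rule class_bound_transfer[OF coarsening_refining[OF cs] refining_system_axioms])
  fix n
  obtain d where d: "\<forall>U\<in>\<U> n. \<forall>x\<in>U. \<forall>y\<in>U. dist x y \<le> d" using coarsening_systemD(2)[OF cs] by (rule exE)
  obtain k where k: "\<forall>m\<ge>k. \<forall>x. \<exists>t<N. \<exists>U\<in>V m t. cball x d \<subseteq> U" using V_leb by (rule exE)
  have "\<exists>W\<in>Vs k. U \<subseteq> W" if U: "U \<in> \<U> n - {{}}" for U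
  proof -
    obtain x where x: "x \<in> U" using U by blast
    obtain t W where W: "t < N" "W \<in> V k t" "cball x d \<subseteq> W" using k by blast
    have "U \<subseteq> cball x d" using d U x by auto
    then show ?thesis using W Vs_iff by blast
  qed
  from refinementI[OF this] show "\<exists>k f. refinement (\<U> n - {{}}) (Vs k) f" by blast
  obtain l where l: "\<forall>A\<subseteq>UNIV. A \<noteq> {} \<longrightarrow> (\<forall>x\<in>A. \<forall>y\<in>A. dist x y \<le> D n) \<longrightarrow> (\<exists>U\<in>\<U> l - {{}}. A \<subseteq> U)"
    using coarsening_systemD(3)[OF cs, of n "D n"] by (elim exE conjE)
  have "\<exists>W\<in>\<U> l - {{}}. U \<subseteq> W" if U: "U \<in> Vs n" for U
    using l[THEN spec, of U] lf_family_ne[OF lf U] Vs_diam[OF U] by simp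
  from refinementI[OF this] show "\<exists>k f. refinement (Vs n) (\<U> k - {{}}) f" by blast
qed (rule cb)

text \<open>Covering sets of \<open>Y\<close> lie in large members of the equivariant system, which
  are fixed because they contain points of \<open>Y\<close> together with their translates.
  Conversely, points of a fixed member are displaced by at most its diameter and so lie near
  \<open>Y\<close>, which gives a simplicial map back to a coarser covering of \<open>Y\<close>. The
  round trip is homologous to the transition map of \<open>Y\<close>, so a multiple of
  \<open>w'\<close> that bounds would contradict the survival of \<open>w\<close>.\<close>

lemma fixed_class:
  fixes Y :: "'a set" and w :: "'a set list \<Rightarrow> 'k::ab_group_add"
  assumes p: "prime p"
    and cs: "coarsening_system Y \<W> \<sigma>" and w: "w \<in> cycles p (\<W> n1 - {{}}) r"
    and nz: "\<And>k. k \<ge> n1 \<Longrightarrow> \<not> homologous p (\<W> k - {{}}) r (refining_system.trp (\<lambda>n. \<W> n - {{}}) \<sigma> n1 k w) 0"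
    and Yfix: "\<And>y g. y \<in> Y \<Longrightarrow> g \<in> \<Gamma> \<Longrightarrow> dist y (g y) \<le> k2"
    and dense: "\<And>d. \<exists>C\<ge>0. \<forall>x. (\<forall>g\<in>\<Gamma>. dist x (g x) \<le> d) \<longrightarrow> (\<exists>y\<in>Y. dist x y \<le> C)"
  shows "\<exists>n0. \<exists>w'::'a set list \<Rightarrow> 'k. w' \<in> cycles p (Fx n0) r \<and>
    (\<forall>j k. 0 < j \<longrightarrow> j < p \<longrightarrow> n0 \<le> k \<longrightarrow> \<not> homologous p (Fx k) r (F.trp n0 k (nmult j w')) 0)"
proof -
  interpret W: refining_system "\<lambda>n. \<W> n - {{}}" \<sigma> by (rule coarsening_refining[OF cs])
  obtain d where d: "\<forall>U\<in>\<W> n1. \<forall>x\<in>U. \<forall>y\<in>U. dist x y \<le> d" using coarsening_systemD(2)[OF cs] by (rule exE)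
  \<comment> \<open>Radius \<open>d\<close> makes room for a whole covering set; radius
    \<open>k2\<close> makes the member contain the translates of a point of \<open>Y\<close>, so
    that it is fixed.\<close>
  obtain n0 where n0: "\<forall>m\<ge>n0. \<forall>x. \<exists>t<N. \<exists>U\<in>V m t. cball x (max d k2) \<subseteq> U" using V_leb by (rule exE)
  have "\<exists>W\<in>Fx n0. U \<subseteq> W" if U: "U \<in> \<W> n1 - {{}}" for U
  proof -
    obtain x where x: "x \<in> U" using U by blast
    have xY: "x \<in> Y" using coarsening_systemD(1)[OF cs, of U n1] U x by blast
    obtain t W where W: "t < N" "W \<in> V n0 t" "cball x (max d k2) \<subseteq> W" using n0 by blast
    have "U \<subseteq> cball x (max d k2)" using d U x by force
    moreover have "W \<in> Fx n0" unfolding Fx_def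
    proof (intro CollectI conjI ballI)
      show WV: "W \<in> Vs n0" using W(1,2) Vs_iff by blast
      fix g assume g: "g \<in> \<Gamma>"
      have "dist x (g x) \<le> max d k2" using Yfix[OF xY g] by simp
      then have "g x \<in> W" using W(3) by (auto simp: mem_cball)
      moreover have "0 \<le> max d k2" using order_trans[OF zero_le_dist Yfix[OF xY g]] by simp
      then have "x \<in> W" using W(3) by auto
      ultimately show "g ` W = W" by (intro same_colour[OF WV g]) blast
    qed
    ultimately show ?thesis using W(3) by blast
  qed
  from refinementI[OF this] obtain f0 where f0: "refinement (\<W> n1 - {{}}) (Fx n0) f0" by (rule exE)
  have f0s: "simp_map (\<W> n1 - {{}}) (Fx n0) f0" by (rule refinement_simp_map[OF W.lf F.lf f0])
  define w' where "w' = push (\<W> n1 - {{}}) f0 w"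
  have w': "w' \<in> cycles p (Fx n0) r" unfolding w'_def by (rule push_cycles[OF f0s W.lfin F.lfin w])
  have False if j: "0 < j" "j < p" and k: "n0 \<le> k"
    and h0: "homologous p (Fx k) r (F.trp n0 k (nmult j w')) 0" for j k
  proof -
    obtain C where C: "C \<ge> 0" "\<forall>x. (\<forall>g\<in>\<Gamma>. dist x (g x) \<le> D k) \<longrightarrow> (\<exists>y\<in>Y. dist x y \<le> C)"
      using dense[of "D k"] by (elim exE conjE)
    \<comment> \<open>The trace on \<open>Y\<close> of the \<open>C\<close>-neighbourhood of
      \<open>U\<close>: the set \<open>U\<close> itself need not meet \<open>Y\<close>.\<close>
    define NY where "NY = (\<lambda>U. {y \<in> Y. \<exists>u\<in>U. dist u y \<le> C})"
    have near: "\<exists>y\<in>Y. dist x y \<le> C" if U: "U \<in> Fx k" "x \<in> U" for U x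
    proof -
      have "dist x (g x) \<le> D k" if g: "g \<in> \<Gamma>" for g
      proof (rule Vs_diam[of U])
        show "U \<in> Vs k" using U(1) Fx_sub by blast
        have "g ` U = U" using U(1) g unfolding Fx_def by blast
        then show "g x \<in> U" using U(2) by blast
      qed (rule U(2))
      then show ?thesis using C(2) by blast
    qed
    obtain l where l: "l \<ge> n1"
      "\<forall>A\<subseteq>Y. A \<noteq> {} \<longrightarrow> (\<forall>x\<in>A. \<forall>y\<in>A. dist x y \<le> D k + 2 * C) \<longrightarrow> (\<exists>U\<in>\<W> l - {{}}. A \<subseteq> U)"
      using coarsening_systemD(3)[OF cs, of n1 "D k + 2 * C"] by (elim exE conjE)
    have "\<exists>W. W \<in> \<W> l - {{}} \<and> NY U \<subseteq> W" if U: "U \<in> Fx k" for U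
    proof -
      have UV: "U \<in> Vs k" using U Fx_sub by blast
      obtain x where x: "x \<in> U" using lf_family_ne[OF lf UV] by blast
      have "NY U \<noteq> {}" using near[OF U x] x unfolding NY_def by blast
      moreover have "dist y z \<le> D k + 2 * C" if yz: "y \<in> NY U" "z \<in> NY U" for y z
      proof -
        obtain u v where uv: "u \<in> U" "dist u y \<le> C" "v \<in> U" "dist v z \<le> C"
          using yz unfolding NY_def by blast
        have "dist y z \<le> dist u y + (dist u v + dist v z)"
          by (metis dist_commute dist_triangle_le dist_triangle add_left_mono order_trans)
        then show ?thesis using uv Vs_diam[OF UV uv(1,3)] by linarith
      qed
      moreover have "NY U \<subseteq> Y" unfolding NY_def by blast
      ultimately show ?thesis using l(2) by blast
    qed
    then have "\<forall>U\<in>Fx k. \<exists>W. W \<in> \<W> l - {{}} \<and> NY U \<subseteq> W" by blast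
    from bchoice[OF this] obtain g where g: "\<forall>U\<in>Fx k. g U \<in> \<W> l - {{}} \<and> NY U \<subseteq> g U" by (rule exE)
    \<comment> \<open>Members of \<open>Fx k\<close> are not subsets of \<open>Y\<close>, so
      \<open>g\<close> is not a refinement and must be checked directly. One point of
      \<open>Y\<close> near a common point of the simplex lies in all the sets
      \<open>NY U\<close>.\<close>
    have gs: "simp_map (Fx k) (\<W> l - {{}}) g"
      unfolding simp_map_def
    proof (intro conjI allI impI)
      fix W
      show "finite {U \<in> Fx k. g U = W}"
      proof (cases "W \<in> \<W> l - {{}}")
        case True
        then have "bounded W" by (rule lf_family_bounded[OF W.lf])
        then obtain c e where ce: "\<forall>y\<in>W. dist c y \<le> e" unfolding bounded_def by blast
        have "{U \<in> Fx k. g U = W} \<subseteq> {U \<in> Fx k. U \<inter> cball c (e + C) \<noteq> {}}"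
        proof
          fix U assume U: "U \<in> {U \<in> Fx k. g U = W}"
          then have UF: "U \<in> Fx k" by simp
          obtain x where x: "x \<in> U" using lf_family_ne[OF F.lf UF] by blast
          obtain y where y: "y \<in> Y" "dist x y \<le> C" using near[OF UF x] by blast
          then have "y \<in> NY U" using x unfolding NY_def by blast
          then have "y \<in> W" using g U by blast
          then have "dist c y \<le> e" using ce by blast
          then have "dist c x \<le> e + C" using y(2) dist_triangle[of c x y] by (simp add: dist_commute)
          then have "x \<in> U \<inter> cball c (e + C)" using x by simp
          then show "U \<in> {U \<in> Fx k. U \<inter> cball c (e + C) \<noteq> {}}" using UF by blast
        qed
        then show ?thesis by (rule finite_subset) (rule lf_family_finite[OF F.lf bounded_cball])
      next
        case False
        then have e: "{U \<in> Fx k. g U = W} = {}" using g by blast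
        show ?thesis unfolding e by simp
      qed
    next
      fix \<tau> assume t: "\<tau> \<subseteq> Fx k" "\<Inter>\<tau> \<noteq> {}" "\<tau> \<noteq> {}"
      show "g ` \<tau> \<subseteq> \<W> l - {{}}" using g t(1) by blast
      obtain x where x: "\<forall>U\<in>\<tau>. x \<in> U" using t(2) by blast
      obtain U0 where U0: "U0 \<in> \<tau>" using t(3) by blast
      then obtain y where y: "y \<in> Y" "dist x y \<le> C" using near[of U0 x] x t(1) by blast
      have "y \<in> g U" if U: "U \<in> \<tau>" for U
      proof -
        have "y \<in> NY U" unfolding NY_def using y x U by blast
        then show ?thesis using g t(1) U by blast
      qed
      then show "\<Inter>(g ` \<tau>) \<noteq> {}" by blast
    qed
    define f1 where "f1 = F.tr n0 k \<circ> f0"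
    have f1: "refinement (\<W> n1 - {{}}) (Fx k) f1" unfolding f1_def
      by (rule refinement_comp[OF f0 F.tr_refinement[OF k]])
    have f1s: "simp_map (\<W> n1 - {{}}) (Fx k) f1" by (rule refinement_simp_map[OF W.lf F.lf f1])
    \<comment> \<open>Although \<open>g\<close> is no refinement, the composite is one: a point of
      \<open>U\<close> lies in \<open>Y\<close> and is at distance 0 from the enlarged set.\<close>
    have h: "refinement (\<W> n1 - {{}}) (\<W> l - {{}}) (g \<circ> f1)"
      unfolding refinement_def
    proof
      fix U assume U: "U \<in> \<W> n1 - {{}}"
      have f1U: "f1 U \<in> Fx k" "U \<subseteq> f1 U" using f1 U unfolding refinement_def by blast+
      have "U \<subseteq> Y" using coarsening_systemD(1)[OF cs] U by blast
      have "U \<subseteq> NY (f1 U)" unfolding NY_def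
      proof (intro subsetI CollectI conjI)
        fix y assume y: "y \<in> U"
        show "y \<in> Y" using \<open>U \<subseteq> Y\<close> y by blast
        show "\<exists>u\<in>f1 U. dist u y \<le> C" using f1U(2) C(1) y by (intro bexI[of _ y]) auto
      qed
      then show "(g \<circ> f1) U \<in> \<W> l - {{}} \<and> U \<subseteq> (g \<circ> f1) U" using g f1U(1) unfolding comp_apply by blast
    qed
    have in1: "f0 v \<in> Fx n0" "f1 v \<in> Fx k" if "v \<in> \<W> n1 - {{}}" for v
      using f0 f1 that unfolding refinement_def by blast+
    have "F.trp n0 k w' = push (\<W> n1 - {{}}) f1 w"
      unfolding F.trp_def w'_def f1_def
      by (rule ext, rule push_push[OF in1(1) simp_map_fin[OF f0s] simp_map_fin[OF F.tr_simp_map[OF k]]])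
    then have "push (Fx k) g (F.trp n0 k w') = push (\<W> n1 - {{}}) (g \<circ> f1) w"
      by (simp only:) (rule ext, rule push_push[OF in1(2) simp_map_fin[OF f1s] simp_map_fin[OF gs]])
    moreover have "push (Fx k) g (F.trp n0 k (nmult j w')) = nmult j (push (Fx k) g (F.trp n0 k w'))"
      unfolding additive_nmult_commute[OF F.additive_trp] additive_nmult_commute[OF additive_push] ..
    moreover have "homologous p (\<W> l - {{}}) r (push (Fx k) g (F.trp n0 k (nmult j w'))) (push (Fx k) g 0)"
      by (rule push_homologous[OF gs F.lfin W.lfin h0])
    ultimately have 1: "homologous p (\<W> l - {{}}) r (nmult j (push (\<W> n1 - {{}}) (g \<circ> f1) w)) 0"
      unfolding additive.zero[OF additive_push] by (simp only:)
    have 2: "homologous p (\<W> l - {{}}) r (W.trp n1 l w) (push (\<W> n1 - {{}}) (g \<circ> f1) w)"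
      unfolding W.trp_def by (rule refinements_homologous[OF W.lf W.lf h W.tr_refinement[OF l(1)] w])
    have 3: "homologous p (\<W> l - {{}}) r (nmult j (W.trp n1 l w)) 0"
      by (rule homologous_trans[OF homologous_nmult[OF 2] 1])
    have "w \<in> chains p (\<W> n1 - {{}}) r" using w unfolding cycles_def by blast
    then have "W.trp n1 l w \<in> chains p (\<W> l - {{}}) r" by (rule W.trp_chains[OF l(1)])
    then have "nmult p (W.trp n1 l w) = 0"
      using chains_tors by (auto simp: fun_eq_iff nmult_def sum_fun_apply)
    from nmult_invertible[OF p j this] obtain i where i: "nmult i (nmult j (W.trp n1 l w)) = W.trp n1 l w" by (rule exE)
    \<comment> \<open>Multiplying by an inverse of \<open>j\<close> modulo \<open>p\<close> turns
      the vanishing of the multiple into that of the class itself.\<close>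
    have "homologous p (\<W> l - {{}}) r (W.trp n1 l w) 0"
      using homologous_nmult[OF 3, of i] unfolding i additive.zero[OF additive_nmult] .
    then show False using nz[OF l(1)] by contradiction
  qed
  then show ?thesis using w' by blast
qed

end

section \<open>The action as a group of isometries, and displacement bounds\<close>

lemma isometric_actionD:
  assumes "isometric_action G \<phi>"
  shows "group G" "g \<in> carrier G \<Longrightarrow> h \<in> carrier G \<Longrightarrow> \<phi> (g \<otimes>\<^bsub>G\<^esub> h) = \<phi> g \<circ> \<phi> h" "\<phi> \<one>\<^bsub>G\<^esub> = id"
    "g \<in> carrier G \<Longrightarrow> dist (\<phi> g x) (\<phi> g y) = dist x y"
proof -
  have act: "group_action G UNIV \<phi>" using assms unfolding isometric_action_def by (rule conjunct1)
  then interpret group_action G UNIV \<phi> .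
  show "group G" using group_hom unfolding group_hom_def by (rule conjunct1)
  show "g \<in> carrier G \<Longrightarrow> h \<in> carrier G \<Longrightarrow> \<phi> (g \<otimes>\<^bsub>G\<^esub> h) = \<phi> g \<circ> \<phi> h"
    by (rule ext) (simp only: composition_rule[OF UNIV_I] comp_apply)
  show "\<phi> \<one>\<^bsub>G\<^esub> = id" unfolding id_eq_one[symmetric] id_def restrict_def by simp
  show "g \<in> carrier G \<Longrightarrow> dist (\<phi> g x) (\<phi> g y) = dist x y" 
    by (rule assms[unfolded isometric_action_def, THEN conjunct2, THEN bspec, THEN spec, THEN spec])
qed

lemma isometric_action_inv:
  assumes "isometric_action G \<phi>" "g \<in> carrier G"
  shows "\<phi> g \<circ> \<phi> (inv\<^bsub>G\<^esub> g) = id" "\<phi> (inv\<^bsub>G\<^esub> g) \<circ> \<phi> g = id"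
proof -
  interpret group G by (rule isometric_actionD(1)[OF assms(1)])
  show "\<phi> g \<circ> \<phi> (inv\<^bsub>G\<^esub> g) = id" "\<phi> (inv\<^bsub>G\<^esub> g) \<circ> \<phi> g = id"
    unfolding isometric_actionD(2)[OF assms inv_closed[OF assms(2)], symmetric]
      isometric_actionD(2)[OF assms(1) inv_closed[OF assms(2)] assms(2), symmetric]
      r_inv[OF assms(2)] l_inv[OF assms(2)] isometric_actionD(3)[OF assms(1)] by (rule refl)+
qed

lemma isometry_group_image:
  assumes "isometric_action G \<phi>" "finite (carrier G)"
  shows "isometry_group (\<phi> ` carrier G)"
proof
  interpret group G by (rule isometric_actionD(1)[OF assms(1)])
  note D = isometric_actionD[OF assms(1)]
  show "finite (\<phi> ` carrier G)" using assms(2) by simp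
  show "id \<in> \<phi> ` carrier G" using imageI[OF one_closed, of \<phi>] unfolding D(3) .
  show "g \<circ> h \<in> \<phi> ` carrier G" if gh: "g \<in> \<phi> ` carrier G" "h \<in> \<phi> ` carrier G" for g h
  proof -
    obtain x y where "x \<in> carrier G" "y \<in> carrier G" "g = \<phi> x" "h = \<phi> y" using gh by (elim imageE)
    then show ?thesis by (intro image_eqI[of _ _ "x \<otimes>\<^bsub>G\<^esub> y"]) (simp_all only: D(2) m_closed)
  qed
  show "\<exists>h\<in>\<phi> ` carrier G. g \<circ> h = id \<and> h \<circ> g = id" if g: "g \<in> \<phi> ` carrier G" for g
  proof -
    obtain x where "x \<in> carrier G" "g = \<phi> x" using g by (elim imageE)
    then show ?thesis
      by (intro bexI[of _ "\<phi> (inv\<^bsub>G\<^esub> x)"]) (simp_all only: isometric_action_inv[OF assms(1)] inv_closed imageI)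
  qed
  show "dist (g x) (g y) = dist x y" if "g \<in> \<phi> ` carrier G" for g x y using that D(4) by blast
qed

lemma setwise_stabilizer_subgroup:
  assumes act: "isometric_action G \<phi>"
  shows "subgroup {g \<in> carrier G. \<phi> g ` U = U} G"
proof -
  interpret group G by (rule isometric_actionD(1)[OF act])
  note D = isometric_actionD[OF act]
  show ?thesis
  proof
    show "{g \<in> carrier G. \<phi> g ` U = U} \<subseteq> carrier G" by blast
    show "\<one>\<^bsub>G\<^esub> \<in> {g \<in> carrier G. \<phi> g ` U = U}" by (simp add: D(3))
    fix g assume g: "g \<in> {g \<in> carrier G. \<phi> g ` U = U}"
    then have gc: "g \<in> carrier G" "\<phi> g ` U = U" by simp_all
    show "g \<otimes>\<^bsub>G\<^esub> h \<in> {g \<in> carrier G. \<phi> g ` U = U}" if h: "h \<in> {g \<in> carrier G. \<phi> g ` U = U}" for h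
    proof -
      have hc: "h \<in> carrier G" "\<phi> h ` U = U" using h by simp_all
      have "\<phi> (g \<otimes>\<^bsub>G\<^esub> h) ` U = U" unfolding D(2)[OF gc(1) hc(1)] image_comp[symmetric] gc(2) hc(2) ..
      then show ?thesis using m_closed[OF gc(1) hc(1)] by blast
    qed
    have "\<phi> (inv\<^bsub>G\<^esub> g) ` U = (\<phi> (inv\<^bsub>G\<^esub> g) \<circ> \<phi> g) ` U" unfolding image_comp[symmetric] gc(2) ..
    then show "inv\<^bsub>G\<^esub> g \<in> {g \<in> carrier G. \<phi> g ` U = U}"
      using gc(1) isometric_action_inv(2)[OF act gc(1)] by simp
  qed
qed

lemma bounded_fixed_set_dense:
  assumes "is_bounded_fixed_set \<phi> H Y"
  shows "\<exists>C\<ge>0. \<forall>x\<in>fixed_within \<phi> H d. \<exists>y\<in>Y. dist x y \<le> C"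
proof -
  obtain k where "\<forall>l\<ge>k. coarse_equivalence Y (fixed_within \<phi> H l) id"
    using assms unfolding is_bounded_fixed_set_def by (elim exE conjE)
  then have "coarse_equivalence Y (fixed_within \<phi> H (max k d)) id" by simp
  from coarse_equivalence_dense[OF this] obtain C
    where C: "C \<ge> 0" "\<forall>x\<in>fixed_within \<phi> H (max k d). \<exists>y\<in>Y. dist x y \<le> C" by (elim exE conjE)
  have "fixed_within \<phi> H d \<subseteq> fixed_within \<phi> H (max k d)" unfolding fixed_within_def by (auto simp: le_max_iff_disj)
  then show ?thesis using C by (intro exI[of _ C]) blast
qed

lemma bounded_fixed_set_subset:
  assumes "is_bounded_fixed_set \<phi> H Y" obtains k where "Y \<subseteq> fixed_within \<phi> H k"
  using assms unfolding is_bounded_fixed_set_def by blast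

text \<open>A point moved little by a nontrivial subgroup is close to the common set
  \<open>Y\<close>, and \<open>Y\<close> is moved a bounded distance by the whole group; hence so is
  the point. The bound can be taken uniform because there are finitely many subgroups.\<close>

lemma semifree_displacement:
  assumes act: "isometric_action G \<phi>" and fin: "finite (carrier G)" and sf: "semifree_at_large_scale G \<phi>"
  shows "\<exists>K. \<forall>H. subgroup H G \<longrightarrow> H \<noteq> {\<one>\<^bsub>G\<^esub>} \<longrightarrow> fixed_within \<phi> H d \<subseteq> fixed_within \<phi> (carrier G) K"
proof -
  interpret group G by (rule isometric_actionD(1)[OF act])
  obtain Y where Y: "\<And>H. subgroup H G \<Longrightarrow> H \<noteq> {\<one>\<^bsub>G\<^esub>} \<Longrightarrow> is_bounded_fixed_set \<phi> H Y"
    using sf unfolding semifree_at_large_scale_def by blast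
  define S where "S = {H. subgroup H G \<and> H \<noteq> {\<one>\<^bsub>G\<^esub>}}"
  have "S \<subseteq> Pow (carrier G)" unfolding S_def using subgroup.subset by blast
  then have finS: "finite S" by (rule finite_subset) (simp add: fin)
  have "\<exists>K. fixed_within \<phi> H d \<subseteq> fixed_within \<phi> (carrier G) K" if "H \<in> S" for H
  proof -
    have H: "subgroup H G" "H \<noteq> {\<one>\<^bsub>G\<^esub>}" using that by (simp_all add: S_def)
    \<comment> \<open>The whole group contains a nontrivial subgroup, so the common \<open>Y\<close>
      is also a bounded fixed set for it.\<close>
    have "carrier G \<noteq> {\<one>\<^bsub>G\<^esub>}" using H subgroup.subset[OF H(1)] subgroup.one_closed[OF H(1)] by blast
    then have "is_bounded_fixed_set \<phi> (carrier G) Y" by (intro Y subgroup_self)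
    then obtain k where k: "Y \<subseteq> fixed_within \<phi> (carrier G) k" by (rule bounded_fixed_set_subset)
    obtain C where C: "\<forall>x\<in>fixed_within \<phi> H d. \<exists>y\<in>Y. dist x y \<le> C"
      using bounded_fixed_set_dense[OF Y[OF H], of d] by (elim exE conjE)
    have "dist x (\<phi> g x) \<le> k + 2 * C" if x: "x \<in> fixed_within \<phi> H d" and g: "g \<in> carrier G" for x g
    proof -
      obtain y where y: "y \<in> Y" "dist x y \<le> C" using C x by blast
      have "dist y (\<phi> g y) \<le> k" using k y(1) g unfolding fixed_within_def by blast
      moreover have "dist (\<phi> g x) (\<phi> g y) \<le> C" using isometric_actionD(4)[OF act g] y(2) by simp
      ultimately show ?thesis
        using y(2) dist_triangle[of x "\<phi> g x" y] dist_triangle[of y "\<phi> g x" "\<phi> g y"]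
        by (simp add: dist_commute)
    qed
    then show ?thesis unfolding fixed_within_def by blast
  qed
  then have "\<forall>H\<in>S. \<exists>K. fixed_within \<phi> H d \<subseteq> fixed_within \<phi> (carrier G) K" by blast
  from bchoice[OF this] obtain K where K: "\<forall>H\<in>S. fixed_within \<phi> H d \<subseteq> fixed_within \<phi> (carrier G) (K H)"
    by (rule exE)
  have "fixed_within \<phi> H d \<subseteq> fixed_within \<phi> (carrier G) (Max (K ` S))" if H: "H \<in> S" for H
  proof -
    have "K H \<le> Max (K ` S)" using finS H by simp
    then have "fixed_within \<phi> (carrier G) (K H) \<subseteq> fixed_within \<phi> (carrier G) (Max (K ` S))"
      unfolding fixed_within_def using order_trans by blast
    then show ?thesis using K H by blast
  qed
  then show ?thesis unfolding S_def by blast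
qed

lemma integer_mod_square_generators:
  fixes \<phi> :: "int \<times> int \<Rightarrow> 'a::metric_space \<Rightarrow> 'a" and p :: nat
  defines "G \<equiv> integer_mod_group p \<times>\<times> integer_mod_group p"
  assumes act: "isometric_action G \<phi>" and p: "p > 1"
  shows "\<phi> (int i mod int p, int j mod int p) = \<phi> (1, 0) ^^ i \<circ> \<phi> (0, 1) ^^ j"
    and "\<phi> (1, 0) \<circ> \<phi> (0, 1) = \<phi> (0, 1) \<circ> \<phi> (1, 0)"
proof -
  have c: "carrier G = {0..<int p} \<times> {0..<int p}" using p by (simp add: G_def carrier_integer_mod_group)
  have m: "(x, y) \<otimes>\<^bsub>G\<^esub> (x', y') = ((x + x') mod int p, (y + y') mod int p)" for x y x' y' by (simp add: G_def)
  have o: "\<phi> (0, 0) = id" using isometric_actionD(3)[OF act] by (simp add: G_def)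
  have f: "\<phi> ((x + x') mod int p, (y + y') mod int p) = \<phi> (x, y) \<circ> \<phi> (x', y')"
    if "x \<in> {0..<int p}" "y \<in> {0..<int p}" "x' \<in> {0..<int p}" "y' \<in> {0..<int p}" for x y x' y'
    using isometric_actionD(2)[OF act, of "(x, y)" "(x', y')"] that unfolding c m by simp
  have in_p: "int i mod int p \<in> {0..<int p}" "1 \<in> {0..<int p}" "0 \<in> {0..<int p}" for i using p by simp_all
  have a: "\<phi> (int i mod int p, 0) = \<phi> (1, 0) ^^ i" for i
  proof (induction i)
    case (Suc i)
    have "\<phi> (int (Suc i) mod int p, 0) = \<phi> ((1 + int i mod int p) mod int p, (0 + 0) mod int p)"
      by (simp add: mod_add_right_eq)
    also have "\<dots> = \<phi> (1, 0) \<circ> \<phi> (int i mod int p, 0)" by (rule f[OF in_p(2,3,1,3)])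
    finally show ?case by (simp add: Suc)
  qed (simp add: o)
  have b: "\<phi> (0, int j mod int p) = \<phi> (0, 1) ^^ j" for j
  proof (induction j)
    case (Suc j)
    have "\<phi> (0, int (Suc j) mod int p) = \<phi> ((0 + 0) mod int p, (1 + int j mod int p) mod int p)"
      by (simp add: mod_add_right_eq)
    also have "\<dots> = \<phi> (0, 1) \<circ> \<phi> (0, int j mod int p)" by (rule f[OF in_p(3,2,3,1)])
    finally show ?case by (simp add: Suc)
  qed (simp add: o)
  show "\<phi> (int i mod int p, int j mod int p) = \<phi> (1, 0) ^^ i \<circ> \<phi> (0, 1) ^^ j"
    using f[OF in_p(1)[of i] in_p(3) in_p(3) in_p(1)[of j]] unfolding a b by simp
  show "\<phi> (1, 0) \<circ> \<phi> (0, 1) = \<phi> (0, 1) \<circ> \<phi> (1, 0)"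
    using f[OF in_p(2,3,3,2)] f[OF in_p(3,2,2,3)] by simp
qed

lemma no_semifree_action:
  fixes \<phi> :: "int \<times> int \<Rightarrow> 'a::metric_space \<Rightarrow> 'a" and p :: nat
  defines "G \<equiv> integer_mod_group p \<times>\<times> integer_mod_group p"
  assumes p: "prime p" and asd: "finite_asdim (UNIV :: 'a set)"
    and sX: "coarse_homology_sphere p m (UNIV :: 'a set)"
    and act: "isometric_action G \<phi>" and sf: "semifree_at_large_scale G \<phi>"
    and rm: "r < m" and bY: "is_bounded_fixed_set \<phi> (carrier G) Y" and sY: "coarse_homology_sphere p r Y"
  shows False
proof -
  have p1: "p > 1" using p by (rule prime_gt_1_nat)
  have c: "carrier G = {0..<int p} \<times> {0..<int p}" using p1 by (simp add: G_def carrier_integer_mod_group)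
  have fin: "finite (carrier G)" unfolding c by simp
  define \<Gamma> where "\<Gamma> = \<phi> ` carrier G"
  define a where "a = \<phi> (1, 0)"
  define b where "b = \<phi> (0, 1)"
  have ab: "\<phi> (int i mod int p, int j mod int p) = a ^^ i \<circ> b ^^ j" "a \<circ> b = b \<circ> a" for i j
    unfolding a_def b_def using integer_mod_square_generators[OF act[unfolded G_def] p1] by blast+
  have one: "\<one>\<^bsub>G\<^esub> = (0, 0)" by (simp add: G_def)
  have o: "\<phi> (0, 0) = id" using isometric_actionD(3)[OF act] unfolding one .
  have ab': "\<phi> (int i, int j) = a ^^ i \<circ> b ^^ j" if "i < p" "j < p" for i j using ab(1)[of i j] that by simp
  have \<Gamma>: "\<Gamma> = {a ^^ i \<circ> b ^^ j | i j. i < p \<and> j < p}"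
  proof (intro subset_antisym subsetI)
    fix g assume "g \<in> \<Gamma>"
    then obtain x y where xy: "g = \<phi> (x, y)" "0 \<le> x" "x < int p" "0 \<le> y" "y < int p" unfolding \<Gamma>_def c by auto
    then have "g = a ^^ nat x \<circ> b ^^ nat y" "nat x < p" "nat y < p" using ab'[of "nat x" "nat y"] by auto
    then show "g \<in> {a ^^ i \<circ> b ^^ j | i j. i < p \<and> j < p}" by blast
  next
    fix g assume "g \<in> {a ^^ i \<circ> b ^^ j | i j. i < p \<and> j < p}"
    then obtain i j where ij: "g = a ^^ i \<circ> b ^^ j" "i < p" "j < p" by blast
    then have "g = \<phi> (int i, int j)" "(int i, int j) \<in> carrier G" using ab' by (simp_all add: c)
    then show "g \<in> \<Gamma>" unfolding \<Gamma>_def by blast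
  qed
  \<comment> \<open>The exponents \<open>p\<close> and 0 have the same residue, so evaluating
    \<open>ab(1)\<close> at \<open>p\<close> compares the power with the identity.\<close>
  have ap: "a ^^ p = id" and bp: "b ^^ p = id" using ab(1)[of p 0] ab(1)[of 0 p] by (simp_all add: o)
  interpret isometry_group \<Gamma> unfolding \<Gamma>_def by (rule isometry_group_image[OF act fin])
  have proper: "proper_space (UNIV :: 'a set)" using sX unfolding coarse_homology_sphere_def by (rule conjunct1)
  obtain V D N where "eq_system \<Gamma> V D N" using eq_system_exists[OF proper asd] by (elim exE)
  then interpret eq_system \<Gamma> V D N .
  have fw: "x \<in> fixed_within \<phi> (carrier G) d \<longleftrightarrow> (\<forall>g\<in>\<Gamma>. dist x (g x) \<le> d)" for x d
    unfolding fixed_within_def \<Gamma>_def by blast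
  have stab: "\<exists>k\<ge>n. \<forall>U\<in>Vs n. (\<exists>i<p. \<exists>j<p. (i, j) \<noteq> (0, 0) \<and> (a ^^ i \<circ> b ^^ j) ` U = U) \<longrightarrow> tr n k U \<in> Fx k" for n
  proof -
    obtain K where K: "\<And>H. subgroup H G \<Longrightarrow> H \<noteq> {\<one>\<^bsub>G\<^esub>} \<Longrightarrow>
        fixed_within \<phi> H (D n) \<subseteq> fixed_within \<phi> (carrier G) K"
      using semifree_displacement[OF act fin sf, of "D n"] by blast
    define k where "k = max n (nat \<lceil>K\<rceil>)"
    have k: "K \<le> real k" "n \<le> k" unfolding k_def by linarith+
    show ?thesis
    proof (intro exI[of _ "Suc k"] conjI ballI impI)
      fix U assume U: "U \<in> Vs n" and ex: "\<exists>i<p. \<exists>j<p. (i, j) \<noteq> (0, 0) \<and> (a ^^ i \<circ> b ^^ j) ` U = U"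
      obtain i j where ij: "i < p" "j < p" "(i, j) \<noteq> (0, 0)" "(a ^^ i \<circ> b ^^ j) ` U = U"
        using ex by (elim exE conjE)
      \<comment> \<open>The stabiliser keeps \<open>x\<close> inside \<open>U\<close>, so it
        displaces \<open>x\<close> by at most the diameter bound \<open>D n\<close>. This turns a
        condition on the vertex into one on a point.\<close>
      define H where "H = {g \<in> carrier G. \<phi> g ` U = U}"
      have H: "subgroup H G" unfolding H_def by (rule setwise_stabilizer_subgroup[OF act])
      have "(int i, int j) \<in> H" unfolding H_def c using ij by (simp add: ab')
      then have H1: "H \<noteq> {\<one>\<^bsub>G\<^esub>}" unfolding one using ij(3) by auto
      obtain x where x: "x \<in> U" using lf_family_ne[OF lf U] by blast
      have "x \<in> fixed_within \<phi> H (D n)" unfolding fixed_within_def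
      proof (intro CollectI ballI)
        fix h assume "h \<in> H"
        then have "\<phi> h x \<in> U" using x unfolding H_def by blast
        then show "dist x (\<phi> h x) \<le> D n" by (rule Vs_diam[OF U x])
      qed
      then have "x \<in> fixed_within \<phi> (carrier G) K" using K[OF H H1] by blast
      then show "tr n (Suc k) U \<in> Fx (Suc k)" unfolding fw by (intro fixed_later[OF U x _ k]) blast
    qed (use k in simp)
  qed
  interpret pair_system \<Gamma> V D N a b p by standard (fact p1 \<Gamma> ap bp ab(2) stab)+
  \<comment> \<open>From the sphere \<open>UNIV\<close> only the bound on classes is taken, from the
    sphere \<open>Y\<close> only a surviving cycle.\<close>
  obtain \<U> \<rho> where U: "coarsening_system (UNIV :: 'a set) \<U> \<rho>"
    "\<forall>q. refining_system.class_bound (\<lambda>n. \<U> n - {{}}) \<rho> TYPE(qz) p q (if q = m then p else 1)"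
    using sphere_system[OF p1 sX] by (elim exE conjE)
  obtain \<W> \<sigma> n w where W: "coarsening_system Y \<W> \<sigma>"
    and w: "(w :: 'a set list \<Rightarrow> qz) \<in> cycles p (\<W> n - {{}}) r"
      "\<forall>k\<ge>n. \<not> homologous p (\<W> k - {{}}) r (refining_system.trp (\<lambda>n. \<W> n - {{}}) \<sigma> n k w) 0"
    using sphere_system[OF p1 sY] by (elim exE conjE)
  obtain k2 where k2: "Y \<subseteq> fixed_within \<phi> (carrier G) k2" using bY by (rule bounded_fixed_set_subset)
  have "\<exists>n0. \<exists>w'::'a set list \<Rightarrow> qz. w' \<in> cycles p (Fx n0) r \<and>
    (\<forall>j k. 0 < j \<longrightarrow> j < p \<longrightarrow> n0 \<le> k \<longrightarrow> \<not> homologous p (Fx k) r (F.trp n0 k (nmult j w')) 0)"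
  proof (rule fixed_class[OF p W w(1)])
    show "\<not> homologous p (\<W> k - {{}}) r (refining_system.trp (\<lambda>n. \<W> n - {{}}) \<sigma> n k w) 0" if "k \<ge> n" for k
      using w(2) that by blast
    show "dist y (g y) \<le> k2" if "y \<in> Y" "g \<in> \<Gamma>" for y g using k2 that fw by blast
    show "\<exists>C\<ge>0. \<forall>x. (\<forall>g\<in>\<Gamma>. dist x (g x) \<le> d) \<longrightarrow> (\<exists>y\<in>Y. dist x y \<le> C)" for d
      using bounded_fixed_set_dense[OF bY, of d] fw by blast
  qed
  then obtain n0 and w' :: "'a set list \<Rightarrow> qz" where w': "w' \<in> cycles p (Fx n0) r"
    "\<forall>j k. 0 < j \<longrightarrow> j < p \<longrightarrow> n0 \<le> k \<longrightarrow> \<not> homologous p (Fx k) r (F.trp n0 k (nmult j w')) 0"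
    by (elim exE conjE)
  show False
  proof (rule no_small_fixed_class[OF rm _ w'(1)])
    show "class_bound TYPE(qz) p q (if q = m then p else 1)" for q by (rule class_bound_Vs[OF U(1) U(2)[THEN spec]])
  qed (use w'(2) in blast)
qed

theorem theoremB:
  fixes p m :: nat
  assumes "prime p"
    and "proper_space (UNIV :: 'a::metric_space set)"
    and "geodesic_space (UNIV :: 'a set)"
    and "finite_asdim (UNIV :: 'a set)"
    and "coarse_homology_sphere p m (UNIV :: 'a set)"
  defines "G \<equiv> integer_mod_group p \<times>\<times> integer_mod_group p"
  shows "\<not> (\<exists>\<phi> :: int \<times> int \<Rightarrow> 'a \<Rightarrow> 'a.
              isometric_action G \<phi> \<and> tame_action G \<phi> \<and> semifree_at_large_scale G \<phi> \<and>
              (\<exists>r Y. r < m \<and> is_bounded_fixed_set \<phi> (carrier G) Y \<and>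
                     coarse_homology_sphere p r Y))"
proof (rule notI, elim exE conjE)
  fix \<phi> :: "int \<times> int \<Rightarrow> 'a \<Rightarrow> 'a" and r Y
  assume "isometric_action G \<phi>" "semifree_at_large_scale G \<phi>" "r < m"
    "is_bounded_fixed_set \<phi> (carrier G) Y" "coarse_homology_sphere p r Y"
  with assms(1,4,5) show False unfolding G_def by (intro no_semifree_action[of p m \<phi> r Y])
qed

end
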